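(* Let $k$ be a field of characteristic different from $2$ and let $G$ be a nonabelian residually torsion-free nilpotent group with an involution $\ast$. Fix a total order $<$ on $G$ making $(G,<)$ an ordered group, and let $k(G)$ be the division subring of the Malcev-Neumann series ring $k((G;<))$ generated by $k[G]$. Then $k(G)$ contains a free symmetric pair with respect to the unique $k$-involution of $k(G)$ extending the $k$-linear extension of $\ast$ to $k[G]$.
   Context: A group $G$ is residually torsion-free nilpotent if for every $1\ne g\in G$ there is a normal subgroup $N_g$ with $g\notin N_g$ and $G/N_g$ torsion-free nilpotent; such groups are orderable. A group is orderable if it has a total order $<$ with $x<y\Rightarrow zx<zy$ and $xz<yz$ for all $x,y,z$. For a field $k$ and ordered group $(G,<)$, the Malcev-Neumann series ring $k((G;<))$ consists of formal sums $f=\sum_{x\in G}a_x x$, $a_x\in k$, whose support $\{x: a_x\neq0\}$ is well-ordered, with componentwise addition and multiplication $fg=\sum_x(\sum_{yz=x}a_yb_z)x$; it is a division ring containing $k[G]$. An involution on a group is an anti-automorphism of order $2$; a $k$-involution on a $k$-algebra is a $k$-linear map $\ast$ with $(xy)^\ast=y^\ast x^\ast$, $(x^\ast)^\ast=x$. It is known that the $k$-involution of $k[G]$ induced by $\ast$ extends uniquely to $k(G)$. A free symmetric pair is a pair of elements $u,v$ with $u^\ast=u$, $v^\ast=v$ which generate a free subgroup of rank $2$ of the multiplicative group. *)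

theory Defs
  imports "HOL-Algebra.Algebra"
begin

definition nonabelian :: "('a, 'b) monoid_scheme \<Rightarrow> bool" where
  "nonabelian G \<longleftrightarrow> (\<exists>x\<in>carrier G. \<exists>y\<in>carrier G. x \<otimes>\<^bsub>G\<^esub> y \<noteq> y \<otimes>\<^bsub>G\<^esub> x)"

definition torsion_free :: "('a, 'b) monoid_scheme \<Rightarrow> bool" where
  "torsion_free G \<longleftrightarrow>
     (\<forall>x\<in>carrier G. x \<noteq> \<one>\<^bsub>G\<^esub> \<longrightarrow> (\<forall>n::nat. n > 0 \<longrightarrow> x [^]\<^bsub>G\<^esub> n \<noteq> \<one>\<^bsub>G\<^esub>))"

fun lower_central :: "('a, 'b) monoid_scheme \<Rightarrow> nat \<Rightarrow> 'a set" where
  "lower_central G 0 = carrier G"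
| "lower_central G (Suc n) = generate G
     {x \<otimes>\<^bsub>G\<^esub> y \<otimes>\<^bsub>G\<^esub> inv\<^bsub>G\<^esub> x \<otimes>\<^bsub>G\<^esub> inv\<^bsub>G\<^esub> y | x y.
        x \<in> lower_central G n \<and> y \<in> carrier G}"

definition nilpotent_group :: "('a, 'b) monoid_scheme \<Rightarrow> bool" where
  "nilpotent_group G \<longleftrightarrow> group G \<and> (\<exists>n. lower_central G n = {\<one>\<^bsub>G\<^esub>})"

definition residually_tfn :: "('a, 'b) monoid_scheme \<Rightarrow> bool" where
  "residually_tfn G \<longleftrightarrow>
     (\<forall>g\<in>carrier G. g \<noteq> \<one>\<^bsub>G\<^esub> \<longrightarrow>
        (\<exists>N. N \<lhd> G \<and> g \<notin> N \<and> torsion_free (G Mod N) \<and> nilpotent_group (G Mod N)))"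

definition group_involution :: "('a, 'b) monoid_scheme \<Rightarrow> ('a \<Rightarrow> 'a) \<Rightarrow> bool" where
  "group_involution G s \<longleftrightarrow>
     (\<forall>x\<in>carrier G. s x \<in> carrier G) \<and>
     (\<forall>x\<in>carrier G. \<forall>y\<in>carrier G. s (x \<otimes>\<^bsub>G\<^esub> y) = s y \<otimes>\<^bsub>G\<^esub> s x) \<and>
     (\<forall>x\<in>carrier G. s (s x) = x) \<and>
     (\<exists>x\<in>carrier G. s x \<noteq> x)"

definition ordered_group :: "('a, 'b) monoid_scheme \<Rightarrow> ('a \<Rightarrow> 'a \<Rightarrow> bool) \<Rightarrow> bool" where
  "ordered_group G lt \<longleftrightarrow>
     (\<forall>x\<in>carrier G. \<not> lt x x) \<and>
     (\<forall>x\<in>carrier G. \<forall>y\<in>carrier G. \<forall>z\<in>carrier G. lt x y \<longrightarrow> lt y z \<longrightarrow> lt x z) \<and>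
     (\<forall>x\<in>carrier G. \<forall>y\<in>carrier G. x = y \<or> lt x y \<or> lt y x) \<and>
     (\<forall>x\<in>carrier G. \<forall>y\<in>carrier G. \<forall>z\<in>carrier G. lt x y \<longrightarrow>
        lt (z \<otimes>\<^bsub>G\<^esub> x) (z \<otimes>\<^bsub>G\<^esub> y) \<and> lt (x \<otimes>\<^bsub>G\<^esub> z) (y \<otimes>\<^bsub>G\<^esub> z))"

text \<open>Formal series are functions 'g => 'k, vanishing outside the carrier.\<close>
definition supp :: "('g \<Rightarrow> 'k::zero) \<Rightarrow> 'g set" where
  "supp f = {x. f x \<noteq> 0}"

definition well_ordered_on :: "('g \<Rightarrow> 'g \<Rightarrow> bool) \<Rightarrow> 'g set \<Rightarrow> bool" where
  "well_ordered_on lt A \<longleftrightarrow>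
     (\<forall>S. S \<subseteq> A \<longrightarrow> S \<noteq> {} \<longrightarrow> (\<exists>m\<in>S. \<forall>s\<in>S. \<not> lt s m))"

definition MN_series :: "('g, 'b) monoid_scheme \<Rightarrow> ('g \<Rightarrow> 'g \<Rightarrow> bool) \<Rightarrow> ('g \<Rightarrow> 'k::zero) set" where
  "MN_series G lt = {f. supp f \<subseteq> carrier G \<and> well_ordered_on lt (supp f)}"

text \<open>Product: (fg)(x) = sum over y z = x of f(y) g(z) (a finite sum for well-ordered supports).\<close>
definition MN_mult :: "('g, 'b) monoid_scheme \<Rightarrow> ('g \<Rightarrow> 'k::comm_ring_1) \<Rightarrow> ('g \<Rightarrow> 'k) \<Rightarrow> 'g \<Rightarrow> 'k" where
  "MN_mult G f g x =
     (\<Sum>p\<in>{(y, z). y \<in> supp f \<and> z \<in> supp g \<and> y \<otimes>\<^bsub>G\<^esub> z = x}. f (fst p) * g (snd p))"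

definition MN_one :: "('g, 'b) monoid_scheme \<Rightarrow> 'g \<Rightarrow> 'k::{zero,one}" where
  "MN_one G = (\<lambda>x. if x = \<one>\<^bsub>G\<^esub> then 1 else 0)"

definition group_algebra :: "('g, 'b) monoid_scheme \<Rightarrow> ('g \<Rightarrow> 'k::zero) set" where
  "group_algebra G = {f. supp f \<subseteq> carrier G \<and> finite (supp f)}"

inductive_set division_closure ::
  "('g, 'b) monoid_scheme \<Rightarrow> ('g \<Rightarrow> 'g \<Rightarrow> bool) \<Rightarrow> ('g \<Rightarrow> 'k::field) set"
  for G lt where
  base: "f \<in> group_algebra G \<Longrightarrow> f \<in> division_closure G lt"
| add: "f \<in> division_closure G lt \<Longrightarrow> g \<in> division_closure G lt \<Longrightarrow>
        (\<lambda>x. f x + g x) \<in> division_closure G lt"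
| neg: "f \<in> division_closure G lt \<Longrightarrow> (\<lambda>x. - f x) \<in> division_closure G lt"
| mult: "f \<in> division_closure G lt \<Longrightarrow> g \<in> division_closure G lt \<Longrightarrow>
        MN_mult G f g \<in> division_closure G lt"
| inverse: "f \<in> division_closure G lt \<Longrightarrow> f \<noteq> (\<lambda>x. 0) \<Longrightarrow> g \<in> MN_series G lt \<Longrightarrow>
        MN_mult G f g = MN_one G \<Longrightarrow> MN_mult G g f = MN_one G \<Longrightarrow>
        g \<in> division_closure G lt"

definition extending_k_involution ::
  "('g, 'b) monoid_scheme \<Rightarrow> ('g \<Rightarrow> 'g \<Rightarrow> bool) \<Rightarrow> ('g \<Rightarrow> 'g) \<Rightarrow>
   (('g \<Rightarrow> 'k::field) \<Rightarrow> ('g \<Rightarrow> 'k)) \<Rightarrow> bool" where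
  "extending_k_involution G lt s \<sigma> \<longleftrightarrow>
     (\<forall>f\<in>division_closure G lt. \<sigma> f \<in> division_closure G lt) \<and>
     (\<forall>f\<in>division_closure G lt. \<forall>g\<in>division_closure G lt. \<forall>a b::'k.
        \<sigma> (\<lambda>x. a * f x + b * g x) = (\<lambda>x. a * \<sigma> f x + b * \<sigma> g x)) \<and>
     (\<forall>f\<in>division_closure G lt. \<forall>g\<in>division_closure G lt.
        \<sigma> (MN_mult G f g) = MN_mult G (\<sigma> g) (\<sigma> f)) \<and>
     (\<forall>f\<in>division_closure G lt. \<sigma> (\<sigma> f) = f) \<and>
     (\<forall>f\<in>group_algebra G. \<sigma> f = (\<lambda>x. if x \<in> carrier G then f (s x) else 0))"

text \<open>Words in u, v and their inverses: a letter is (is_v, is_inverse).\<close>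
definition reduced_word :: "(bool \<times> bool) list \<Rightarrow> bool" where
  "reduced_word w \<longleftrightarrow>
     (\<forall>i. Suc i < length w \<longrightarrow> \<not> (fst (w ! i) = fst (w ! Suc i) \<and> snd (w ! i) \<noteq> snd (w ! Suc i)))"

definition eval_word :: "('a \<Rightarrow> 'a \<Rightarrow> 'a) \<Rightarrow> 'a \<Rightarrow> 'a \<Rightarrow> 'a \<Rightarrow> 'a \<Rightarrow> 'a \<Rightarrow> (bool \<times> bool) list \<Rightarrow> 'a" where
  "eval_word mul e u u' v v' w =
     foldr (\<lambda>(isv, isinv) acc. mul (if isv then (if isinv then v' else v) else (if isinv then u' else u)) acc)
       w e"

definition free_symmetric_pair ::
  "('g, 'b) monoid_scheme \<Rightarrow> ('g \<Rightarrow> 'g \<Rightarrow> bool) \<Rightarrow>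
   (('g \<Rightarrow> 'k::field) \<Rightarrow> ('g \<Rightarrow> 'k)) \<Rightarrow> ('g \<Rightarrow> 'k) \<Rightarrow> ('g \<Rightarrow> 'k) \<Rightarrow> bool" where
  "free_symmetric_pair G lt \<sigma> u v \<longleftrightarrow>
     u \<in> division_closure G lt \<and> v \<in> division_closure G lt \<and>
     \<sigma> u = u \<and> \<sigma> v = v \<and>
     (\<exists>u' v'. u' \<in> division_closure G lt \<and> v' \<in> division_closure G lt \<and>
        MN_mult G u u' = MN_one G \<and> MN_mult G u' u = MN_one G \<and>
        MN_mult G v v' = MN_one G \<and> MN_mult G v' v = MN_one G \<and>
        (\<forall>w. w \<noteq> [] \<longrightarrow> reduced_word w \<longrightarrow>
           eval_word (MN_mult G) (MN_one G) u u' v v' w \<noteq> MN_one G))"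

end

theory Submission
  imports Defs "HOL-Library.Function_Algebras"
begin

text \<open>
  Let \<open>x, y\<close> be elements whose images in a suitable quotient generate a discrete Heisenberg
  group, and let \<open>L\<close> be the group of those \<open>g\<close> commuting with \<open>y\<close> modulo the kernel whose
  commutator with \<open>x\<close> is, modulo the kernel, a power \<open>[x, y]\<^sup>d\<close>; the exponent is a degree
  on \<open>L\<close> for which \<open>y\<close> has degree one. Elements of \<open>k(G)\<close> are viewed as functions
  of \<open>t = x\<close> with coefficients in the Ore division ring of fractions \<open>K\<close> of the finitely graded
  series on \<open>L\<close>, and \<open>p = (1 - t)\<^sup>-\<^sup>1\<close> plays the part of a pole: if \<open>k\<close> is not of the form
  \<open>c - t c t\<^sup>-\<^sup>1\<close> with \<open>c\<close> in \<open>K\<close>, then multiplication by \<open>p k\<close> strictly raises the order of a pole.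
  Hence the elements \<open>d\<^sub>i p\<^sup>-\<^sup>1 \<lambda> p \<kappa> p \<lambda>' p\<^sup>-\<^sup>1 e\<^sub>i\<close> generate a free group as soon as six
  products of the coefficients are not of that form, and that is detected in the two completions of
  \<open>K\<close> with respect to the degree, where every \<open>c - t c t\<^sup>-\<^sup>1\<close> vanishes at the group elements
  commuting with \<open>x\<close>. The letters are symmetric for \<open>e\<^sub>i = d\<^sub>i\<^sup>*\<close> and a matching choice of \<open>\<lambda>'\<close>.
  Finally \<open>x\<close> and \<open>y\<close> are found with one of three behaviours under the involution, according to whether the
  symmetric elements do not all commute, commute without being central, or are central.
\<close>

section \<open>Malcev--Neumann series\<close>

text \<open>A factor that raises the order of a pole normally has an inverse that lowers it, which
  would spoil any growth argument. Here multiplication by \<open>1 - t\<close> keeps the order: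
  \<open>(1 - t) k p z = (k - \<tau> k) p z + \<tau> k z\<close>, where \<open>\<tau>\<close> is
  conjugation by \<open>t\<close>, so it only replaces the leading coefficient \<open>k\<close> by
  \<open>k - \<tau> k\<close>. A letter contains \<open>p\<close> twice and \<open>1 - t\<close>
  twice, and so does its inverse. Both therefore raise the order by two as long as the coefficients
  met on the way are not coboundaries, and no reduced word can act trivially. The obstacle is to
  show that a given coefficient differs from \<open>c - \<tau> c\<close> for every unknown
  \<open>c\<close>. A general series on \<open>L\<close> may have degrees unbounded in both
  directions, so it cannot be expanded by degree; fractions of series with finitely many degrees can
  be, once by increasing and once by decreasing degree, and conjugation by \<open>x\<close> respects
  both expansions. Each of them shows terms that the other hides. The factor 2 enters through
  \<open>(1 + h)(1 - h)\<^sup>-\<^sup>1 = 1 + 2 h + ...\<close>, whose linear term separates the two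
  letters, and through coefficients of products of differences that equal -2.\<close>

definition single :: "'g \<Rightarrow> 'k \<Rightarrow> 'g \<Rightarrow> 'k::zero" where
  "single h c = (\<lambda>x. if x = h then c else 0)"

lemma single_apply: "single h c x = (if x = h then c else 0)"
  by (simp add: single_def)

lemma supp_zero [simp]: "supp (0 :: 'g \<Rightarrow> 'k::zero) = {}"
  by (simp add: supp_def)

lemma supp_add_subset: "supp (f + g) \<subseteq> supp f \<union> supp (g :: 'g \<Rightarrow> 'k::monoid_add)"
  by (auto simp: supp_def)

lemma supp_diff_subset: "supp (f - g) \<subseteq> supp f \<union> supp (g :: 'g \<Rightarrow> 'k::group_add)"
  by (auto simp: supp_def)

lemma supp_uminus [simp]: "supp (- f) = supp (f :: 'g \<Rightarrow> 'k::group_add)"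
  by (auto simp: supp_def)

lemma supp_single_subset: "supp (single h c) \<subseteq> {h}"
  by (auto simp: supp_def single_def)

lemma supp_empty_iff: "supp f = {} \<longleftrightarrow> f = (0 :: 'g \<Rightarrow> 'k::zero)"
  by (auto simp: supp_def zero_fun_def)

lemma well_ordered_on_subset: "well_ordered_on lt A \<Longrightarrow> B \<subseteq> A \<Longrightarrow> well_ordered_on lt B"
  unfolding well_ordered_on_def by (meson subset_trans)

lemma well_ordered_on_induct:
  assumes "well_ordered_on lt A" "a \<in> A"
    and "\<And>a. a \<in> A \<Longrightarrow> (\<And>b. b \<in> A \<Longrightarrow> lt b a \<Longrightarrow> Q b) \<Longrightarrow> Q a"
  shows "Q a"
proof (rule ccontr)
  assume "\<not> Q a"
  then have "{a\<in>A. \<not> Q a} \<subseteq> A" "{a\<in>A. \<not> Q a} \<noteq> {}" using assms(2) by auto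
  then obtain m where "m \<in> {a\<in>A. \<not> Q a}" "\<forall>s\<in>{a\<in>A. \<not> Q a}. \<not> lt s m"
    using assms(1) unfolding well_ordered_on_def by meson
  then show False using assms(3)[of m] by auto
qed

context group
begin

lemma inv_cancel_left [simp]:
  "a \<in> carrier G \<Longrightarrow> y \<in> carrier G \<Longrightarrow> inv a \<otimes> (a \<otimes> y) = y"
  "a \<in> carrier G \<Longrightarrow> y \<in> carrier G \<Longrightarrow> a \<otimes> (inv a \<otimes> y) = y"
  by (simp_all add: m_assoc[symmetric])

end

section \<open>Ordered groups and their well-ordered subsets\<close>

locale ordered_grp = group G for G :: "('g, 'b) monoid_scheme" (structure) +
  fixes lt :: "'g \<Rightarrow> 'g \<Rightarrow> bool"  (infix "\<lessdot>" 50)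
  assumes ordered: "ordered_group G lt"
begin

lemma lt_irrefl: "x \<in> carrier G \<Longrightarrow> \<not> x \<lessdot> x"
  using ordered by (simp add: ordered_group_def)

lemma lt_trans: "x \<in> carrier G \<Longrightarrow> y \<in> carrier G \<Longrightarrow> z \<in> carrier G \<Longrightarrow> x \<lessdot> y \<Longrightarrow> y \<lessdot> z \<Longrightarrow> x \<lessdot> z"
  using ordered unfolding ordered_group_def by meson

lemma lt_total: "x \<in> carrier G \<Longrightarrow> y \<in> carrier G \<Longrightarrow> x = y \<or> x \<lessdot> y \<or> y \<lessdot> x"
  using ordered unfolding ordered_group_def by meson

lemma lt_mult_left: "x \<in> carrier G \<Longrightarrow> y \<in> carrier G \<Longrightarrow> z \<in> carrier G \<Longrightarrow> x \<lessdot> y \<Longrightarrow> z \<otimes> x \<lessdot> z \<otimes> y"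
  using ordered unfolding ordered_group_def by meson

lemma lt_mult_right: "x \<in> carrier G \<Longrightarrow> y \<in> carrier G \<Longrightarrow> z \<in> carrier G \<Longrightarrow> x \<lessdot> y \<Longrightarrow> x \<otimes> z \<lessdot> y \<otimes> z"
  using ordered unfolding ordered_group_def by meson

lemma lt_asym: "x \<in> carrier G \<Longrightarrow> y \<in> carrier G \<Longrightarrow> x \<lessdot> y \<Longrightarrow> \<not> y \<lessdot> x"
  using lt_irrefl[of x] lt_trans[of x y x] by blast

lemma not_lt_trans:
  "x \<in> carrier G \<Longrightarrow> y \<in> carrier G \<Longrightarrow> z \<in> carrier G \<Longrightarrow> \<not> y \<lessdot> x \<Longrightarrow> \<not> z \<lessdot> y \<Longrightarrow> \<not> z \<lessdot> x"
  using lt_total[of x y] lt_total[of y z] lt_trans[of z x y] by blast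

lemma lt_mult:
  assumes [simp]: "a \<in> carrier G" "b \<in> carrier G" "c \<in> carrier G" "d \<in> carrier G"
    and "a \<lessdot> c" "\<not> d \<lessdot> b"
  shows "a \<otimes> b \<lessdot> c \<otimes> d"
proof -
  have 1: "a \<otimes> b \<lessdot> c \<otimes> b" using assms by (intro lt_mult_right) auto
  show ?thesis
  proof (cases "b = d")
    case False
    then have "b \<lessdot> d" using assms lt_total[of b d] by simp
    then have "c \<otimes> b \<lessdot> c \<otimes> d" by (intro lt_mult_left) auto
    then show ?thesis using 1 lt_trans[of "a \<otimes> b" "c \<otimes> b" "c \<otimes> d"] by simp
  qed (use 1 in auto)
qed

lemma lt_mult':
  assumes [simp]: "a \<in> carrier G" "b \<in> carrier G" "c \<in> carrier G" "d \<in> carrier G"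
    and "\<not> c \<lessdot> a" "b \<lessdot> d"
  shows "a \<otimes> b \<lessdot> c \<otimes> d"
proof -
  have 1: "a \<otimes> b \<lessdot> a \<otimes> d" using assms by (intro lt_mult_left) auto
  show ?thesis
  proof (cases "a = c")
    case False
    then have "a \<lessdot> c" using assms lt_total[of a c] by simp
    then have "a \<otimes> d \<lessdot> c \<otimes> d" by (intro lt_mult_right) auto
    then show ?thesis using 1 lt_trans[of "a \<otimes> b" "a \<otimes> d" "c \<otimes> d"] by simp
  qed (use 1 in auto)
qed

lemma not_lt_mult:
  assumes [simp]: "a \<in> carrier G" "b \<in> carrier G" "c \<in> carrier G" "d \<in> carrier G"
    and "\<not> c \<lessdot> a" "\<not> d \<lessdot> b"
  shows "\<not> c \<otimes> d \<lessdot> a \<otimes> b"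
proof (cases "a = c")
  case True
  show ?thesis
  proof (cases "b = d")
    case False
    then have "b \<lessdot> d" using lt_total[of b d] assms by simp
    then have "a \<otimes> b \<lessdot> a \<otimes> d" by (intro lt_mult_left) auto
    then show ?thesis using True lt_asym[of "a \<otimes> b" "a \<otimes> d"] by simp
  qed (use True lt_irrefl[of "a \<otimes> b"] in simp)
next
  case False
  then have "a \<lessdot> c" using lt_total[of a c] assms by simp
  then have "a \<otimes> b \<lessdot> c \<otimes> d" using assms by (intro lt_mult) auto
  then show ?thesis using lt_asym[of "a \<otimes> b" "c \<otimes> d"] by simp
qed

lemma lt_inv:
  assumes [simp]: "a \<in> carrier G" "b \<in> carrier G" and "a \<lessdot> b"
  shows "inv b \<lessdot> inv a"
proof -
  have "inv a \<otimes> a \<otimes> inv b \<lessdot> inv a \<otimes> b \<otimes> inv b"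
    using assms by (intro lt_mult_left lt_mult_right) auto
  then show ?thesis by (simp add: m_assoc)
qed

lemma well_ordered_min:
  assumes "well_ordered_on lt A" "A \<subseteq> carrier G" "A \<noteq> {}"
  obtains m where "m \<in> A" "\<And>s. s \<in> A \<Longrightarrow> s = m \<or> m \<lessdot> s"
proof -
  obtain m where "m \<in> A" "\<forall>s\<in>A. \<not> s \<lessdot> m"
    using assms unfolding well_ordered_on_def by blast
  then have "s = m \<or> m \<lessdot> s" if "s \<in> A" for s
    using that assms(2) lt_total[of s m] by blast
  then show ?thesis using that \<open>m \<in> A\<close> by blast
qed

lemma well_ordered_on_Un:
  assumes "well_ordered_on lt A" "well_ordered_on lt B" "A \<subseteq> carrier G" "B \<subseteq> carrier G"
  shows "well_ordered_on lt (A \<union> B)"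
  unfolding well_ordered_on_def
proof (intro allI impI)
  fix S assume S: "S \<subseteq> A \<union> B" "S \<noteq> {}"
  show "\<exists>m\<in>S. \<forall>s\<in>S. \<not> s \<lessdot> m"
  proof (cases "S \<inter> A = {} \<or> S \<inter> B = {}")
    case True
    then have "S \<subseteq> A \<or> S \<subseteq> B" using S by auto
    then show ?thesis using S assms unfolding well_ordered_on_def by blast
  next
    case False
    obtain m where m: "m \<in> S \<inter> A" "\<forall>s\<in>S \<inter> A. \<not> s \<lessdot> m"
      using False assms(1) unfolding well_ordered_on_def by (meson inf_le2)
    obtain n where n: "n \<in> S \<inter> B" "\<forall>s\<in>S \<inter> B. \<not> s \<lessdot> n"
      using False assms(2) unfolding well_ordered_on_def by (meson inf_le2)
    have c: "m \<in> carrier G" "n \<in> carrier G" "S \<subseteq> carrier G" using m n assms S by auto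
    show ?thesis
    proof (cases "n \<lessdot> m")
      case True
      then have "\<not> s \<lessdot> n" if "s \<in> S" for s
        using that S m n c(1,2) subsetD[OF c(3) that] lt_trans[OF _ c(2) c(1), of s] True by blast
      then show ?thesis using n by blast
    next
      case False
      then have "\<not> s \<lessdot> m" if "s \<in> S" for s
        using that S m n c(1,2) subsetD[OF c(3) that] not_lt_trans[OF c(1,2), of s] False by blast
      then show ?thesis using m by blast
    qed
  qed
qed

lemma well_ordered_on_finite:
  assumes "finite A" "A \<subseteq> carrier G" shows "well_ordered_on lt A"
  using assms
proof (induction rule: finite_induct)
  case empty
  then show ?case by (simp add: well_ordered_on_def)
next
  case (insert x F)
  have "well_ordered_on lt {x}"
    using lt_irrefl[of x] insert(4) by (auto simp: well_ordered_on_def subset_singleton_iff)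
  then have "well_ordered_on lt ({x} \<union> F)" using insert by (intro well_ordered_on_Un) auto
  then show ?case by simp
qed

text \<open>The initial segment \<open>I a\<close> below \<open>a\<close>, if nonempty, has a
  greatest element \<open>m\<close>, hence is contained in \<open>I m\<close> with \<open>m\<close>
  added. Induction along the well-order makes every \<open>I a\<close> finite, and the greatest
  element of \<open>A\<close> finishes the argument.\<close>

lemma finite_if_well_ordered_both:
  assumes "A \<subseteq> carrier G" "well_ordered_on lt A" "well_ordered_on (\<lambda>x y. y \<lessdot> x) A"
  shows "finite A"
proof -
  define I where "I a = {x\<in>A. x \<lessdot> a}" for a
  have max: "\<exists>m\<in>S. S \<subseteq> insert m {x\<in>S. x \<lessdot> m}" if S: "S \<subseteq> A" "S \<noteq> {}" for S
  proof -
    obtain m where m: "m \<in> S" "\<forall>s\<in>S. \<not> m \<lessdot> s"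
      using S assms(3) unfolding well_ordered_on_def by meson
    have c: "S \<subseteq> carrier G" using \<open>S \<subseteq> A\<close> assms(1) by simp
    have "s = m \<or> s \<lessdot> m" if "s \<in> S" for s
      using lt_total[OF subsetD[OF c that] subsetD[OF c m(1)]] m(2) that by blast
    then show ?thesis using m(1) by blast
  qed
  have fin: "finite (I a)" if "a \<in> A" for a
  proof (rule well_ordered_on_induct[OF assms(2) that])
    fix a assume a: "a \<in> A" "\<And>b. b \<in> A \<Longrightarrow> b \<lessdot> a \<Longrightarrow> finite (I b)"
    show "finite (I a)"
    proof (cases "I a = {}")
      case False
      have "I a \<subseteq> A" by (auto simp: I_def)
      then obtain m where m: "m \<in> I a" "I a \<subseteq> insert m {x\<in>I a. x \<lessdot> m}" using max False by blast
      then have "finite (I m)" using a by (auto simp: I_def)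
      moreover have "I a \<subseteq> insert m (I m)" using m(2) by (auto simp: I_def)
      ultimately show ?thesis by (meson finite_insert finite_subset)
    qed simp
  qed
  show ?thesis
  proof (cases "A = {}")
    case False
    then obtain m where m: "m \<in> A" "A \<subseteq> insert m {x\<in>A. x \<lessdot> m}" using max by blast
    then have "A \<subseteq> insert m (I m)" by (auto simp: I_def)
    then show ?thesis using fin[OF m(1)] by (meson finite_insert finite_subset)
  qed simp
qed

text \<open>The map sending \<open>a\<close> to \<open>inv a \<otimes> x\<close> reverses the order,
  so well-ordering of \<open>B\<close> makes the fibre well-ordered downwards as well. This is what
  makes the convolution sums finite.\<close>

lemma finite_fibre:
  assumes "A \<subseteq> carrier G" "B \<subseteq> carrier G" "well_ordered_on lt A" "well_ordered_on lt B"
    and x: "x \<in> carrier G"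
  shows "finite {a\<in>A. inv a \<otimes> x \<in> B}" (is "finite ?F")
proof (rule finite_if_well_ordered_both)
  show "?F \<subseteq> carrier G" using assms by auto
  show "well_ordered_on lt ?F" by (rule well_ordered_on_subset[OF assms(3)]) auto
  show "well_ordered_on (\<lambda>x y. y \<lessdot> x) ?F"
    unfolding well_ordered_on_def
  proof (intro allI impI)
    fix S assume S: "S \<subseteq> ?F" "S \<noteq> {}"
    have "(\<lambda>a. inv a \<otimes> x) ` S \<subseteq> B" "(\<lambda>a. inv a \<otimes> x) ` S \<noteq> {}" using S by auto
    then obtain b where b: "b \<in> (\<lambda>a. inv a \<otimes> x) ` S" "\<forall>s\<in>(\<lambda>a. inv a \<otimes> x) ` S. \<not> s \<lessdot> b"
      using assms(4) unfolding well_ordered_on_def by metis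
    then obtain m where m: "m \<in> S" "b = inv m \<otimes> x" by auto
    have "\<not> m \<lessdot> s" if s: "s \<in> S" for s
    proof
      assume "m \<lessdot> s"
      moreover have "m \<in> carrier G" "s \<in> carrier G" using S m s assms by auto
      ultimately have "inv s \<otimes> x \<lessdot> inv m \<otimes> x" using x lt_inv[of m s] lt_mult_right[of "inv s" "inv m" x] by simp
      then show False using b m s by auto
    qed
    then show "\<exists>m\<in>S. \<forall>s\<in>S. \<not> m \<lessdot> s" using m by auto
  qed
qed

text \<open>The claim is proved by induction on \<open>a1\<close>. Given a pair
  \<open>(a1, b1)\<close> of \<open>Q\<close> with least second entry, let \<open>Q1\<close> be the
  pairs of \<open>Q\<close> with smaller product. A pair \<open>(a2, b2)\<close> of
  \<open>Q1\<close> with least second entry has \<open>b2\<close> not below \<open>b1\<close>, which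
  forces \<open>a2\<close> below \<open>a1\<close>. So \<open>Q1\<close> has a minimal product by
  induction, and it is minimal in \<open>Q\<close> too.\<close>

lemma well_ordered_on_prod:
  assumes AB: "A \<subseteq> carrier G" "B \<subseteq> carrier G" and wA: "well_ordered_on lt A" and wB: "well_ordered_on lt B"
  shows "well_ordered_on lt {a \<otimes> b |a b. a \<in> A \<and> b \<in> B}"
  unfolding well_ordered_on_def
proof (intro allI impI)
  define has_min where "has_min Q \<longleftrightarrow> (\<exists>a b. (a, b) \<in> Q \<and> (\<forall>a' b'. (a', b') \<in> Q \<longrightarrow> \<not> a' \<otimes> b' \<lessdot> a \<otimes> b))" for Q
  have min2: "\<exists>a b. (a, b) \<in> Q \<and> (\<forall>a' b'. (a', b') \<in> Q \<longrightarrow> \<not> b' \<lessdot> b)" if "Q \<subseteq> A \<times> B" "Q \<noteq> {}" for Q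
  proof -
    have "snd ` Q \<subseteq> B" "snd ` Q \<noteq> {}" using that by auto
    then obtain b where "b \<in> snd ` Q" "\<forall>s\<in>snd ` Q. \<not> s \<lessdot> b"
      using wB unfolding well_ordered_on_def by metis
    then show ?thesis by force
  qed
  have claim: "\<forall>Q \<subseteq> A \<times> B. \<forall>b1. (a1, b1) \<in> Q \<longrightarrow> (\<forall>a b. (a, b) \<in> Q \<longrightarrow> \<not> b \<lessdot> b1) \<longrightarrow> has_min Q" if "a1 \<in> A" for a1
  proof (rule well_ordered_on_induct[OF wA that])
    fix a1 assume a1: "a1 \<in> A" and IH: "\<And>a2. a2 \<in> A \<Longrightarrow> a2 \<lessdot> a1 \<Longrightarrow>
        \<forall>Q \<subseteq> A \<times> B. \<forall>b1. (a2, b1) \<in> Q \<longrightarrow> (\<forall>a b. (a, b) \<in> Q \<longrightarrow> \<not> b \<lessdot> b1) \<longrightarrow> has_min Q"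
    show "\<forall>Q \<subseteq> A \<times> B. \<forall>b1. (a1, b1) \<in> Q \<longrightarrow> (\<forall>a b. (a, b) \<in> Q \<longrightarrow> \<not> b \<lessdot> b1) \<longrightarrow> has_min Q"
    proof (intro allI impI)
      fix Q b1 assume Q: "Q \<subseteq> A \<times> B" "(a1, b1) \<in> Q" "\<forall>a b. (a, b) \<in> Q \<longrightarrow> \<not> b \<lessdot> b1"
      define Q1 where "Q1 = {(a, b). (a, b) \<in> Q \<and> a \<otimes> b \<lessdot> a1 \<otimes> b1}"
      have Q1: "Q1 \<subseteq> A \<times> B" using Q by (auto simp: Q1_def)
      show "has_min Q"
      proof (cases "Q1 = {}")
        case True
        then show ?thesis using Q(2) unfolding has_min_def Q1_def by auto
      next
        case False
        then obtain a2 b2 where a2: "(a2, b2) \<in> Q1" "\<forall>a b. (a, b) \<in> Q1 \<longrightarrow> \<not> b \<lessdot> b2"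
          using min2[OF Q1] by blast
        have c: "a1 \<in> carrier G" "b1 \<in> carrier G" "a2 \<in> carrier G" "b2 \<in> carrier G" "a2 \<in> A"
          using a2 Q Q1 AB by auto
        have "\<not> b2 \<lessdot> b1" "a2 \<otimes> b2 \<lessdot> a1 \<otimes> b1" using a2 Q by (auto simp: Q1_def)
        have "a2 \<lessdot> a1"
        proof (rule ccontr)
          assume "\<not> a2 \<lessdot> a1"
          then have "\<not> a2 \<otimes> b2 \<lessdot> a1 \<otimes> b1"
            using not_lt_mult[OF c(1,2,3,4)] \<open>\<not> b2 \<lessdot> b1\<close> by blast
          then show False using \<open>a2 \<otimes> b2 \<lessdot> a1 \<otimes> b1\<close> by simp
        qed
        then have "has_min Q1" using IH[OF c(5)] Q1 a2 by blast
        then obtain a3 b3 where a3: "(a3, b3) \<in> Q1" "\<forall>a' b'. (a', b') \<in> Q1 \<longrightarrow> \<not> a' \<otimes> b' \<lessdot> a3 \<otimes> b3"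
          unfolding has_min_def by blast
        have "\<not> a' \<otimes> b' \<lessdot> a3 \<otimes> b3" if "(a', b') \<in> Q" for a' b'
        proof
          assume l: "a' \<otimes> b' \<lessdot> a3 \<otimes> b3"
          have "a3 \<otimes> b3 \<lessdot> a1 \<otimes> b1" using a3 by (auto simp: Q1_def)
          moreover have "a' \<in> carrier G" "b' \<in> carrier G" "a3 \<in> carrier G" "b3 \<in> carrier G"
            using that a3 Q Q1 AB by auto
          ultimately have "a' \<otimes> b' \<lessdot> a1 \<otimes> b1" using l c lt_trans[of "a' \<otimes> b'" "a3 \<otimes> b3" "a1 \<otimes> b1"] by auto
          then have "(a', b') \<in> Q1" using that by (auto simp: Q1_def)
          then show False using a3 l by auto
        qed
        then show ?thesis using a3 unfolding has_min_def Q1_def by auto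
      qed
    qed
  qed
  fix S assume S: "S \<subseteq> {a \<otimes> b |a b. a \<in> A \<and> b \<in> B}" "S \<noteq> {}"
  define Q where "Q = {(a, b). a \<in> A \<and> b \<in> B \<and> a \<otimes> b \<in> S}"
  have Q: "Q \<subseteq> A \<times> B" "Q \<noteq> {}" using S by (auto simp: Q_def)
  then have "has_min Q" using min2[OF Q] claim by (meson SigmaD1 subsetD)
  then obtain a b where ab: "(a, b) \<in> Q" "\<forall>a' b'. (a', b') \<in> Q \<longrightarrow> \<not> a' \<otimes> b' \<lessdot> a \<otimes> b"
    unfolding has_min_def by blast
  have "\<not> s \<lessdot> a \<otimes> b" if "s \<in> S" for s
  proof -
    obtain a' b' where "s = a' \<otimes> b'" "a' \<in> A" "b' \<in> B" using subsetD[OF S(1) \<open>s \<in> S\<close>] by blast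
    then show ?thesis using ab that by (auto simp: Q_def)
  qed
  then show "\<exists>m\<in>S. \<forall>s\<in>S. \<not> s \<lessdot> m" using ab by (auto simp: Q_def)
qed

section \<open>The ring of Malcev-Neumann series\<close>

abbreviation MN :: "('g \<Rightarrow> 'k::zero) set" where "MN \<equiv> MN_series G lt"

abbreviation mul :: "('g \<Rightarrow> 'k::comm_ring_1) \<Rightarrow> ('g \<Rightarrow> 'k) \<Rightarrow> 'g \<Rightarrow> 'k" (infixl "\<star>" 70)
  where "f \<star> g \<equiv> MN_mult G f g"

lemma MN_I: "supp f \<subseteq> carrier G \<Longrightarrow> well_ordered_on lt (supp f) \<Longrightarrow> f \<in> MN"
  and MN_supp: "f \<in> MN \<Longrightarrow> supp f \<subseteq> carrier G"
  and MN_well_ordered: "f \<in> MN \<Longrightarrow> well_ordered_on lt (supp f)"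
  by (simp_all add: MN_series_def)

lemma MN_outside: "f \<in> MN \<Longrightarrow> x \<notin> carrier G \<Longrightarrow> f x = 0"
  using MN_supp[of f] by (auto simp: supp_def)

lemma MN_subset_supp: "f \<in> MN \<Longrightarrow> supp h \<subseteq> supp f \<Longrightarrow> h \<in> MN"
  using MN_supp[of f] MN_well_ordered[of f] well_ordered_on_subset[of lt "supp f" "supp h"]
  by (auto intro!: MN_I)

lemma MN_zero [simp]: "0 \<in> MN"
  by (simp add: MN_series_def well_ordered_on_def)

lemma MN_add [simp]:
  assumes "f \<in> MN" "g \<in> MN" shows "f + g \<in> (MN :: ('g \<Rightarrow> 'k::monoid_add) set)"
proof (rule MN_I)
  show "well_ordered_on lt (supp (f + g))"
    using well_ordered_on_Un[of "supp f" "supp g"] assms supp_add_subset well_ordered_on_subset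
    by (metis MN_supp MN_well_ordered)
qed (use assms supp_add_subset[of f g] MN_supp in blast)

lemma MN_uminus [simp]: "f \<in> MN \<Longrightarrow> - f \<in> (MN :: ('g \<Rightarrow> 'k::group_add) set)"
  by (simp add: MN_series_def)

lemma MN_diff [simp]:
  assumes "f \<in> MN" "g \<in> MN" shows "f - g \<in> (MN :: ('g \<Rightarrow> 'k::ab_group_add) set)"
  using MN_add[OF assms(1) MN_uminus[OF assms(2)]] by simp

lemma MN_single [simp]: "h \<in> carrier G \<Longrightarrow> single h c \<in> MN"
  by (rule MN_I) (use supp_single_subset[of h c] in \<open>auto intro!: well_ordered_on_finite dest: finite_subset\<close>)

lemma finite_mult_support:
  assumes "f \<in> MN" "g \<in> MN" "x \<in> carrier G"
  shows "finite {a \<in> supp f. inv a \<otimes> x \<in> supp g}"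
  using assms by (intro finite_fibre) (auto simp: MN_series_def)

text \<open>The freedom in choosing the finite index set \<open>A\<close> lets several products be
  written as sums over one common set, which is how associativity and distributivity are
  proved.\<close>

lemma mult_eq:
  assumes "f \<in> MN" "g \<in> MN" "x \<in> carrier G" "finite A" "A \<subseteq> carrier G"
    and "{a \<in> supp f. inv a \<otimes> x \<in> supp g} \<subseteq> A"
  shows "(f \<star> g) x = (\<Sum>a\<in>A. f a * g (inv a \<otimes> x))"
proof -
  let ?P = "{(y, z). y \<in> supp f \<and> z \<in> supp g \<and> y \<otimes> z = x}"
  let ?F = "{a \<in> supp f. inv a \<otimes> x \<in> supp g}"
  have sf: "a \<in> carrier G" if "a \<in> supp f" for a using that MN_supp[OF assms(1)] by auto
  have sg: "a \<in> carrier G" if "a \<in> supp g" for a using that MN_supp[OF assms(2)] by auto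
  have P: "?P = (\<lambda>a. (a, inv a \<otimes> x)) ` ?F"
  proof (intro equalityI subsetI)
    fix p assume "p \<in> ?P"
    then obtain y z where p: "p = (y, z)" "y \<in> supp f" "z \<in> supp g" "y \<otimes> z = x" by auto
    then have "inv y \<otimes> x = z" using sf sg by (auto simp: inv_solve_left' m_assoc[symmetric])
    then show "p \<in> (\<lambda>a. (a, inv a \<otimes> x)) ` ?F" using p by auto
  qed (use sf sg assms(3) in \<open>auto simp: m_assoc[symmetric]\<close>)
  have "(f \<star> g) x = (\<Sum>a\<in>?F. f a * g (inv a \<otimes> x))"
    unfolding MN_mult_def P by (subst sum.reindex) (auto simp: inj_on_def)
  also have "\<dots> = (\<Sum>a\<in>A. f a * g (inv a \<otimes> x))"
    using assms(4,6) by (intro sum.mono_neutral_left) (auto simp: supp_def)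
  finally show ?thesis .
qed

lemma mult_outside:
  assumes "supp f \<subseteq> carrier G" "supp g \<subseteq> carrier G" "x \<notin> carrier G" shows "(f \<star> g) x = 0"
proof -
  have "{(y, z). y \<in> supp f \<and> z \<in> supp g \<and> y \<otimes> z = x} = {}" using assms by auto
  then show ?thesis unfolding MN_mult_def by (metis sum.empty)
qed

lemma mult_nonzeroE:
  assumes "(f \<star> g) x \<noteq> 0" obtains a b where "a \<in> supp f" "b \<in> supp g" "x = a \<otimes> b"
proof -
  have "{(y, z). y \<in> supp f \<and> z \<in> supp g \<and> y \<otimes> z = x} \<noteq> {}"
    using assms unfolding MN_mult_def by (metis sum.empty)
  then show ?thesis using that by auto
qed

lemma MN_mult [simp]:
  assumes "f \<in> MN" "g \<in> MN" shows "f \<star> g \<in> MN"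
proof -
  have s: "supp (f \<star> g) \<subseteq> {a \<otimes> b |a b. a \<in> supp f \<and> b \<in> supp g}"
    by (auto simp: supp_def[of "f \<star> g"] elim!: mult_nonzeroE)
  moreover have "{a \<otimes> b |a b. a \<in> supp f \<and> b \<in> supp g} \<subseteq> carrier G"
    using assms MN_supp by fastforce
  ultimately show ?thesis
    using assms well_ordered_on_prod[of "supp f" "supp g"]
    by (intro MN_I well_ordered_on_subset[OF _ s]) (auto simp: MN_series_def)
qed

lemma mult_assoc:
  assumes f: "f \<in> MN" and g: "g \<in> MN" and h: "h \<in> MN"
  shows "f \<star> g \<star> h = f \<star> (g \<star> h)"
proof
  fix x
  show "(f \<star> g \<star> h) x = (f \<star> (g \<star> h)) x"
  proof (cases "x \<in> carrier G")
    case x: True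
    \<comment> \<open>The left factors of all factorisations \<open>x = a b c\<close> with entries
      from the three supports.\<close>
    define A where "A = {a \<in> supp f. inv a \<otimes> x \<in> {b \<otimes> c |b c. b \<in> supp g \<and> c \<in> supp h}}"
    have sf: "a \<in> carrier G" if "a \<in> supp f" for a using that MN_supp[OF f] by auto
    have sg: "a \<in> carrier G" if "a \<in> supp g" for a using that MN_supp[OF g] by auto
    have sh: "a \<in> carrier G" if "a \<in> supp h" for a using that MN_supp[OF h] by auto
    have "well_ordered_on lt {b \<otimes> c |b c. b \<in> supp g \<and> c \<in> supp h}"
      by (intro well_ordered_on_prod MN_supp MN_well_ordered g h)
    moreover have "{b \<otimes> c |b c. b \<in> supp g \<and> c \<in> supp h} \<subseteq> carrier G" using sg sh by auto
    ultimately have "finite A"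
      unfolding A_def by (intro finite_fibre MN_supp MN_well_ordered f x)
    then have A: "finite A" "A \<subseteq> carrier G" "A \<subseteq> supp f" using sf by (auto simp: A_def)
    have fin: "finite {b \<in> supp g. inv b \<otimes> (inv a \<otimes> x) \<in> supp h}" if "a \<in> A" for a
      using that A x by (intro finite_mult_support g h) auto
    \<comment> \<open>The partial products \<open>a b\<close> of those factorisations. Both
      bracketings become sums over the finite rectangle of \<open>A\<close> and
      \<open>B\<close>.\<close>
    define B where "B = (\<Union>a\<in>A. (\<lambda>b. a \<otimes> b) ` {b \<in> supp g. inv b \<otimes> (inv a \<otimes> x) \<in> supp h})"
    have B: "finite B" "B \<subseteq> carrier G" using A fin sg by (auto simp: B_def)
    have "(f \<star> g \<star> h) x = (\<Sum>d\<in>B. (f \<star> g) d * h (inv d \<otimes> x))"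
    proof (rule mult_eq[OF MN_mult[OF f g] h x B])
      show "{a \<in> supp (f \<star> g). inv a \<otimes> x \<in> supp h} \<subseteq> B"
      proof clarify
        fix d assume d: "d \<in> supp (f \<star> g)" "inv d \<otimes> x \<in> supp h"
        then obtain a b where ab: "a \<in> supp f" "b \<in> supp g" "d = a \<otimes> b"
          using mult_nonzeroE[of f g d] by (auto simp: supp_def)
        have e: "inv b \<otimes> (inv a \<otimes> x) = inv d \<otimes> x"
          using ab sf sg x by (simp add: inv_mult_group m_assoc)
        have "inv a \<otimes> x = b \<otimes> (inv d \<otimes> x)"
          unfolding e[symmetric] using ab sf sg x by simp
        then have "a \<in> A" using ab d by (auto simp: A_def)
        moreover have "b \<in> {b \<in> supp g. inv b \<otimes> (inv a \<otimes> x) \<in> supp h}" using ab d e by simp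
        ultimately show "d \<in> B" unfolding B_def ab(3) by blast
      qed
    qed
    also have "\<dots> = (\<Sum>d\<in>B. \<Sum>a\<in>A. f a * g (inv a \<otimes> d) * h (inv d \<otimes> x))"
    proof (rule sum.cong[OF refl])
      fix d assume d: "d \<in> B"
      show "(f \<star> g) d * h (inv d \<otimes> x) = (\<Sum>a\<in>A. f a * g (inv a \<otimes> d) * h (inv d \<otimes> x))"
      proof (cases "h (inv d \<otimes> x) = 0")
        case False
        have dc: "d \<in> carrier G" using d B by auto
        have "(f \<star> g) d = (\<Sum>a\<in>A. f a * g (inv a \<otimes> d))"
        proof (rule mult_eq[OF f g dc A(1,2)], clarify)
          fix a assume a: "a \<in> supp f" "inv a \<otimes> d \<in> supp g"
          have "inv a \<otimes> x = (inv a \<otimes> d) \<otimes> (inv d \<otimes> x)"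
            using a sf x dc by (simp add: m_assoc)
          then show "a \<in> A" using a False by (auto simp: A_def supp_def)
        qed
        then show ?thesis by (simp add: sum_distrib_right)
      qed simp
    qed
    also have "\<dots> = (\<Sum>a\<in>A. \<Sum>d\<in>B. f a * g (inv a \<otimes> d) * h (inv d \<otimes> x))"
      by (rule sum.swap)
    also have "\<dots> = (\<Sum>a\<in>A. f a * (g \<star> h) (inv a \<otimes> x))"
    proof (rule sum.cong[OF refl])
      fix a assume a: "a \<in> A"
      have ac: "a \<in> carrier G" using a A by auto
      have inj: "inj_on (\<lambda>d. inv a \<otimes> d) B"
        using ac B by (intro inj_onI) (metis inv_closed l_cancel subsetD)
      have "(g \<star> h) (inv a \<otimes> x) = (\<Sum>b\<in>(\<lambda>d. inv a \<otimes> d) ` B. g b * h (inv b \<otimes> (inv a \<otimes> x)))"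
      proof (rule mult_eq[OF g h])
        show "{b \<in> supp g. inv b \<otimes> (inv a \<otimes> x) \<in> supp h} \<subseteq> (\<lambda>d. inv a \<otimes> d) ` B"
        proof clarify
          fix b assume b: "b \<in> supp g" "inv b \<otimes> (inv a \<otimes> x) \<in> supp h"
          then have "a \<otimes> b \<in> B" using a by (auto simp: B_def)
          moreover have "b = inv a \<otimes> (a \<otimes> b)" using ac b sg by (simp add: m_assoc[symmetric])
          ultimately show "b \<in> (\<lambda>d. inv a \<otimes> d) ` B" by blast
        qed
      qed (use ac x B in auto)
      also have "\<dots> = (\<Sum>d\<in>B. g (inv a \<otimes> d) * h (inv d \<otimes> x))"
      proof (subst sum.reindex[OF inj], unfold o_def, rule sum.cong[OF refl])
        fix d assume "d \<in> B"
        then have dc: "d \<in> carrier G" using B by auto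
        have "inv (inv a \<otimes> d) \<otimes> (inv a \<otimes> x) = inv d \<otimes> (a \<otimes> (inv a \<otimes> x))"
          using ac dc x by (simp add: inv_mult_group m_assoc)
        also have "a \<otimes> (inv a \<otimes> x) = x" using ac x by (simp add: m_assoc[symmetric])
        finally show "g (inv a \<otimes> d) * h (inv (inv a \<otimes> d) \<otimes> (inv a \<otimes> x)) = g (inv a \<otimes> d) * h (inv d \<otimes> x)"
          by simp
      qed
      finally show "(\<Sum>d\<in>B. f a * g (inv a \<otimes> d) * h (inv d \<otimes> x)) = f a * (g \<star> h) (inv a \<otimes> x)"
        by (simp add: sum_distrib_left mult.assoc)
    qed
    also have "\<dots> = (f \<star> (g \<star> h)) x"
    proof (rule mult_eq[symmetric, OF f MN_mult[OF g h] x A(1,2)], clarify)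
      fix a assume a: "a \<in> supp f" "inv a \<otimes> x \<in> supp (g \<star> h)"
      then obtain b c where "b \<in> supp g" "c \<in> supp h" "inv a \<otimes> x = b \<otimes> c"
        using mult_nonzeroE[of g h "inv a \<otimes> x"] by (auto simp: supp_def)
      then show "a \<in> A" using a by (auto simp: A_def)
    qed
    finally show ?thesis .
  qed (use assms in \<open>simp add: mult_outside MN_supp\<close>)
qed

lemma mult_distrib_left:
  assumes f: "f \<in> MN" and g: "g \<in> MN" and h: "h \<in> MN"
  shows "f \<star> (g + h) = f \<star> g + f \<star> h"
proof
  fix x
  show "(f \<star> (g + h)) x = (f \<star> g + f \<star> h) x"
  proof (cases "x \<in> carrier G")
    case x: True
    let ?A = "{a \<in> supp f. inv a \<otimes> x \<in> supp g} \<union> {a \<in> supp f. inv a \<otimes> x \<in> supp h}"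
    have A: "finite ?A" "?A \<subseteq> carrier G" using finite_mult_support[OF f g x] finite_mult_support[OF f h x] MN_supp[OF f] by auto
    have 1: "(f \<star> (g + h)) x = (\<Sum>a\<in>?A. f a * (g + h) (inv a \<otimes> x))"
      using supp_add_subset[of g h] by (intro mult_eq f x A) (auto simp: g h)
    have 2: "(f \<star> g) x = (\<Sum>a\<in>?A. f a * g (inv a \<otimes> x))" by (intro mult_eq f g x A) auto
    have 3: "(f \<star> h) x = (\<Sum>a\<in>?A. f a * h (inv a \<otimes> x))" by (intro mult_eq f h x A) auto
    show ?thesis by (simp add: 1 2 3 distrib_left sum.distrib)
  qed (use assms in \<open>simp add: mult_outside MN_supp\<close>)
qed

lemma mult_distrib_right:
  assumes f: "f \<in> MN" and g: "g \<in> MN" and h: "h \<in> MN"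
  shows "(g + h) \<star> f = g \<star> f + h \<star> f"
proof
  fix x
  show "((g + h) \<star> f) x = (g \<star> f + h \<star> f) x"
  proof (cases "x \<in> carrier G")
    case x: True
    let ?A = "{a \<in> supp g. inv a \<otimes> x \<in> supp f} \<union> {a \<in> supp h. inv a \<otimes> x \<in> supp f}"
    have A: "finite ?A" "?A \<subseteq> carrier G" using finite_mult_support[OF g f x] finite_mult_support[OF h f x] MN_supp[OF g] MN_supp[OF h] by auto
    have 1: "((g + h) \<star> f) x = (\<Sum>a\<in>?A. (g + h) a * f (inv a \<otimes> x))"
      using supp_add_subset[of g h] by (intro mult_eq f x A) (auto simp: g h)
    have 2: "(g \<star> f) x = (\<Sum>a\<in>?A. g a * f (inv a \<otimes> x))" by (intro mult_eq f g x A) auto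
    have 3: "(h \<star> f) x = (\<Sum>a\<in>?A. h a * f (inv a \<otimes> x))" by (intro mult_eq f h x A) auto
    show ?thesis by (simp add: 1 2 3 distrib_right sum.distrib)
  qed (use assms in \<open>simp add: mult_outside MN_supp\<close>)
qed

lemma single_mult:
  assumes "f \<in> MN" "h \<in> carrier G"
  shows "single h c \<star> f = (\<lambda>x. if x \<in> carrier G then c * f (inv h \<otimes> x) else 0)"
proof
  fix x
  show "(single h c \<star> f) x = (if x \<in> carrier G then c * f (inv h \<otimes> x) else 0)"
  proof (cases "x \<in> carrier G")
    case True
    have "(single h c \<star> f) x = (\<Sum>a\<in>{h}. single h c a * f (inv a \<otimes> x))"
      using supp_single_subset[of h c] by (intro mult_eq) (auto simp: True assms)
    then show ?thesis using True by (simp add: single_def)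
  qed (use assms in \<open>simp add: mult_outside MN_supp\<close>)
qed

lemma mult_single:
  assumes "f \<in> MN" "h \<in> carrier G"
  shows "f \<star> single h c = (\<lambda>x. if x \<in> carrier G then f (x \<otimes> inv h) * c else 0)"
proof
  fix x
  show "(f \<star> single h c) x = (if x \<in> carrier G then f (x \<otimes> inv h) * c else 0)"
  proof (cases "x \<in> carrier G")
    case True
    have eq: "inv a \<otimes> x = h \<longleftrightarrow> a = x \<otimes> inv h" if "a \<in> carrier G" for a
      using True assms that by (auto simp: m_assoc inv_mult_group)
    have "(f \<star> single h c) x = (\<Sum>a\<in>{x \<otimes> inv h}. f a * single h c (inv a \<otimes> x))"
      using supp_single_subset[of h c] eq MN_supp[OF assms(1)] by (intro mult_eq) (auto simp: True assms)
    also have "\<dots> = f (x \<otimes> inv h) * single h c (inv (x \<otimes> inv h) \<otimes> x)" by simp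
    also have "inv (x \<otimes> inv h) \<otimes> x = h" using eq[of "x \<otimes> inv h"] True assms by simp
    finally show ?thesis using True by (simp add: single_def)
  qed (use assms in \<open>simp add: mult_outside MN_supp\<close>)
qed

lemma MN_one_eq: "MN_one G = single \<one> 1"
  by (simp add: MN_one_def single_def)

lemma single_mult_single [simp]:
  assumes "a \<in> carrier G" "b \<in> carrier G"
  shows "single a c \<star> single b d = single (a \<otimes> b) (c * d)"
proof -
  have "x \<otimes> inv b = a \<longleftrightarrow> x = a \<otimes> b" if "x \<in> carrier G" for x
    using that assms by (auto simp: m_assoc)
  then show ?thesis
    using assms by (subst mult_single) (auto simp: fun_eq_iff single_apply)
qed

lemma one_mult [simp]: "f \<in> MN \<Longrightarrow> single \<one> 1 \<star> f = f"
  and mult_one [simp]: "f \<in> MN \<Longrightarrow> f \<star> single \<one> 1 = f"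
  by (auto simp: single_mult mult_single MN_outside)

end

section \<open>Inverses of Malcev-Neumann series\<close>

context ordered_grp
begin

lemma mult_less_zero:
  assumes "f \<in> MN" "g \<in> MN" "x \<in> carrier G"
    and "\<And>a. a \<in> supp f \<Longrightarrow> \<not> a \<lessdot> \<one>" and "\<And>b. b \<in> supp g \<Longrightarrow> x \<lessdot> b"
  shows "(f \<star> g) x = 0"
proof (rule ccontr)
  assume "(f \<star> g) x \<noteq> 0"
  then obtain a b where ab: "a \<in> supp f" "b \<in> supp g" "x = a \<otimes> b" by (rule mult_nonzeroE)
  have c: "a \<in> carrier G" "b \<in> carrier G" using ab MN_supp assms(1,2) by blast+
  have "\<one> \<otimes> x \<lessdot> a \<otimes> b" using ab assms c by (intro lt_mult') auto
  then show False using ab(3) assms(3) lt_irrefl[of x] by simp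
qed

text \<open>A factor \<open>a\<close> above \<open>\<one>\<close> would need the partner
  \<open>inv a \<otimes> x\<close>, which lies below \<open>x\<close> and so outside the support of
  \<open>g\<close>. Only the factorisation \<open>\<one> \<otimes> x\<close> remains.\<close>

lemma mult_lead:
  assumes "f \<in> MN" "g \<in> MN" "x \<in> carrier G"
    and f: "\<And>a. a \<in> supp f \<Longrightarrow> \<not> a \<lessdot> \<one>" and g: "\<And>b. b \<in> supp g \<Longrightarrow> \<not> b \<lessdot> x"
  shows "(f \<star> g) x = f \<one> * g x"
proof -
  have sub: "{a \<in> supp f. inv a \<otimes> x \<in> supp g} \<subseteq> {\<one>}"
  proof
    fix a assume a: "a \<in> {a \<in> supp f. inv a \<otimes> x \<in> supp g}"
    have c: "a \<in> carrier G" using a MN_supp assms(1) by blast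
    show "a \<in> {\<one>}"
    proof (rule ccontr)
      assume "a \<notin> {\<one>}"
      then have "\<one> \<lessdot> a" using lt_total[of a \<one>] f[of a] a c by auto
      then have "inv a \<lessdot> \<one>" using lt_inv[of \<one> a] c by simp
      then have "inv a \<otimes> x \<lessdot> \<one> \<otimes> x" using c assms(3) by (intro lt_mult_right) auto
      then show False using g[of "inv a \<otimes> x"] a assms(3) by simp
    qed
  qed
  show ?thesis using mult_eq[OF assms(1-3), of "{\<one>}"] sub assms(3) by simp
qed

text \<open>Approximate inverses whose error lies strictly above their support agree on common initial
  segments; their union is the largest one, and a nonzero error would allow one more term.\<close>

lemma right_inverse_unital:
  fixes f :: "'g \<Rightarrow> 'k::field"
  assumes f: "f \<in> MN" "f \<one> = 1" "\<And>a. a \<in> supp f \<Longrightarrow> \<not> a \<lessdot> \<one>"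
  shows "\<exists>g\<in>MN. f \<star> g = single \<one> 1"
proof -
  define err where "err g = single \<one> 1 - f \<star> g" for g
  define App where "App = {g\<in>MN. \<forall>x\<in>supp g. \<forall>y\<in>supp (err g). x \<lessdot> y}"
  have err_MN: "err g \<in> MN" if "g \<in> MN" for g using that f by (simp add: err_def)
  have App_MN: "g \<in> MN" if "g \<in> App" for g using that by (simp add: App_def)
  have App_err: "err g y = 0" if "g \<in> App" "x \<in> supp g" "y = x \<or> y \<lessdot> x" for g x y
  proof (rule ccontr)
    assume "err g y \<noteq> 0"
    then have "x \<lessdot> y" "y \<in> supp (err g)" using that by (auto simp: App_def supp_def)
    moreover have "x \<in> carrier G" using that App_MN MN_supp by blast
    moreover have "y \<in> carrier G" using calculation(2) err_MN App_MN that(1) MN_supp by blast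
    ultimately show False using that(3) lt_irrefl[of x] lt_asym[of x y] by blast
  qed
  \<comment> \<open>At the first place \<open>m\<close> where \<open>g\<close> and \<open>g'\<close>
    differ, \<open>f \<star> (g - g')\<close> has the nonzero value of \<open>g - g'\<close>,
    because \<open>f\<close> has leading term one. But it equals the difference of the two errors,
    and both vanish at \<open>m\<close>.\<close>
  have agree: "g z = g' z"
    if g: "g \<in> App" "g' \<in> App" and y: "y \<in> supp g" and x: "x \<in> supp g'" "x = y \<or> x \<lessdot> y"
      and z: "z = x \<or> z \<lessdot> x" "z \<in> carrier G" for g g' x y z
  proof (rule ccontr)
    assume ne: "g z \<noteq> g' z"
    note MN = App_MN[OF g(1)] App_MN[OF g(2)]
    have c: "x \<in> carrier G" "y \<in> carrier G" using x y MN MN_supp by blast+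
    have D: "g - g' \<in> MN" using MN by simp
    have zD: "z \<in> supp (g - g')" using ne by (simp add: supp_def)
    then obtain m where m: "m \<in> supp (g - g')" "\<And>s. s \<in> supp (g - g') \<Longrightarrow> s = m \<or> m \<lessdot> s"
      using well_ordered_min[OF MN_well_ordered[OF D] MN_supp[OF D]] by (metis empty_iff)
    have mc: "m \<in> carrier G" using m MN_supp[OF D] by blast
    have "m = z \<or> m \<lessdot> z" using m(2)[OF zD] by blast
    then have mx: "m = x \<or> m \<lessdot> x" using z lt_trans[OF mc z(2) c(1)] by blast
    then have my: "m = y \<or> m \<lessdot> y" using x(2) lt_trans[OF mc c] by blast
    have "\<not> s \<lessdot> m" if "s \<in> supp (g - g')" for s
      using m(2)[OF that] lt_irrefl[OF mc] lt_asym[OF mc, of s] subsetD[OF MN_supp[OF D] that] by blast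
    then have "(f \<star> (g - g')) m = (g - g') m"
      using mult_lead[OF f(1) D mc f(3)] f(2) by simp
    moreover have "f \<star> g = f \<star> (g - g') + f \<star> g'"
      using mult_distrib_left[OF f(1) D MN(2)] by simp
    ultimately have "err g' m - err g m = (g - g') m" by (simp add: err_def)
    then show False
      using App_err[OF g(1) y my] App_err[OF g(2) x(1) mx] m(1) by (simp add: supp_def)
  qed
  \<comment> \<open>The union of all approximations. By \<open>agree\<close> the chosen
    \<open>g\<close> does not matter, and \<open>l\<close> coincides with \<open>g\<close> up to
    every point of the support of \<open>g\<close>.\<close>
  define l where "l x = (if \<exists>g\<in>App. g x \<noteq> 0 then (SOME g. g \<in> App \<and> g x \<noteq> 0) x else 0)" for x
  have l_eq: "l z = g z" if g: "g \<in> App" "x \<in> supp g" "z = x \<or> z \<lessdot> x" "z \<in> carrier G" for g x z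
  proof (cases "\<exists>g\<in>App. g z \<noteq> 0")
    case True
    define g1 where "g1 = (SOME g. g \<in> App \<and> g z \<noteq> 0)"
    have g1: "g1 \<in> App" "g1 z \<noteq> 0"
      using someI_ex[of "\<lambda>g. g \<in> App \<and> g z \<noteq> 0"] True unfolding g1_def by blast+
    then have "g z = g1 z" using agree[OF g(1) g1(1) g(2) _ g(3), of z] g(4) by (simp add: supp_def)
    then show ?thesis using True by (simp add: l_def g1_def)
  qed (use g in \<open>auto simp: l_def\<close>)
  have l_supp: "\<exists>g\<in>App. x \<in> supp g" if "x \<in> supp l" for x
    using that by (auto simp: supp_def l_def split: if_splits)
  have l_MN: "l \<in> MN"
  proof (rule MN_I)
    show sub: "supp l \<subseteq> carrier G" using l_supp App_MN MN_supp by blast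
    show "well_ordered_on lt (supp l)"
      unfolding well_ordered_on_def
    proof (intro allI impI)
      fix T assume T: "T \<subseteq> supp l" "T \<noteq> {}"
      then obtain s where s: "s \<in> T" by blast
      then obtain g where g: "g \<in> App" "s \<in> supp g" using T l_supp by blast
      define T' where "T' = {t\<in>T. t = s \<or> t \<lessdot> s}"
      have "t \<in> supp g" if "t \<in> T'" for t
      proof -
        have t: "t = s \<or> t \<lessdot> s" "t \<in> supp l" "t \<in> carrier G" using that T sub by (auto simp: T'_def)
        then show ?thesis using l_eq[OF g t(1,3)] by (simp add: supp_def)
      qed
      then have "T' \<subseteq> supp g" "T' \<noteq> {}" using s by (auto simp: T'_def)
      then obtain m where m: "m \<in> T'" "\<And>t. t \<in> T' \<Longrightarrow> \<not> t \<lessdot> m"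
        using MN_well_ordered[OF App_MN[OF g(1)]] unfolding well_ordered_on_def by meson
      have c: "s \<in> carrier G" "m \<in> carrier G" using s m sub T by (auto simp: T'_def)
      have "\<not> t \<lessdot> m" if "t \<in> T" for t
      proof
        assume tm: "t \<lessdot> m"
        have tc: "t \<in> carrier G" using that sub T by blast
        have "m = s \<or> m \<lessdot> s" using m(1) by (simp add: T'_def)
        then have "t \<lessdot> s" using tm lt_trans[OF tc c(2,1)] by blast
        then have "t \<in> T'" using that by (simp add: T'_def)
        then show False using m(2) tm by blast
      qed
      then show "\<exists>m\<in>T. \<forall>s\<in>T. \<not> s \<lessdot> m" using m(1) unfolding T'_def by blast
    qed
  qed
  have l_App: "l \<in> App"
    unfolding App_def
  proof (intro CollectI conjI l_MN ballI)
    fix x y assume x: "x \<in> supp l" and y: "y \<in> supp (err l)"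
    obtain g where g: "g \<in> App" "x \<in> supp g" using x l_supp by blast
    have c: "x \<in> carrier G" "y \<in> carrier G" using x y l_MN err_MN[OF l_MN] MN_supp by blast+
    show "x \<lessdot> y"
    proof (rule ccontr)
      assume n: "\<not> x \<lessdot> y"
      then have yx: "y = x \<or> y \<lessdot> x" using lt_total[OF c] by blast
      have D: "l - g \<in> MN" using l_MN App_MN[OF g(1)] by simp
      have "y \<lessdot> b" if "b \<in> supp (l - g)" for b
      proof -
        have bc: "b \<in> carrier G" using that D MN_supp by blast
        have "\<not> (b = x \<or> b \<lessdot> x)" using l_eq[OF g _ bc] that by (auto simp: supp_def)
        then have "x \<lessdot> b" using lt_total[OF bc c(1)] by blast
        then show ?thesis using yx lt_trans[OF c(2,1) bc] by blast
      qed
      then have "(f \<star> (l - g)) y = 0" by (intro mult_less_zero f D c(2)) auto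
      moreover have "f \<star> l = f \<star> (l - g) + f \<star> g"
        using mult_distrib_left[OF f(1) D App_MN[OF g(1)]] by simp
      ultimately have "err l y = err g y" by (simp add: err_def)
      then show False using App_err[OF g yx] y by (simp add: supp_def)
    qed
  qed
  have "err l = 0"
  proof (rule ccontr)
    assume "err l \<noteq> 0"
    then obtain w where w: "w \<in> supp (err l)" "\<And>s. s \<in> supp (err l) \<Longrightarrow> s = w \<or> w \<lessdot> s"
      using well_ordered_min[OF MN_well_ordered[OF err_MN[OF l_MN]] MN_supp[OF err_MN[OF l_MN]]]
      by (metis supp_empty_iff)
    have wc: "w \<in> carrier G" using w err_MN[OF l_MN] MN_supp by blast
    define c where "c = err l w"
    \<comment> \<open>The first term of the error is added to \<open>l\<close>. It cancels the error
      at \<open>w\<close> and leaves everything below \<open>w\<close> alone, so \<open>g\<close> is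
      a proper extension of \<open>l\<close> that is still an approximation.\<close>
    define g where "g = l + single w c"
    have g_MN: "g \<in> MN" using wc l_MN by (simp add: g_def)
    have err_g: "err g = err l - f \<star> single w c"
      using mult_distrib_left[OF f(1) l_MN, of "single w c"] wc by (simp add: err_def g_def)
    have lw: "\<not> s \<lessdot> w" if "s \<in> supp (single w c)" for s
      using that supp_single_subset[of w c] lt_irrefl[OF wc] by auto
    have gt: "w \<lessdot> y" if y: "y \<in> supp (err g)" for y
    proof (rule ccontr)
      assume n: "\<not> w \<lessdot> y"
      have yc: "y \<in> carrier G" using y err_MN[OF g_MN] MN_supp by blast
      have "err g y = 0"
      proof (cases "y = w")
        case True
        have "(f \<star> single w c) w = c"
          using mult_lead[OF f(1) _ wc f(3), of "single w c"] lw wc f(2) by (simp add: single_apply)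
        then show ?thesis using True by (simp add: err_g c_def)
      next
        case False
        then have "y \<lessdot> w" using n lt_total[OF yc wc] by blast
        then have "(f \<star> single w c) y = 0"
          using supp_single_subset[of w c] wc by (intro mult_less_zero f yc) auto
        moreover have "err l y = 0"
          using w(2)[of y] False n by (auto simp: supp_def)
        ultimately show ?thesis by (simp add: err_g)
      qed
      then show False using y by (simp add: supp_def)
    qed
    have "g \<in> App"
      unfolding App_def
    proof (intro CollectI conjI g_MN ballI)
      fix x y assume x: "x \<in> supp g" and y: "y \<in> supp (err g)"
      have c: "x \<in> carrier G" "y \<in> carrier G" using x y g_MN err_MN[OF g_MN] MN_supp by blast+
      have "x \<in> supp l \<or> x = w"
        using x supp_add_subset[of l "single w c"] supp_single_subset[of w c] unfolding g_def by blast
      then have "x = w \<or> x \<lessdot> w" using l_App w(1) unfolding App_def by blast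
      then show "x \<lessdot> y" using gt[OF y] lt_trans[OF c(1) wc c(2)] by blast
    qed
    moreover have "l w = 0"
      using l_App w(1) lt_irrefl[OF wc] unfolding App_def supp_def by blast
    then have "g w \<noteq> 0" using w(1) by (simp add: g_def single_def c_def supp_def)
    ultimately show False using l_eq[of g w w] wc \<open>l w = 0\<close> by (simp add: supp_def)
  qed
  then show ?thesis using l_MN by (intro bexI[of _ l]) (simp_all add: err_def)
qed

text \<open>Right multiplication by the inverse of the leading monomial moves the leading term to
  \<open>\<one>\<close> with coefficient one, where \<open>right_inverse_unital\<close>
  applies.\<close>

lemma right_inverse:
  fixes f :: "'g \<Rightarrow> 'k::field"
  assumes f: "f \<in> MN" "f \<noteq> 0"
  shows "\<exists>g\<in>MN. f \<star> g = single \<one> 1"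
proof -
  obtain m where m: "m \<in> supp f" "\<And>s. s \<in> supp f \<Longrightarrow> s = m \<or> m \<lessdot> s"
    using well_ordered_min[OF MN_well_ordered[OF f(1)] MN_supp[OF f(1)]] f(2) by (metis supp_empty_iff)
  have mc: "m \<in> carrier G" using m MN_supp[OF f(1)] by blast
  define s where "s = single (inv m) (inverse (f m))"
  have s: "s \<in> MN" using mc by (simp add: s_def)
  have "\<exists>g\<in>MN. (f \<star> s) \<star> g = single \<one> 1"
  proof (rule right_inverse_unital)
    show "f \<star> s \<in> MN" using f s by simp
    show "(f \<star> s) \<one> = 1" using mc m(1) f(1) by (simp add: s_def mult_single supp_def)
    fix a assume "a \<in> supp (f \<star> s)"
    then obtain x b where x: "x \<in> supp f" "b \<in> supp s" "a = x \<otimes> b"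
      using mult_nonzeroE[of f s a] by (auto simp: supp_def)
    moreover have "b = inv m" using x(2) supp_single_subset[of "inv m" "inverse (f m)"] unfolding s_def by blast
    ultimately have x: "x \<in> supp f" "a = x \<otimes> inv m" by simp_all
    have xc: "x \<in> carrier G" using x MN_supp[OF f(1)] by blast
    have "\<not> x \<lessdot> m" using m(2)[OF x(1)] lt_irrefl[OF mc] lt_asym[OF mc xc] by blast
    then have "\<not> x \<otimes> inv m \<lessdot> m \<otimes> inv m"
      using mc xc lt_irrefl[of "inv m"] by (intro not_lt_mult) auto
    then show "\<not> a \<lessdot> \<one>" using mc x by simp
  qed
  then obtain g where "g \<in> MN" "(f \<star> s) \<star> g = single \<one> 1" by blast
  then show ?thesis using mult_assoc[OF f(1) s, of g] s by (intro bexI[of _ "s \<star> g"]) auto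
qed

lemma MN_inverse:
  fixes f :: "'g \<Rightarrow> 'k::field"
  assumes f: "f \<in> MN" "f \<noteq> 0"
  shows "\<exists>g\<in>MN. f \<star> g = single \<one> 1 \<and> g \<star> f = single \<one> 1"
proof -
  obtain g where g: "g \<in> MN" "f \<star> g = single \<one> 1" using right_inverse[OF f] by blast
  have "f \<star> 0 = 0" using mult_distrib_left[OF f(1) MN_zero MN_zero] by simp
  moreover have "single \<one> 1 \<noteq> (0 :: 'g \<Rightarrow> 'k)" by (auto simp: single_def fun_eq_iff)
  ultimately have "g \<noteq> 0" using g by auto
  then obtain h where h: "h \<in> MN" "g \<star> h = single \<one> 1" using right_inverse g(1) by blast
  have "f = f \<star> (g \<star> h)" using h f(1) by simp
  also have "\<dots> = h" using mult_assoc[OF f(1) g(1) h(1)] g(2) h(1) by simp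
  finally show ?thesis using g h by auto
qed

end

text \<open>The carrier is a subset of an additive group type because several division rings of
  series live in the same function type with the same product. One element may thus belong to
  several of them, and \<open>S\<close> can be compared inside all.\<close>

locale div_ring =
  fixes D :: "'a::ab_group_add set"
    and mult :: "'a \<Rightarrow> 'a \<Rightarrow> 'a"  (infixl "\<star>" 70)
    and one :: 'a
  assumes zero_closed [simp]: "0 \<in> D"
    and add_closed [simp]: "a \<in> D \<Longrightarrow> b \<in> D \<Longrightarrow> a + b \<in> D"
    and uminus_closed [simp]: "a \<in> D \<Longrightarrow> - a \<in> D"
    and mult_closed [simp]: "a \<in> D \<Longrightarrow> b \<in> D \<Longrightarrow> a \<star> b \<in> D"
    and one_closed [simp]: "one \<in> D"
    and assoc: "a \<in> D \<Longrightarrow> b \<in> D \<Longrightarrow> c \<in> D \<Longrightarrow> a \<star> b \<star> c = a \<star> (b \<star> c)"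
    and one_left [simp]: "a \<in> D \<Longrightarrow> one \<star> a = a"
    and one_right [simp]: "a \<in> D \<Longrightarrow> a \<star> one = a"
    and distl: "a \<in> D \<Longrightarrow> b \<in> D \<Longrightarrow> c \<in> D \<Longrightarrow> a \<star> (b + c) = a \<star> b + a \<star> c"
    and distr: "a \<in> D \<Longrightarrow> b \<in> D \<Longrightarrow> c \<in> D \<Longrightarrow> (b + c) \<star> a = b \<star> a + c \<star> a"
    and one_neq_zero [simp]: "one \<noteq> 0"
    and inverse_ex: "a \<in> D \<Longrightarrow> a \<noteq> 0 \<Longrightarrow> \<exists>b\<in>D. a \<star> b = one \<and> b \<star> a = one"
begin

lemma diff_closed [simp]: "a \<in> D \<Longrightarrow> b \<in> D \<Longrightarrow> a - b \<in> D"
  by (metis add_closed uminus_closed diff_conv_add_uminus)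

lemma mult_zero_right [simp]: "a \<in> D \<Longrightarrow> a \<star> 0 = 0"
  using distl[of a 0 0] by simp

lemma mult_zero_left [simp]: "a \<in> D \<Longrightarrow> 0 \<star> a = 0"
  using distr[of a 0 0] by simp

lemma mult_uminus_right [simp]: "a \<in> D \<Longrightarrow> b \<in> D \<Longrightarrow> a \<star> (- b) = - (a \<star> b)"
  using distl[of a b "- b"] by (simp add: eq_neg_iff_add_eq_0 add.commute)

lemma mult_uminus_left [simp]: "a \<in> D \<Longrightarrow> b \<in> D \<Longrightarrow> (- b) \<star> a = - (b \<star> a)"
  using distr[of a b "- b"] by (simp add: eq_neg_iff_add_eq_0 add.commute)

lemma diffl: "a \<in> D \<Longrightarrow> b \<in> D \<Longrightarrow> c \<in> D \<Longrightarrow> a \<star> (b - c) = a \<star> b - a \<star> c"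
  using distl[of a b "- c"] by simp

lemma diffr: "a \<in> D \<Longrightarrow> b \<in> D \<Longrightarrow> c \<in> D \<Longrightarrow> (b - c) \<star> a = b \<star> a - c \<star> a"
  using distr[of a b "- c"] by simp

lemmas ring_rules = assoc distl distr diffl diffr

definition rinv :: "'a \<Rightarrow> 'a" where
  "rinv a = (SOME b. b \<in> D \<and> a \<star> b = one \<and> b \<star> a = one)"

lemma rinv:
  assumes "a \<in> D" "a \<noteq> 0"
  shows rinv_closed: "rinv a \<in> D" and rinv_right [simp]: "a \<star> rinv a = one" and rinv_left [simp]: "rinv a \<star> a = one"
  using someI_ex[of "\<lambda>b. b \<in> D \<and> a \<star> b = one \<and> b \<star> a = one"] inverse_ex[OF assms]
  unfolding rinv_def by blast+

lemma rinv_unique: "a \<in> D \<Longrightarrow> b \<in> D \<Longrightarrow> a \<star> b = one \<Longrightarrow> rinv a = b"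
proof -
  assume a: "a \<in> D" "b \<in> D" "a \<star> b = one"
  then have "a \<noteq> 0" using one_neq_zero by (metis mult_zero_left)
  then have r: "rinv a \<in> D" "rinv a \<star> a = one" using rinv a by auto
  have "rinv a \<star> (a \<star> b) = b" using assoc[of "rinv a" a b] r a by simp
  then show "rinv a = b" using a r by simp
qed

lemma rinv_unique': "a \<in> D \<Longrightarrow> b \<in> D \<Longrightarrow> b \<star> a = one \<Longrightarrow> rinv a = b"
proof -
  assume a: "a \<in> D" "b \<in> D" "b \<star> a = one"
  then have "a \<noteq> 0" using one_neq_zero by (metis mult_zero_right)
  then have r: "rinv a \<in> D" "a \<star> rinv a = one" using rinv a by auto
  have "(b \<star> a) \<star> rinv a = b" using assoc[of b a "rinv a"] r a by simp
  then show "rinv a = b" using a r by simp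
qed

lemma no_zero_divisors:
  assumes "a \<in> D" "b \<in> D" "a \<noteq> 0" "b \<noteq> 0" shows "a \<star> b \<noteq> 0"
proof
  assume "a \<star> b = 0"
  then have "rinv a \<star> (a \<star> b) = 0" using assms rinv_closed by simp
  then show False using assms assoc[of "rinv a" a b] rinv[of a] by simp
qed

lemma mult_right_cancel:
  assumes "a \<in> D" "b \<in> D" "c \<in> D" "a \<noteq> 0" "b \<star> a = c \<star> a" shows "b = c"
  using no_zero_divisors[of "b - c" a] assms by (auto simp: diffr)

lemma rinv_nonzero: "a \<in> D \<Longrightarrow> a \<noteq> 0 \<Longrightarrow> rinv a \<noteq> 0"
  using rinv[of a] by (metis mult_zero_right one_neq_zero)

lemma rinv_one [simp]: "rinv one = one"
  by (intro rinv_unique) auto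

lemma rinv_cancel [simp]:
  assumes "a \<in> D" "a \<noteq> 0" "x \<in> D"
  shows "rinv a \<star> (a \<star> x) = x" "a \<star> (rinv a \<star> x) = x"
  using assms assoc[of "rinv a" a x] assoc[of a "rinv a" x] rinv[of a] by simp_all

end

section \<open>Poles\<close>

locale pole = div_ring +
  fixes K :: "'a set" and t p :: 'a and \<tau> :: "'a \<Rightarrow> 'a"
  assumes K_D: "K \<subseteq> D"
    and K_add: "a \<in> K \<Longrightarrow> b \<in> K \<Longrightarrow> a + b \<in> K"
    and K_uminus: "a \<in> K \<Longrightarrow> - a \<in> K"
    and K_mult: "a \<in> K \<Longrightarrow> b \<in> K \<Longrightarrow> a \<star> b \<in> K"
    and K_one: "one \<in> K"
    and K_rinv: "a \<in> K \<Longrightarrow> a \<noteq> 0 \<Longrightarrow> rinv a \<in> K"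
    and t_D [simp]: "t \<in> D" and p_D [simp]: "p \<in> D"
    and \<tau>_K: "c \<in> K \<Longrightarrow> \<tau> c \<in> K"
    and t_K: "c \<in> K \<Longrightarrow> t \<star> c = \<tau> c \<star> t"
    and p_inverse: "(one - t) \<star> p = one"
begin

lemma K_D' [simp]: "a \<in> K \<Longrightarrow> a \<in> D" using K_D by blast

lemma K_diff: "a \<in> K \<Longrightarrow> b \<in> K \<Longrightarrow> a - b \<in> K"
  by (metis K_add K_uminus diff_conv_add_uminus)

lemma K_zero: "0 \<in> K"
  using K_add[OF K_one K_uminus[OF K_one]] by simp

definition coboundaries :: "'a set" where "coboundaries = {c - \<tau> c |c. c \<in> K}"

text \<open>These are the left submodules of \<open>D\<close> over the skew polynomial ring
  generated by \<open>K\<close> and \<open>t\<close>.\<close>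

definition stable :: "'a set \<Rightarrow> bool" where
  "stable M \<longleftrightarrow> M \<subseteq> D \<and> 0 \<in> M \<and> (\<forall>a\<in>M. \<forall>b\<in>M. a + b \<in> M) \<and>
     (\<forall>c\<in>K. \<forall>a\<in>M. c \<star> a \<in> M) \<and> (\<forall>a\<in>M. t \<star> a \<in> M)"

text \<open>The module \<open>M + K p M\<close>: poles of order one more than those allowed in
  \<open>M\<close>.\<close>

inductive_set extend :: "'a set \<Rightarrow> 'a set" for M where
  base: "a \<in> M \<Longrightarrow> a \<in> extend M"
| step: "v \<in> extend M \<Longrightarrow> c \<in> K \<Longrightarrow> z \<in> M \<Longrightarrow> v + c \<star> (p \<star> z) \<in> extend M"

lemma t_p: "z \<in> D \<Longrightarrow> t \<star> (p \<star> z) = p \<star> z - z"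
proof -
  assume z: "z \<in> D"
  have "(one - t) \<star> p \<star> z = z" using p_inverse z by simp
  then have "p \<star> z - t \<star> (p \<star> z) = z" using z by (simp add: diffr assoc)
  then show ?thesis by (simp add: algebra_simps)
qed

lemma stableD:
  assumes "stable M"
  shows "M \<subseteq> D" "0 \<in> M" "a \<in> M \<Longrightarrow> b \<in> M \<Longrightarrow> a + b \<in> M" "c \<in> K \<Longrightarrow> a \<in> M \<Longrightarrow> c \<star> a \<in> M"
    "a \<in> M \<Longrightarrow> t \<star> a \<in> M" "a \<in> M \<Longrightarrow> a \<in> D"
  using assms unfolding stable_def by blast+

lemma stable_uminus: assumes "stable M" "a \<in> M" shows "- a \<in> M"
  using stableD(4)[OF assms(1) K_uminus[OF K_one] assms(2)] stableD(6)[OF assms] by simp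

lemma stable_diff: "stable M \<Longrightarrow> a \<in> M \<Longrightarrow> b \<in> M \<Longrightarrow> a - b \<in> M"
  using stableD(3)[of M a "- b"] stable_uminus by simp

lemma stable_scale_iff:
  assumes "stable M" "c \<in> K" "c \<noteq> 0" "a \<in> D" shows "c \<star> a \<in> M \<longleftrightarrow> a \<in> M"
proof
  assume "c \<star> a \<in> M"
  then have "rinv c \<star> (c \<star> a) \<in> M" using assms K_rinv stableD(4) by blast
  then show "a \<in> M" using assms by simp
qed (rule stableD(4)[OF assms(1,2)])

lemma t_cp:
  assumes "c \<in> K" "z \<in> D"
  shows "t \<star> (c \<star> (p \<star> z)) = \<tau> c \<star> (p \<star> z) - \<tau> c \<star> z"
proof -
  have "t \<star> (c \<star> (p \<star> z)) = t \<star> c \<star> (p \<star> z)" using assms by (simp add: assoc)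
  also have "\<dots> = \<tau> c \<star> (t \<star> (p \<star> z))" using assms t_K \<tau>_K by (simp add: assoc)
  also have "\<dots> = \<tau> c \<star> (p \<star> z) - \<tau> c \<star> z" using assms \<tau>_K by (simp add: t_p diffl)
  finally show ?thesis .
qed

text \<open>The only point beyond bookkeeping is
  \<open>t (c p z) = \<tau> c p z - \<tau> c z\<close>, whose correction term lies in
  \<open>M\<close>.\<close>

lemma stable_extend:
  assumes M: "stable M" shows "stable (extend M)"
proof -
  have D: "v \<in> D" if "v \<in> extend M" for v
    using that by induction (use stableD[OF M] in auto)
  have add: "u + v \<in> extend M" if "v \<in> extend M" "u \<in> extend M" for u v
    using that(1)
  proof induction
    case (base a)
    show ?case using that(2) base
    proof (induction u)
      case (base b)
      then show ?case using stableD(3)[OF M] extend.base by blast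
    next
      case (step v c z)
      then have "(v + a) + c \<star> (p \<star> z) \<in> extend M" by (intro extend.step)
      then show ?case by (simp add: algebra_simps)
    qed
  next
    case (step v c z)
    then have "(u + v) + c \<star> (p \<star> z) \<in> extend M" by (intro extend.step)
    then show ?case by (simp add: algebra_simps)
  qed
  have scale: "c \<star> v \<in> extend M" if "v \<in> extend M" "c \<in> K" for c v
    using that(1)
  proof induction
    case (base a)
    then show ?case using stableD(4)[OF M] that(2) extend.base by blast
  next
    case (step v e z)
    have "c \<star> v + (c \<star> e) \<star> (p \<star> z) \<in> extend M"
      using step that(2) K_mult by (intro extend.step) auto
    moreover have "c \<star> (v + e \<star> (p \<star> z)) = c \<star> v + (c \<star> e) \<star> (p \<star> z)"
      using step that(2) D stableD(6)[OF M] by (simp add: distl assoc)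
    ultimately show ?case by simp
  qed
  have t: "t \<star> v \<in> extend M" if "v \<in> extend M" for v
    using that
  proof induction
    case (base a)
    then show ?case using stableD(5)[OF M] extend.base by blast
  next
    case (step v c z)
    have z: "z \<in> D" using step stableD(6)[OF M] by blast
    have "\<tau> c \<star> z \<in> M" using step \<tau>_K stableD(4)[OF M] by blast
    then have "- (\<tau> c \<star> z) \<in> extend M" using stable_uminus[OF M] extend.base by blast
    then have "t \<star> v + (- (\<tau> c \<star> z)) \<in> extend M" using step add by blast
    then have "t \<star> v + (- (\<tau> c \<star> z)) + \<tau> c \<star> (p \<star> z) \<in> extend M"
      by (rule extend.step) (use step \<tau>_K in auto)
    moreover have "t \<star> (v + c \<star> (p \<star> z)) = t \<star> v + (- (\<tau> c \<star> z)) + \<tau> c \<star> (p \<star> z)"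
      using step z D by (simp add: distl t_cp)
    ultimately show ?case by simp
  qed
  show ?thesis unfolding stable_def using D add scale t extend.base stableD(2)[OF M] by blast
qed

lemma one_minus_t_p:
  assumes "c \<in> K" "z \<in> D"
  shows "(one - t) \<star> (c \<star> (p \<star> z)) = (c - \<tau> c) \<star> (p \<star> z) + \<tau> c \<star> z"
  using assms \<tau>_K by (simp add: diffr t_cp)

lemma stable_one_minus_t: "stable M \<Longrightarrow> a \<in> M \<Longrightarrow> (one - t) \<star> a \<in> M"
  using stable_diff[of M a "t \<star> a"] stableD[of M] by (simp add: diffr)

text \<open>Elements of \<open>extend M\<close> lie in the sum of the line \<open>K p z\<close> and a stable subspace
  avoiding \<open>p z\<close>, because a stable subspace remains stable when a new \<open>p z'\<close> is adjoined.\<close>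

lemma extend_complement:
  assumes M: "stable M" and z: "z \<in> M" "p \<star> z \<notin> M" and v: "v \<in> extend M"
  shows "\<exists>N. stable N \<and> M \<subseteq> N \<and> p \<star> z \<notin> N \<and> (\<exists>c\<in>K. v - c \<star> (p \<star> z) \<in> N)"
  using v
proof induction
  case (base a)
  have "a - 0 \<star> (p \<star> z) = a" using stableD(6)[OF M z(1)] by simp
  then have "a - 0 \<star> (p \<star> z) \<in> M" using base by simp
  then show ?case using M z(2) K_zero by blast
next
  case (step v c y)
  then obtain N b where N: "stable N" "M \<subseteq> N" "p \<star> z \<notin> N" and b: "b \<in> K" "v - b \<star> (p \<star> z) \<in> N" by blast
  have D: "z \<in> D" "y \<in> D" using z(1) step stableD(6)[OF M] by auto
  show ?case
  \<comment> \<open>Either the new generator \<open>p y\<close> is congruent to a multiple of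
    \<open>p z\<close> modulo \<open>N\<close>, and the coefficient of \<open>p z\<close> is
    adjusted; or \<open>N\<close> is enlarged by \<open>K p y\<close>. In the second case
    \<open>p z\<close> stays outside, since a relation putting it inside could be solved for
    \<open>p y\<close>, which is the first case.\<close>
  proof (cases "\<exists>e\<in>K. p \<star> y - e \<star> (p \<star> z) \<in> N")
    case True
    then obtain e where e: "e \<in> K" "p \<star> y - e \<star> (p \<star> z) \<in> N" by blast
    have "(v - b \<star> (p \<star> z)) + c \<star> (p \<star> y - e \<star> (p \<star> z)) \<in> N"
      using stableD(3,4)[OF N(1)] b e step by blast
    moreover have "(v - b \<star> (p \<star> z)) + c \<star> (p \<star> y - e \<star> (p \<star> z)) = v + c \<star> (p \<star> y) - (b + c \<star> e) \<star> (p \<star> z)"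
      using D b e step by (simp add: ring_rules algebra_simps)
    ultimately show ?thesis using N b e step K_add K_mult by (intro exI[of _ N]) (auto intro!: bexI[of _ "b + c \<star> e"])
  next
    case False
    define N' where "N' = {m + e \<star> (p \<star> y) |m e. m \<in> N \<and> e \<in> K}"
    have sub: "N \<subseteq> N'"
    proof
      fix m assume m: "m \<in> N"
      have "m = m + 0 \<star> (p \<star> y)" using D by simp
      then show "m \<in> N'" using m K_zero unfolding N'_def by blast
    qed
    have "stable N'"
      unfolding stable_def
    proof (intro conjI ballI)
      show "N' \<subseteq> D" using stableD(6)[OF N(1)] D by (auto simp: N'_def)
      show "0 \<in> N'" using sub stableD(2)[OF N(1)] by blast
    next
      fix u w assume "u \<in> N'" "w \<in> N'"
      then obtain m e m' e' where *: "u = m + e \<star> (p \<star> y)" "w = m' + e' \<star> (p \<star> y)" "m \<in> N" "m' \<in> N" "e \<in> K" "e' \<in> K"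
        unfolding N'_def by blast
      have "u + w = (m + m') + (e + e') \<star> (p \<star> y)" using * D by (simp add: distr algebra_simps)
      then show "u + w \<in> N'" using * stableD(3)[OF N(1)] K_add unfolding N'_def by blast
    next
      fix a u assume a: "a \<in> K" and "u \<in> N'"
      then obtain m e where *: "u = m + e \<star> (p \<star> y)" "m \<in> N" "e \<in> K" unfolding N'_def by blast
      have "a \<star> u = a \<star> m + (a \<star> e) \<star> (p \<star> y)" using * a D stableD(6)[OF N(1)] by (simp add: distl assoc)
      then show "a \<star> u \<in> N'" using * a stableD(4)[OF N(1)] K_mult unfolding N'_def by blast
    next
      fix u assume "u \<in> N'"
      then obtain m e where *: "u = m + e \<star> (p \<star> y)" "m \<in> N" "e \<in> K" unfolding N'_def by blast
      have "t \<star> u = (t \<star> m - \<tau> e \<star> y) + \<tau> e \<star> (p \<star> y)"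
        using * D stableD(6)[OF N(1)] by (simp add: distl t_cp algebra_simps)
      moreover have "t \<star> m - \<tau> e \<star> y \<in> N"
        using * stableD(5)[OF N(1)] stableD(4)[OF N(1)] \<tau>_K N(2) step(3) stable_diff[OF N(1)] by blast
      ultimately show "t \<star> u \<in> N'" using * \<tau>_K unfolding N'_def by blast
    qed
    moreover have "p \<star> z \<notin> N'"
    proof
      assume "p \<star> z \<in> N'"
      then obtain m e where *: "p \<star> z = m + e \<star> (p \<star> y)" "m \<in> N" "e \<in> K" unfolding N'_def by blast
      have "e \<noteq> 0" using * N(3) D by auto
      have "rinv e \<star> (- m) \<in> N" using * K_rinv \<open>e \<noteq> 0\<close> stableD(4)[OF N(1)] stable_uminus[OF N(1)] by blast
      moreover have m: "- m = e \<star> (p \<star> y) - p \<star> z" using *(1) by (simp add: algebra_simps)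
      have "rinv e \<star> (- m) = p \<star> y - rinv e \<star> (p \<star> z)"
        unfolding m using *(3) D \<open>e \<noteq> 0\<close> K_rinv by (simp add: diffl)
      ultimately show False using False * K_rinv \<open>e \<noteq> 0\<close> by auto
    qed
    moreover have "v + c \<star> (p \<star> y) - b \<star> (p \<star> z) \<in> N'"
    proof -
      have "v + c \<star> (p \<star> y) - b \<star> (p \<star> z) = (v - b \<star> (p \<star> z)) + c \<star> (p \<star> y)" by (simp add: algebra_simps)
      then show ?thesis using b(2) step(2) unfolding N'_def by blast
    qed
    ultimately show ?thesis using sub N(2) b(1) by blast
  qed
qed

text \<open>Modulo the complement \<open>N\<close> the element would be \<open>c p z\<close>.
  Applying \<open>1 - t\<close> to the difference gives \<open>(b - (c - \<tau> c)) p z\<close> in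
  \<open>N\<close>. The coefficient is nonzero because \<open>b\<close> is no coboundary, so it can
  be divided out and \<open>p z\<close> would lie in \<open>N\<close>.\<close>

lemma extend_top:
  assumes M: "stable M" and z: "z \<in> M" "p \<star> z \<notin> M" and b: "b \<in> K" "b \<notin> coboundaries"
  shows "p \<star> (b \<star> (p \<star> z)) \<notin> extend M"
proof
  assume "p \<star> (b \<star> (p \<star> z)) \<in> extend M"
  then obtain N c where N: "stable N" "M \<subseteq> N" "p \<star> z \<notin> N" and c: "c \<in> K" "p \<star> (b \<star> (p \<star> z)) - c \<star> (p \<star> z) \<in> N"
    using extend_complement[OF M z] by blast
  have D: "z \<in> D" using z(1) stableD(6)[OF M] by auto
  have "(one - t) \<star> (p \<star> (b \<star> (p \<star> z)) - c \<star> (p \<star> z)) \<in> N" using stable_one_minus_t[OF N(1) c(2)] .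
  moreover have "(one - t) \<star> (p \<star> (b \<star> (p \<star> z))) = b \<star> (p \<star> z)"
    using D b p_inverse assoc[of "one - t" p "b \<star> (p \<star> z)"] by simp
  ultimately have "b \<star> (p \<star> z) - ((c - \<tau> c) \<star> (p \<star> z) + \<tau> c \<star> z) \<in> N"
    using D b c one_minus_t_p by (simp add: diffl)
  moreover have "\<tau> c \<star> z \<in> N" using c \<tau>_K z N(2) stableD(4)[OF N(1)] by blast
  ultimately have "b \<star> (p \<star> z) - ((c - \<tau> c) \<star> (p \<star> z) + \<tau> c \<star> z) + \<tau> c \<star> z \<in> N" using stableD(3)[OF N(1)] by blast
  moreover have "b \<star> (p \<star> z) - ((c - \<tau> c) \<star> (p \<star> z) + \<tau> c \<star> z) + \<tau> c \<star> z = (b - (c - \<tau> c)) \<star> (p \<star> z)"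
    using D b c \<tau>_K K_diff by (simp add: diffr distr algebra_simps)
  moreover have "b - (c - \<tau> c) \<noteq> 0" using b c unfolding coboundaries_def by auto
  ultimately show False
    using stable_scale_iff[OF N(1) _ _, of "b - (c - \<tau> c)" "p \<star> z"] K_diff b c \<tau>_K D N(3) by auto
qed

text \<open>The leading coefficient of a pole: \<open>y\<close> is \<open>k p z\<close> up to terms
  in \<open>M\<close>, for some pole \<open>p z\<close> missed by \<open>M\<close>. Leaving
  \<open>z\<close> unspecified allows the coefficient to be absorbed into \<open>z\<close> when the
  next \<open>p\<close> is applied.\<close>

definition top :: "'a set \<Rightarrow> 'a \<Rightarrow> 'a \<Rightarrow> bool" where
  "top M k y \<longleftrightarrow> (\<exists>z\<in>M. p \<star> z \<notin> M \<and> y - k \<star> (p \<star> z) \<in> M)"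

lemma top_scale:
  assumes M: "stable M" and "top M k y" "k \<in> K" "e \<in> K" "y \<in> D"
  shows "top M (e \<star> k) (e \<star> y)"
proof -
  obtain z where z: "z \<in> M" "p \<star> z \<notin> M" "y - k \<star> (p \<star> z) \<in> M" using assms(2) unfolding top_def by blast
  have "e \<star> (y - k \<star> (p \<star> z)) \<in> M" using z assms stableD(4)[OF M] by blast
  then show ?thesis using z assms stableD(6)[OF M] unfolding top_def by (auto simp: diffl assoc)
qed

text \<open>Since \<open>(1 - t) k p z\<close> is \<open>(k - \<tau> k) p z\<close> plus the term
  \<open>\<tau> k z\<close> of \<open>M\<close>, the pole keeps its order and its coefficient
  undergoes a difference operator.\<close>

lemma top_one_minus_t:
  assumes M: "stable M" and "top M k y" "k \<in> K" "y \<in> D"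
  shows "top M (k - \<tau> k) ((one - t) \<star> y)"
proof -
  obtain z where z: "z \<in> M" "p \<star> z \<notin> M" "y - k \<star> (p \<star> z) \<in> M" using assms(2) unfolding top_def by blast
  have "(one - t) \<star> (y - k \<star> (p \<star> z)) + \<tau> k \<star> z \<in> M"
    using z assms \<tau>_K stableD(3,4)[OF M] stable_one_minus_t[OF M] by blast
  moreover have "(one - t) \<star> (y - k \<star> (p \<star> z)) + \<tau> k \<star> z = (one - t) \<star> y - (k - \<tau> k) \<star> (p \<star> z)"
    using z assms stableD(6)[OF M] one_minus_t_p[of k z] \<tau>_K by (simp add: diffl)
  ultimately show ?thesis using z unfolding top_def by auto
qed

text \<open>The new \<open>z\<close> is \<open>k p z\<close>, which lies in \<open>extend M\<close>,
  while \<open>extend_top\<close> keeps \<open>p k p z\<close> out of it. Hence the coefficient is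
  reset to \<open>one\<close>.\<close>

lemma top_p:
  assumes M: "stable M" and "top M k y" "k \<in> K" "k \<notin> coboundaries" "y \<in> D"
  shows "top (extend M) one (p \<star> y)"
proof -
  obtain z where z: "z \<in> M" "p \<star> z \<notin> M" "y - k \<star> (p \<star> z) \<in> M" using assms(2) unfolding top_def by blast
  have zD: "z \<in> D" using z stableD(6)[OF M] by blast
  have "0 + k \<star> (p \<star> z) \<in> extend M" using z assms stableD(2)[OF M] by (intro extend.intros)
  moreover have "p \<star> (k \<star> (p \<star> z)) \<notin> extend M" using extend_top[OF M z(1,2) assms(3,4)] .
  moreover have "0 + one \<star> (p \<star> (y - k \<star> (p \<star> z))) \<in> extend M"
    using z K_one stableD(2)[OF M] by (intro extend.intros)
  then have "p \<star> y - one \<star> (p \<star> (k \<star> (p \<star> z))) \<in> extend M"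
    using zD assms by (simp add: diffl)
  ultimately show ?thesis unfolding top_def by auto
qed

lemma top_not_mem:
  assumes M: "stable M" and "top M k y" "k \<in> K" "k \<noteq> 0" shows "y \<notin> M"
proof
  assume y: "y \<in> M"
  obtain z where z: "z \<in> M" "p \<star> z \<notin> M" "y - k \<star> (p \<star> z) \<in> M" using assms(2) unfolding top_def by blast
  have "y - (y - k \<star> (p \<star> z)) \<in> M" using y z stable_diff[OF M] by blast
  then show False using stable_scale_iff[OF M assms(3,4), of "p \<star> z"] z stableD(6)[OF M] by simp
qed

end

text \<open>The six conditions are the coefficients met just before a factor \<open>p\<close>.
  \<open>top1\<close> is for the second \<open>p\<close> applied in a letter, \<open>top2\<close>
  for the second one in an inverse letter. The others concern the first \<open>p\<close>, according
  to the preceding symbol: \<open>top3\<close> letter after letter, \<open>top4\<close> inverse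
  after letter, \<open>top5\<close> letter after inverse, \<open>top6\<close> inverse after inverse.
  Where the indices must differ, the word would otherwise not be reduced. \<open>top2\<close>,
  \<open>top3\<close> and \<open>top5\<close> are stated in the form produced by
  \<open>coboundary_by_parts\<close>.\<close>

locale free_letters = pole +
  fixes \<tau>' :: "'a \<Rightarrow> 'a" and lam lam' \<kappa> :: 'a and d e :: "bool \<Rightarrow> 'a"
  assumes \<tau>_add: "a \<in> K \<Longrightarrow> b \<in> K \<Longrightarrow> \<tau> (a + b) = \<tau> a + \<tau> b"
    and \<tau>_mult: "a \<in> K \<Longrightarrow> b \<in> K \<Longrightarrow> \<tau> (a \<star> b) = \<tau> a \<star> \<tau> b"
    and \<tau>'_K: "a \<in> K \<Longrightarrow> \<tau>' a \<in> K" and \<tau>_\<tau>': "a \<in> K \<Longrightarrow> \<tau> (\<tau>' a) = a"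
    and lam_K: "lam \<in> K" "lam \<noteq> 0" and lam'_K: "lam' \<in> K" "lam' \<noteq> 0"
    and \<kappa>_K: "\<kappa> \<in> K" "\<kappa> \<noteq> 0"
    and d_K: "d i \<in> K" "d i \<noteq> 0" and e_K: "e i \<in> K" "e i \<noteq> 0"
    and top1: "\<kappa> \<notin> coboundaries"
    and top2: "(rinv lam' - \<tau>' (rinv lam')) \<star> (rinv \<kappa> \<star> (rinv lam - \<tau> (rinv lam))) \<notin> coboundaries"
    and top3: "(lam' - \<tau>' lam') \<star> (e j \<star> (d i \<star> (lam - \<tau> lam))) \<notin> coboundaries"
    and top4: "i \<noteq> j \<Longrightarrow> rinv (d j) \<star> (d i \<star> (lam - \<tau> lam)) \<notin> coboundaries"
    and top5: "i \<noteq> j \<Longrightarrow> (lam' - \<tau>' lam') \<star> (e j \<star> rinv (e i)) \<notin> coboundaries"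
    and top6: "rinv (d j) \<star> rinv (e i) \<notin> coboundaries"
begin

lemma \<tau>_uminus: "a \<in> K \<Longrightarrow> \<tau> (- a) = - \<tau> a"
  using \<tau>_add[of a "- a"] \<tau>_add[of 0 0] K_zero K_uminus by (simp add: eq_neg_iff_add_eq_0 add.commute)

lemma \<tau>_diff: "a \<in> K \<Longrightarrow> b \<in> K \<Longrightarrow> \<tau> (a - b) = \<tau> a - \<tau> b"
  using \<tau>_add[of a "- b"] \<tau>_uminus[of b] K_uminus by simp

lemma coboundaries_diff:
  assumes "a \<in> coboundaries" "b \<in> coboundaries" shows "a - b \<in> coboundaries"
proof -
  obtain c c' where c: "a = c - \<tau> c" "b = c' - \<tau> c'" "c \<in> K" "c' \<in> K"
    using assms unfolding coboundaries_def by blast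
  then have "a - b = (c - c') - \<tau> (c - c')" by (simp add: \<tau>_diff algebra_simps)
  then show ?thesis unfolding coboundaries_def using c K_diff by blast
qed

lemma zero_coboundary: "0 \<in> coboundaries"
proof -
  have "0 - \<tau> 0 = 0" using \<tau>_add[of 0 0] K_zero by simp
  then show ?thesis unfolding coboundaries_def using K_zero by (metis (mono_tags, lifting) mem_Collect_eq)
qed

text \<open>Summation by parts: with \<open>c = \<tau>' a f\<close> one has
  \<open>\<tau> c = a \<star> \<tau> f\<close>, so \<open>a (f - \<tau> f)\<close> and
  \<open>(a - \<tau>' a) f\<close> differ by the coboundary \<open>c - \<tau> c\<close>. It moves
  the difference operator off an unwieldy \<open>f\<close> onto \<open>a\<close>.\<close>

lemma coboundary_by_parts:
  assumes "a \<in> K" "f \<in> K" "a \<star> (f - \<tau> f) \<in> coboundaries" shows "(a - \<tau>' a) \<star> f \<in> coboundaries"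
proof -
  let ?c = "\<tau>' a \<star> f"
  have "?c - \<tau> ?c \<in> coboundaries" using assms \<tau>'_K K_mult unfolding coboundaries_def by blast
  then have "a \<star> (f - \<tau> f) - (?c - \<tau> ?c) \<in> coboundaries" using assms coboundaries_diff by blast
  moreover have "a \<star> (f - \<tau> f) - (?c - \<tau> ?c) = (a - \<tau>' a) \<star> f"
    using assms \<tau>'_K \<tau>_K \<tau>_mult \<tau>_\<tau>' by (simp add: diffl diffr)
  ultimately show ?thesis by simp
qed

text \<open>\<open>act (j, False)\<close> is multiplication by \<open>d j \<star> p\<^sup>-\<^sup>1 \<star> lam \<star> p \<star> \<kappa> \<star> p \<star> lam' \<star> p\<^sup>-\<^sup>1 \<star> e j\<close>, and
  \<open>state l\<close> is the coefficient of the pole which it leaves on top.\<close>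

fun act :: "bool \<times> bool \<Rightarrow> 'a \<Rightarrow> 'a" where
  "act (j, False) y = d j \<star> ((one - t) \<star> (lam \<star> (p \<star> (\<kappa> \<star> (p \<star> (lam' \<star> ((one - t) \<star> (e j \<star> y))))))))"
| "act (j, True) y = rinv (e j) \<star> (p \<star> (rinv lam' \<star> ((one - t) \<star> (rinv \<kappa> \<star> ((one - t) \<star> (rinv lam \<star> (p \<star> (rinv (d j) \<star> y))))))))"

fun state :: "bool \<times> bool \<Rightarrow> 'a" where
  "state (i, False) = d i \<star> (lam - \<tau> lam)"
| "state (i, True) = rinv (e i)"

lemmas K_closed = K_mult K_diff K_rinv \<tau>_K \<tau>'_K lam_K lam'_K \<kappa>_K d_K e_K K_one

lemma state_K: "state l \<in> K"
  by (cases l rule: state.cases) (simp_all add: K_closed)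

lemma act_D: "y \<in> D \<Longrightarrow> act l y \<in> D"
  by (cases "(l, y)" rule: act.cases) (simp_all add: K_closed)

text \<open>If \<open>d i (lam - \<tau> lam)\<close> were zero, the product excluded by
  \<open>top3\<close> would be zero, which is a coboundary.\<close>

lemma state_nonzero: "state l \<noteq> 0"
proof (cases l rule: state.cases)
  case (1 i)
  have "(lam' - \<tau>' lam') \<star> (e i \<star> state l) \<notin> coboundaries" using top3 1 by simp
  then show ?thesis using zero_coboundary K_closed(2)[OF lam'_K(1) \<tau>'_K[OF lam'_K(1)]] e_K by auto
next
  case (2 i)
  then show ?thesis using rinv_nonzero e_K by simp
qed

text \<open>The factors are applied from right to left: an element of \<open>K\<close> multiplies
  the leading coefficient, \<open>1 - t\<close> turns \<open>k\<close> into
  \<open>k - \<tau> k\<close>, and \<open>p\<close> extends the module once and resets the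
  coefficient. Letters and inverse letters both contain two factors \<open>p\<close>, hence the two
  extensions.\<close>

lemma act_top:
  assumes M: "stable M" and y: "top M (state l') y" "y \<in> D"
    and red: "\<not> (fst l = fst l' \<and> snd l \<noteq> snd l')"
  shows "top (extend (extend M)) (state l) (act l y)"
proof (cases l rule: state.cases)
  case (1 j)
  obtain i s where l': "l' = (i, s)" by (cases l') auto
  note M1 = stable_extend[OF M]
  note M2 = stable_extend[OF M1]
  have "top M (e j \<star> state l') (e j \<star> y)"
    using y by (intro top_scale M) (simp_all add: K_closed state_K)
  then have "top M (e j \<star> state l' - \<tau> (e j \<star> state l')) ((one - t) \<star> (e j \<star> y))"
    using y by (intro top_one_minus_t M) (simp_all add: K_closed state_K)
  then have "top M (lam' \<star> (e j \<star> state l' - \<tau> (e j \<star> state l'))) (lam' \<star> ((one - t) \<star> (e j \<star> y)))"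
    using y by (intro top_scale M) (simp_all add: K_closed state_K)
  moreover have "(lam' - \<tau>' lam') \<star> (e j \<star> state l') \<notin> coboundaries"
    using red 1 l' top3[of j i] top5[of i j] by (cases s) auto
  then have "lam' \<star> (e j \<star> state l' - \<tau> (e j \<star> state l')) \<notin> coboundaries"
    using coboundary_by_parts[of lam' "e j \<star> state l'"] by (auto simp: K_closed state_K)
  ultimately have "top (extend M) one (p \<star> (lam' \<star> ((one - t) \<star> (e j \<star> y))))"
    using y by (intro top_p[OF M, where k = "lam' \<star> (e j \<star> state l' - \<tau> (e j \<star> state l'))"])
      (simp_all add: K_closed state_K)
  then have "top (extend M) (\<kappa> \<star> one) (\<kappa> \<star> (p \<star> (lam' \<star> ((one - t) \<star> (e j \<star> y)))))"
    using y by (intro top_scale M1) (simp_all add: K_closed)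
  then have "top (extend (extend M)) one (p \<star> (\<kappa> \<star> (p \<star> (lam' \<star> ((one - t) \<star> (e j \<star> y))))))"
    using y top1 by (intro top_p[OF M1, where k = "\<kappa> \<star> one"]) (simp_all add: K_closed)
  then have "top (extend (extend M)) (lam \<star> one) (lam \<star> (p \<star> (\<kappa> \<star> (p \<star> (lam' \<star> ((one - t) \<star> (e j \<star> y)))))))"
    using y by (intro top_scale M2) (simp_all add: K_closed)
  then have "top (extend (extend M)) (lam \<star> one - \<tau> (lam \<star> one)) ((one - t) \<star> (lam \<star> (p \<star> (\<kappa> \<star> (p \<star> (lam' \<star> ((one - t) \<star> (e j \<star> y))))))))"
    using y by (intro top_one_minus_t M2) (simp_all add: K_closed)
  then have "top (extend (extend M)) (d j \<star> (lam \<star> one - \<tau> (lam \<star> one))) (act l y)"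
    using y unfolding 1 act.simps by (intro top_scale M2) (simp_all add: K_closed)
  then show ?thesis using 1 by (simp add: K_closed)
next
  case (2 j)
  obtain i s where l': "l' = (i, s)" by (cases l') auto
  note M1 = stable_extend[OF M]
  note M2 = stable_extend[OF M1]
  let ?a = "rinv lam' - \<tau>' (rinv lam')" and ?mu = "rinv lam - \<tau> (rinv lam)"
  have "top M (rinv (d j) \<star> state l') (rinv (d j) \<star> y)"
    using y by (intro top_scale M) (simp_all add: K_closed state_K)
  moreover have "rinv (d j) \<star> state l' \<notin> coboundaries"
    using red 2 l' top4[of i j] top6[of j i] by (cases s) auto
  ultimately have "top (extend M) one (p \<star> (rinv (d j) \<star> y))"
    using y by (intro top_p[OF M, where k = "rinv (d j) \<star> state l'"]) (simp_all add: K_closed state_K)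
  then have "top (extend M) (rinv lam \<star> one) (rinv lam \<star> (p \<star> (rinv (d j) \<star> y)))"
    using y by (intro top_scale M1) (simp_all add: K_closed)
  then have "top (extend M) (rinv lam \<star> one - \<tau> (rinv lam \<star> one)) ((one - t) \<star> (rinv lam \<star> (p \<star> (rinv (d j) \<star> y))))"
    using y by (intro top_one_minus_t M1) (simp_all add: K_closed)
  then have "top (extend M) ?mu ((one - t) \<star> (rinv lam \<star> (p \<star> (rinv (d j) \<star> y))))"
    by (simp add: K_closed)
  then have "top (extend M) (rinv \<kappa> \<star> ?mu) (rinv \<kappa> \<star> ((one - t) \<star> (rinv lam \<star> (p \<star> (rinv (d j) \<star> y)))))"
    using y by (intro top_scale M1) (simp_all add: K_closed)
  then have "top (extend M) (rinv \<kappa> \<star> ?mu - \<tau> (rinv \<kappa> \<star> ?mu)) ((one - t) \<star> (rinv \<kappa> \<star> ((one - t) \<star> (rinv lam \<star> (p \<star> (rinv (d j) \<star> y))))))"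
    using y by (intro top_one_minus_t M1) (simp_all add: K_closed)
  then have "top (extend M) (rinv lam' \<star> (rinv \<kappa> \<star> ?mu - \<tau> (rinv \<kappa> \<star> ?mu)))
      (rinv lam' \<star> ((one - t) \<star> (rinv \<kappa> \<star> ((one - t) \<star> (rinv lam \<star> (p \<star> (rinv (d j) \<star> y)))))))"
    using y by (intro top_scale M1) (simp_all add: K_closed)
  moreover have "rinv lam' \<star> (rinv \<kappa> \<star> ?mu - \<tau> (rinv \<kappa> \<star> ?mu)) \<notin> coboundaries"
    using coboundary_by_parts[of "rinv lam'" "rinv \<kappa> \<star> ?mu"] top2 by (auto simp: K_closed)
  ultimately have "top (extend (extend M)) one (p \<star> (rinv lam' \<star> ((one - t) \<star> (rinv \<kappa> \<star> ((one - t) \<star> (rinv lam \<star> (p \<star> (rinv (d j) \<star> y))))))))"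
    using y by (intro top_p[OF M1, where k = "rinv lam' \<star> (rinv \<kappa> \<star> ?mu - \<tau> (rinv \<kappa> \<star> ?mu))"]) (simp_all add: K_closed)
  then have "top (extend (extend M)) (rinv (e j) \<star> one) (act l y)"
    using y unfolding 2 act.simps by (intro top_scale M2) (simp_all add: K_closed)
  then show ?thesis using 2 by (simp add: K_closed)
qed

lemma reduced_word_Cons:
  "reduced_word (l # l' # w) \<longleftrightarrow> \<not> (fst l = fst l' \<and> snd l \<noteq> snd l') \<and> reduced_word (l' # w)"
  unfolding reduced_word_def by (auto simp: nth_Cons split: nat.splits)

lemma subset_extend: "M \<subseteq> extend M"
  using extend.base by blast

theorem reduced_word_acts_nontrivially:
  assumes M: "stable M" and one: "one \<in> M" and p: "p \<notin> M" and w: "w \<noteq> []" "reduced_word w"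
  shows "\<exists>y\<in>D. foldr act w y \<noteq> y"
proof -
  \<comment> \<open>The start is chosen as if the last symbol of the word had just acted. A symbol
    repeated is always reduced, so \<open>act_top\<close> applies from the first step on. Since
    \<open>y\<close> lies in \<open>extend M\<close> and the result has a pole beyond a module
    containing it, they differ.\<close>
  define y where "y = state (last w) \<star> p"
  have y: "y \<in> D" by (simp add: y_def state_K)
  have y0: "y = 0 + state (last w) \<star> (p \<star> one)" by (simp add: y_def)
  have top0: "top M (state (last w)) y"
    unfolding top_def using one p stableD(2)[OF M] y0 by (intro bexI[of _ one]) auto
  have yM: "y \<in> extend M" unfolding y0 by (intro extend.intros stableD(2)[OF M] state_K one)
  have "foldr act v y \<in> D \<and> (\<exists>N. stable N \<and> extend M \<subseteq> N \<and> top N (state (hd v)) (foldr act v y))"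
    if "v \<noteq> []" "reduced_word v" "last v = last w" for v
    using that
  proof (induction v)
    case (Cons l v)
    show ?case
    proof (cases v)
      case Nil
      then have "top (extend (extend M)) (state l) (act l y)"
        using Cons.prems top0 y by (intro act_top[OF M, of l]) auto
      then show ?thesis using Nil act_D[OF y] stable_extend[OF stable_extend[OF M]] subset_extend[of "extend M"]
        by (intro conjI exI[of _ "extend (extend M)"]) simp_all
    next
      case (Cons l' v')
      with Cons.IH Cons.prems obtain N where N: "stable N" "extend M \<subseteq> N" "top N (state l') (foldr act v y)"
        and D: "foldr act v y \<in> D" and red: "\<not> (fst l = fst l' \<and> snd l \<noteq> snd l')"
        by (auto simp: reduced_word_Cons)
      then have "top (extend (extend N)) (state l) (act l (foldr act v y))" by (intro act_top) auto
      moreover have "extend M \<subseteq> extend (extend N)" using N(2) subset_extend by blast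
      ultimately show ?thesis using D act_D stable_extend[OF stable_extend[OF N(1)]] Cons
        by (intro conjI exI[of _ "extend (extend N)"]) simp_all
    qed
  qed simp
  then obtain N where N: "stable N" "extend M \<subseteq> N" "top N (state (hd w)) (foldr act w y)"
    using w by blast
  then have "foldr act w y \<notin> N" using top_not_mem state_K state_nonzero by blast
  then have "foldr act w y \<noteq> y" using yM N(2) by auto
  then show ?thesis using y by blast
qed

end

section \<open>Ore fractions\<close>

locale ore_domain = div_ring +
  fixes S :: "'a set"
  assumes S_D: "S \<subseteq> D"
    and S_add: "a \<in> S \<Longrightarrow> b \<in> S \<Longrightarrow> a + b \<in> S"
    and S_uminus: "a \<in> S \<Longrightarrow> - a \<in> S"
    and S_mult: "a \<in> S \<Longrightarrow> b \<in> S \<Longrightarrow> a \<star> b \<in> S"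
    and S_one: "one \<in> S"
    and ore: "a \<in> S \<Longrightarrow> b \<in> S \<Longrightarrow> a \<noteq> 0 \<Longrightarrow> b \<noteq> 0 \<Longrightarrow> \<exists>c\<in>S. \<exists>d\<in>S. a \<star> c = b \<star> d \<and> a \<star> c \<noteq> 0"
begin

lemma S_D' [simp]: "a \<in> S \<Longrightarrow> a \<in> D" using S_D by blast

definition frac :: "'a set" where "frac = {f\<in>D. \<exists>b\<in>S. b \<noteq> 0 \<and> f \<star> b \<in> S}"

end

text \<open>Right fractions of \<open>S\<close> may be evaluated in any other division ring containing \<open>S\<close>;
  \<open>realises f f'\<close> says that \<open>f'\<close> is the value in \<open>E\<close> of the fraction \<open>f\<close>.\<close>

locale ore_pair = ore_domain D mult one S + E: div_ring E mult one
  for D :: "'a::ab_group_add set" and mult (infixl "\<star>" 70) and one and S and E +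
  assumes S_E: "S \<subseteq> E"
begin

lemma S_E' [simp]: "a \<in> S \<Longrightarrow> a \<in> E" using S_E by blast

definition realises :: "'a \<Rightarrow> 'a \<Rightarrow> bool" where
  "realises f f' \<longleftrightarrow> f \<in> D \<and> f' \<in> E \<and> (\<exists>b\<in>S. b \<noteq> 0 \<and> f \<star> b \<in> S \<and> f' \<star> b = f \<star> b)"

lemma realises_S: "s \<in> S \<Longrightarrow> realises s s"
  unfolding realises_def using S_one by (auto intro!: bexI[of _ one])

lemma realises_D: "realises f f' \<Longrightarrow> f \<in> D" "realises f f' \<Longrightarrow> f' \<in> E" "realises f f' \<Longrightarrow> f \<in> frac"
  unfolding realises_def frac_def by blast+

lemma realises_ex:
  assumes "f \<in> frac" shows "\<exists>f'. realises f f'"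
proof -
  obtain b where b: "b \<in> S" "b \<noteq> 0" "f \<star> b \<in> S" "f \<in> D" using assms unfolding frac_def by blast
  then have "f \<star> b \<star> E.rinv b \<star> b = f \<star> b" using E.rinv_closed by (simp add: E.assoc)
  then show ?thesis using b E.rinv_closed[of b] unfolding realises_def
    by (intro exI[of _ "f \<star> b \<star> E.rinv b"]) auto
qed

lemma common_multiple:
  assumes "b \<in> S" "b \<noteq> 0" "d \<in> S" "d \<noteq> 0"
  obtains c e where "c \<in> S" "e \<in> S" "b \<star> c = d \<star> e" "b \<star> c \<noteq> 0" "b \<star> c \<in> S"
  using ore[OF assms(1,3,2,4)] S_mult assms by metis

text \<open>The two denominators are brought to a common right multiple, where both values agree
  with the same element of \<open>S\<close>; this multiple is then cancelled in
  \<open>E\<close>.\<close>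

lemma realises_unique:
  assumes "realises f f'" "realises f f''" shows "f' = f''"
proof -
  obtain b where b: "b \<in> S" "b \<noteq> 0" "f \<star> b \<in> S" "f' \<star> b = f \<star> b" using assms(1) unfolding realises_def by blast
  obtain d where d: "d \<in> S" "d \<noteq> 0" "f \<star> d \<in> S" "f'' \<star> d = f \<star> d" using assms(2) unfolding realises_def by blast
  note D = realises_D[OF assms(1)] realises_D[OF assms(2)]
  obtain c e where ce: "c \<in> S" "e \<in> S" "b \<star> c = d \<star> e" "b \<star> c \<noteq> 0" "b \<star> c \<in> S"
    using common_multiple[OF b(1,2) d(1,2)] .
  have "f' \<star> (b \<star> c) = f \<star> b \<star> c" unfolding b(4)[symmetric] using D b(1) ce(1) by (simp add: E.assoc)
  also have "\<dots> = f \<star> d \<star> e" using D b d ce by (simp add: assoc)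
  also have "\<dots> = f'' \<star> (b \<star> c)" unfolding ce(3) d(4)[symmetric] using D d(1) ce(2) by (simp add: E.assoc)
  finally show ?thesis using E.mult_right_cancel[of "b \<star> c" f' f''] D ce by simp
qed

lemma realises_add:
  assumes "realises f f'" "realises g g'" shows "realises (f + g) (f' + g')"
proof -
  obtain b where b: "b \<in> S" "b \<noteq> 0" "f \<star> b \<in> S" "f' \<star> b = f \<star> b" using assms(1) unfolding realises_def by blast
  obtain d where d: "d \<in> S" "d \<noteq> 0" "g \<star> d \<in> S" "g' \<star> d = g \<star> d" using assms(2) unfolding realises_def by blast
  note D = realises_D[OF assms(1)] realises_D[OF assms(2)]
  obtain c e where ce: "c \<in> S" "e \<in> S" "b \<star> c = d \<star> e" "b \<star> c \<noteq> 0" "b \<star> c \<in> S"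
    using common_multiple[OF b(1,2) d(1,2)] .
  have 1: "f \<star> (b \<star> c) = f \<star> b \<star> c" "f' \<star> (b \<star> c) = f \<star> b \<star> c"
    using D b(1,4) ce(1) E.assoc[of f' b c] by (simp_all add: assoc)
  have 2: "g \<star> (b \<star> c) = g \<star> d \<star> e" "g' \<star> (b \<star> c) = g \<star> d \<star> e"
    unfolding ce(3) using D d(1,4) ce(2) E.assoc[of g' d e] by (simp_all add: assoc)
  have "(f + g) \<star> (b \<star> c) = f \<star> b \<star> c + g \<star> d \<star> e" "(f' + g') \<star> (b \<star> c) = f \<star> b \<star> c + g \<star> d \<star> e"
    using 1 2 D ce by (simp_all add: distr E.distr)
  then show ?thesis using D ce b d S_mult S_add unfolding realises_def
    by (auto intro!: bexI[of _ "b \<star> c"])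
qed

lemma realises_uminus: assumes "realises f f'" shows "realises (- f) (- f')"
proof -
  obtain b where b: "b \<in> S" "b \<noteq> 0" "f \<star> b \<in> S" "f' \<star> b = f \<star> b" using assms(1) unfolding realises_def by blast
  then show ?thesis using realises_D[OF assms] S_uminus unfolding realises_def
    by (auto intro!: bexI[of _ b])
qed

lemma realises_diff: "realises f f' \<Longrightarrow> realises g g' \<Longrightarrow> realises (f - g) (f' - g')"
  using realises_add[OF _ realises_uminus, of f f' g g'] by simp

text \<open>A common multiple \<open>b c = g d e\<close> of the denominator \<open>b\<close> of
  \<open>f\<close> and the numerator \<open>g d\<close> makes \<open>d e\<close> a denominator of
  \<open>f \<star> g\<close>, with numerator \<open>f b c\<close>. The Ore condition asks for
  nonzero elements, so \<open>g d = 0\<close> is treated separately.\<close>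

lemma realises_mult:
  assumes "realises f f'" "realises g g'" shows "realises (f \<star> g) (f' \<star> g')"
proof -
  obtain b where b: "b \<in> S" "b \<noteq> 0" "f \<star> b \<in> S" "f' \<star> b = f \<star> b" using assms(1) unfolding realises_def by blast
  obtain d where d: "d \<in> S" "d \<noteq> 0" "g \<star> d \<in> S" "g' \<star> d = g \<star> d" using assms(2) unfolding realises_def by blast
  note D = realises_D[OF assms(1)] realises_D[OF assms(2)]
  show ?thesis
  proof (cases "g \<star> d = 0")
    case True
    then have "g = 0" "g' = 0" using no_zero_divisors[of g d] E.no_zero_divisors[of g' d] D d by auto
    then show ?thesis using D realises_S[of 0] S_add[OF S_one S_uminus[OF S_one]] by simp
  next
    case False
    obtain c e where ce: "c \<in> S" "e \<in> S" "b \<star> c = g \<star> d \<star> e" "b \<star> c \<noteq> 0" "b \<star> c \<in> S"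
      using common_multiple[OF b(1,2) d(3) False] .
    have "e \<noteq> 0" using ce d by auto
    have 1: "(f \<star> g) \<star> (d \<star> e) = f \<star> (g \<star> d \<star> e)" using D d(1) ce(2) by (simp add: assoc)
    have 2: "(f' \<star> g') \<star> (d \<star> e) = f' \<star> (g' \<star> d \<star> e)" using D d(1) ce by (simp add: E.assoc)
    have 3: "f \<star> (b \<star> c) = f \<star> b \<star> c" "f' \<star> (b \<star> c) = f \<star> b \<star> c"
      using D b(1,4) ce(1) E.assoc[of f' b c] by (simp_all add: assoc)
    have "(f \<star> g) \<star> (d \<star> e) = f \<star> b \<star> c" "(f' \<star> g') \<star> (d \<star> e) = f \<star> b \<star> c"
      unfolding 1 2 d(4) ce(3)[symmetric] 3 by simp_all
    then show ?thesis using D ce b d S_mult no_zero_divisors[of d e] \<open>e \<noteq> 0\<close> unfolding realises_def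
      by (auto intro!: bexI[of _ "d \<star> e"])
  qed
qed

lemma realises_zero_iff: assumes "realises f f'" shows "f' = 0 \<longleftrightarrow> f = 0"
proof -
  obtain b where b: "b \<in> S" "b \<noteq> 0" "f \<star> b \<in> S" "f' \<star> b = f \<star> b" using assms(1) unfolding realises_def by blast
  then show ?thesis using no_zero_divisors[of f b] E.no_zero_divisors[of f' b] realises_D[OF assms]
    by (metis S_D' S_E' mult_zero_left E.mult_zero_left)
qed

lemma realises_rinv:
  assumes "realises f f'" "f \<noteq> 0" shows "realises (rinv f) (E.rinv f')"
proof -
  obtain b where b: "b \<in> S" "b \<noteq> 0" "f \<star> b \<in> S" "f' \<star> b = f \<star> b" using assms(1) unfolding realises_def by blast
  note D = realises_D[OF assms(1)]
  have f': "f' \<noteq> 0" using realises_zero_iff[OF assms(1)] assms(2) by simp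
  have "f \<star> b \<noteq> 0" using no_zero_divisors[of f b] D b assms by simp
  moreover have "rinv f \<star> (f \<star> b) = b" using D b assms by simp
  moreover have "E.rinv f' \<star> (f \<star> b) = b" unfolding b(4)[symmetric] using D b(1,2) f' by simp
  ultimately show ?thesis using D b assms f' rinv_closed E.rinv_closed unfolding realises_def
    by (auto intro!: bexI[of _ "f \<star> b"])
qed

end

context ore_domain
begin

text \<open>With \<open>E = D\<close> every fraction is its own value, so the closure of
  \<open>frac\<close> under the field operations is read off from the rules for
  \<open>realises\<close>.\<close>

sublocale self: ore_pair D mult one S D
  by unfold_locales (rule S_D)

lemma frac_iff: "f \<in> frac \<longleftrightarrow> self.realises f f"
  unfolding frac_def self.realises_def by auto

lemma frac_D [simp]: "f \<in> frac \<Longrightarrow> f \<in> D"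
  by (simp add: frac_def)

lemma frac_S: "f \<in> S \<Longrightarrow> f \<in> frac"
  and frac_add: "f \<in> frac \<Longrightarrow> g \<in> frac \<Longrightarrow> f + g \<in> frac"
  and frac_uminus: "f \<in> frac \<Longrightarrow> - f \<in> frac"
  and frac_mult: "f \<in> frac \<Longrightarrow> g \<in> frac \<Longrightarrow> f \<star> g \<in> frac"
  and frac_rinv: "f \<in> frac \<Longrightarrow> f \<noteq> 0 \<Longrightarrow> rinv f \<in> frac"
  unfolding frac_iff
  by (rule self.realises_S self.realises_add self.realises_uminus self.realises_mult self.realises_rinv; assumption)+

end

section \<open>Series on a graded subgroup\<close>

lemma MN_mult_carrier_update [simp]: "MN_mult (G\<lparr>carrier := L\<rparr>) = MN_mult G"
  by (simp add: MN_mult_def fun_eq_iff)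

lemma (in ordered_grp) div_ring_MN: "div_ring (MN :: ('g \<Rightarrow> 'k::field) set) (MN_mult G) (single \<one> 1)"
proof
  show "single \<one> 1 \<noteq> (0 :: 'g \<Rightarrow> 'k)" by (auto simp: single_def fun_eq_iff)
qed (use mult_assoc mult_distrib_left mult_distrib_right MN_inverse in auto)

text \<open>The parameter \<open>kty\<close> only fixes the field of coefficients.\<close>

locale graded = ordered_grp G lt for G :: "('g, 'b) monoid_scheme" (structure) and lt (infix "\<lessdot>" 50) +
  fixes kty :: "'k::field itself" and L :: "'g set" and deg :: "'g \<Rightarrow> int" and x :: 'g
  assumes L_sub: "subgroup L G" and x_G [simp]: "x \<in> carrier G"
    and x_L: "g \<in> L \<Longrightarrow> x \<otimes> g \<otimes> inv x \<in> L" and x_L': "g \<in> L \<Longrightarrow> inv x \<otimes> g \<otimes> x \<in> L"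
    and deg_mult: "g \<in> L \<Longrightarrow> h \<in> L \<Longrightarrow> deg (g \<otimes> h) = deg g + deg h"
    and deg_x: "g \<in> L \<Longrightarrow> deg (x \<otimes> g \<otimes> inv x) = deg g"
    and x_pos: "\<one> \<lessdot> x" and x_pow: "n > 0 \<Longrightarrow> x [^] (n::nat) \<notin> L"
begin

abbreviation GL where "GL \<equiv> G\<lparr>carrier := L\<rparr>"

text \<open>Used for \<open>e = 1\<close> and \<open>e = -1\<close>: degrees are compared first,
  upwards or downwards, and \<open>\<lessdot>\<close> decides within one degree. The two orders give
  the expansions at zero and at infinity with respect to the degree.\<close>

definition ltd :: "int \<Rightarrow> 'g \<Rightarrow> 'g \<Rightarrow> bool" where
  "ltd e g h \<longleftrightarrow> e * deg g < e * deg h \<or> deg g = deg h \<and> g \<lessdot> h"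

lemma L_G [simp]: "g \<in> L \<Longrightarrow> g \<in> carrier G"
  using subgroup.subset[OF L_sub] by blast

lemma L_closed [simp]: "g \<in> L \<Longrightarrow> h \<in> L \<Longrightarrow> g \<otimes> h \<in> L" "g \<in> L \<Longrightarrow> inv g \<in> L" "\<one> \<in> L"
  using subgroup.m_closed[OF L_sub] subgroup.m_inv_closed[OF L_sub] subgroup.one_closed[OF L_sub] by auto

lemma deg_one [simp]: "deg \<one> = 0"
  using deg_mult[of \<one> \<one>] by simp

lemma deg_inv: "g \<in> L \<Longrightarrow> deg (inv g) = - deg g"
  using deg_mult[of g "inv g"] by simp

lemma deg_x': "g \<in> L \<Longrightarrow> deg (inv x \<otimes> g \<otimes> x) = deg g"
proof -
  assume g: "g \<in> L"
  have "x \<otimes> (inv x \<otimes> g \<otimes> x) \<otimes> inv x = g" using g by (simp add: m_assoc)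
  then show ?thesis using deg_x[OF x_L'[OF g]] by simp
qed

sublocale GL: ordered_grp GL lt
proof -
  interpret g: group GL using L_sub by (rule subgroup_imp_group)
  show "ordered_grp GL lt"
  proof
    show "ordered_group GL lt"
      unfolding ordered_group_def
    proof (intro conjI ballI impI)
      fix g assume "g \<in> carrier GL" then show "\<not> g \<lessdot> g" by (simp add: lt_irrefl)
    next
      fix a b c assume "a \<in> carrier GL" "b \<in> carrier GL" "c \<in> carrier GL" "a \<lessdot> b" "b \<lessdot> c"
      then show "a \<lessdot> c" using lt_trans[of a b c] by simp
    next
      fix a b assume "a \<in> carrier GL" "b \<in> carrier GL"
      then show "a = b \<or> a \<lessdot> b \<or> b \<lessdot> a" using lt_total[of a b] by simp
    next
      fix a b c assume "a \<in> carrier GL" "b \<in> carrier GL" "c \<in> carrier GL" "a \<lessdot> b"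
      then show "c \<otimes>\<^bsub>GL\<^esub> a \<lessdot> c \<otimes>\<^bsub>GL\<^esub> b" "a \<otimes>\<^bsub>GL\<^esub> c \<lessdot> b \<otimes>\<^bsub>GL\<^esub> c"
        using lt_mult_left[of a b c] lt_mult_right[of a b c] by simp_all
    qed
  qed
qed

lemma ordered_grp_ltd: assumes "e * e = 1" shows "ordered_grp GL (ltd e)"
proof -
  interpret g: group GL using L_sub by (rule subgroup_imp_group)
  have e: "e \<noteq> 0" using assms by auto
  show ?thesis
  proof
    show "ordered_group GL (ltd e)"
      unfolding ordered_group_def
    proof (intro conjI ballI impI)
      fix g assume "g \<in> carrier GL" then show "\<not> ltd e g g" by (simp add: ltd_def lt_irrefl)
    next
      fix a b c assume "a \<in> carrier GL" "b \<in> carrier GL" "c \<in> carrier GL" "ltd e a b" "ltd e b c"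
      then show "ltd e a c" using lt_trans[of a b c] by (auto simp: ltd_def)
    next
      fix a b assume "a \<in> carrier GL" "b \<in> carrier GL"
      then show "a = b \<or> ltd e a b \<or> ltd e b a"
        using lt_total[of a b] e mult_cancel_left[of e "deg a" "deg b"] unfolding ltd_def by auto
    next
      fix a b c assume "a \<in> carrier GL" "b \<in> carrier GL" "c \<in> carrier GL" "ltd e a b"
      then show "ltd e (c \<otimes>\<^bsub>GL\<^esub> a) (c \<otimes>\<^bsub>GL\<^esub> b)" "ltd e (a \<otimes>\<^bsub>GL\<^esub> c) (b \<otimes>\<^bsub>GL\<^esub> c)"
        using lt_mult_left[of a b c] lt_mult_right[of a b c] by (auto simp: ltd_def deg_mult distrib_left)
    qed
  qed
qed

abbreviation one :: "'g \<Rightarrow> 'k" where "one \<equiv> single \<one> 1"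
abbreviation A :: "('g \<Rightarrow> 'k) set" where "A \<equiv> MN_series G lt"
abbreviation D :: "('g \<Rightarrow> 'k) set" where "D \<equiv> MN_series GL lt"
abbreviation E :: "int \<Rightarrow> ('g \<Rightarrow> 'k) set" where "E e \<equiv> MN_series GL (ltd e)"

text \<open>Finitely many degrees are what places these series in both completions
  \<open>E 1\<close> and \<open>E (-1)\<close>; a general element of \<open>D\<close> need not lie
  in either.\<close>

definition S :: "('g \<Rightarrow> 'k) set" where "S = {f\<in>D. finite (deg ` supp f)}"

sublocale A: div_ring A "MN_mult G" one by (rule div_ring_MN)

sublocale D: div_ring D "MN_mult G" one using GL.div_ring_MN by simp

lemma div_ring_E: "e * e = 1 \<Longrightarrow> div_ring (E e) (MN_mult G) one"
  using ordered_grp.div_ring_MN[OF ordered_grp_ltd] by simp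

lemma D_supp: "f \<in> D \<Longrightarrow> g \<in> supp f \<Longrightarrow> g \<in> L"
  using GL.MN_supp[of f] by (simp add: subset_iff)

lemma D_A [simp]: "f \<in> D \<Longrightarrow> f \<in> A"
  by (rule MN_I) (use D_supp L_G GL.MN_well_ordered in blast)+

lemma S_D: "f \<in> S \<Longrightarrow> f \<in> D"
  by (simp add: S_def)

text \<open>In a subset of the support, first the extreme one of the finitely many degrees is taken,
  then the least element for \<open>\<lessdot>\<close> within that degree.\<close>

lemma S_E: assumes "f \<in> S" "e * e = 1" shows "f \<in> E e"
proof -
  have f: "supp f \<subseteq> L" "well_ordered_on lt (supp f)" "finite (deg ` supp f)"
    using assms(1) by (auto simp: S_def MN_series_def)
  have "well_ordered_on (ltd e) (supp f)"
    unfolding well_ordered_on_def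
  proof (intro allI impI)
    fix T assume T: "T \<subseteq> supp f" "T \<noteq> {}"
    let ?I = "(\<lambda>g. e * deg g) ` T"
    have fin: "finite ?I" using finite_subset[OF image_mono[OF T(1)] f(3)] by (metis finite_imageI image_image)
    define m where "m = Min ?I"
    have m: "m \<in> ?I" unfolding m_def by (rule Min_in) (use fin T(2) in auto)
    have m': "m \<le> e * deg g" if "g \<in> T" for g unfolding m_def by (rule Min_le[OF fin]) (use that in blast)
    from m have "{g\<in>T. e * deg g = m} \<noteq> {}" "{g\<in>T. e * deg g = m} \<subseteq> supp f" using T by auto
    then obtain h where h: "h \<in> {g\<in>T. e * deg g = m}" "\<forall>s\<in>{g\<in>T. e * deg g = m}. \<not> s \<lessdot> h"
      using f(2) unfolding well_ordered_on_def by meson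
    have "\<not> ltd e s h" if "s \<in> T" for s
      using h m'[OF that] that unfolding ltd_def by auto
    then show "\<exists>m\<in>T. \<forall>s\<in>T. \<not> ltd e s m" using h by blast
  qed
  then show ?thesis using f(1) by (simp add: MN_series_def)
qed

lemma S_add: "f \<in> S \<Longrightarrow> g \<in> S \<Longrightarrow> f + g \<in> S"
  using finite_subset[OF image_mono[OF supp_add_subset[of f g]], of deg] by (simp add: S_def image_Un)

lemma S_uminus: "f \<in> S \<Longrightarrow> - f \<in> S"
  by (simp add: S_def)

lemma S_diff: "f \<in> S \<Longrightarrow> g \<in> S \<Longrightarrow> f - g \<in> S"
  using S_add[of f "- g"] S_uminus by simp

lemma D_mult_suppE:
  assumes "f \<in> D" "g \<in> D" "z \<in> supp (MN_mult G f g)"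
  obtains a b where "a \<in> supp f" "b \<in> supp g" "z = a \<otimes> b" "a \<in> L" "b \<in> L" "deg z = deg a + deg b"
proof -
  obtain a b where "a \<in> supp f" "b \<in> supp g" "z = a \<otimes> b"
    using assms(3) mult_nonzeroE[of f g z] by (auto simp: supp_def)
  moreover have "a \<in> L" "b \<in> L" using calculation D_supp assms by blast+
  ultimately show ?thesis using that[of a b] deg_mult by simp
qed

lemma S_mult: assumes "f \<in> S" "g \<in> S" shows "MN_mult G f g \<in> S"
proof -
  have fg: "f \<in> D" "g \<in> D" using assms S_D by blast+
  have "deg ` supp (MN_mult G f g) \<subseteq> (\<lambda>(a, b). a + b) ` (deg ` supp f \<times> deg ` supp g)"
  proof
    fix i assume "i \<in> deg ` supp (MN_mult G f g)"
    then obtain z where z: "z \<in> supp (MN_mult G f g)" "i = deg z" by blast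
    obtain a b where "a \<in> supp f" "b \<in> supp g" "deg z = deg a + deg b"
      using D_mult_suppE[OF fg z(1)] by metis
    then show "i \<in> (\<lambda>(a, b). a + b) ` (deg ` supp f \<times> deg ` supp g)" using z(2) by force
  qed
  moreover have "finite ((\<lambda>(a, b). a + b) ` (deg ` supp f \<times> deg ` supp g))"
    using assms by (simp add: S_def)
  ultimately have "finite (deg ` supp (MN_mult G f g))" by (rule finite_subset)
  then show ?thesis using D.mult_closed[OF fg] by (simp add: S_def)
qed

lemma S_single: "g \<in> L \<Longrightarrow> single g c \<in> S"
  using finite_subset[OF image_mono[OF supp_single_subset[of g c]], of deg] GL.MN_single[of g c]
  by (simp add: S_def)

definition part :: "int \<Rightarrow> ('g \<Rightarrow> 'k) \<Rightarrow> 'g \<Rightarrow> 'k" where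
  "part i f = (\<lambda>g. if deg g = i then f g else 0)"

lemma supp_part: "supp (part i f) = {g \<in> supp f. deg g = i}"
  by (auto simp: supp_def part_def)

lemma part_S: "f \<in> D \<Longrightarrow> part i f \<in> S"
  using GL.MN_subset_supp[of f "part i f"] by (auto simp: S_def supp_part intro: finite_subset[of _ "{i}"])

lemma S_finite_deg: "f \<in> S \<Longrightarrow> finite (deg ` supp f)"
  by (simp add: S_def)

declare S_D [simp]

text \<open>For homogeneous \<open>h\<close> of degree \<open>i\<close>, only the degree
  \<open>- i\<close> part of its inverse in \<open>D\<close> contributes to degree zero of the
  product, and that part contributes nowhere else. So this part alone is an inverse, and unlike the
  whole series it visibly lies in \<open>S\<close>.\<close>

lemma homogeneous_inverse:
  assumes h: "h \<in> S" "h \<noteq> 0" "\<And>g. g \<in> supp h \<Longrightarrow> deg g = i"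
  obtains k where "k \<in> S" "\<And>g. g \<in> supp k \<Longrightarrow> deg g = - i" "MN_mult G h k = one"
proof -
  obtain g where g: "g \<in> D" "MN_mult G h g = one" using D.inverse_ex[of h] h by auto
  let ?k = "part (- i) g"
  have k: "?k \<in> S" using g part_S by blast
  have sum: "MN_mult G h ?k + MN_mult G h (g - ?k) = one"
    using D.distl[of h ?k "g - ?k"] g h k by simp
  have "MN_mult G h ?k z = one z" for z
  proof (cases "z \<in> L \<and> deg z = 0")
    case True
    have "z \<notin> supp (MN_mult G h (g - ?k))"
    proof
      assume "z \<in> supp (MN_mult G h (g - ?k))"
      then obtain a b where "a \<in> supp h" "b \<in> supp (g - ?k)" "deg z = deg a + deg b"
        using D_mult_suppE[of h "g - ?k" z] h(1) g(1) k by (metis S_D D.diff_closed)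
      then show False using h(3)[of a] True by (auto simp: supp_def part_def split: if_splits)
    qed
    then show ?thesis using fun_cong[OF sum, of z] by (simp add: supp_def)
  next
    case False
    have "z \<notin> supp (MN_mult G h ?k)"
    proof
      assume "z \<in> supp (MN_mult G h ?k)"
      then obtain a b where "a \<in> supp h" "b \<in> supp ?k" "deg z = deg a + deg b" "z \<in> L"
        using D_mult_suppE[of h ?k z] h k by (metis S_D L_closed(1))
      then show False using h(3)[of a] False by (auto simp: supp_part)
    qed
    then show ?thesis using False by (auto simp: supp_def single_apply)
  qed
  then show ?thesis using that[of ?k] k by (auto simp: supp_part)
qed

text \<open>The interval of degrees is half open, so that width zero characterises the zero series
  and the width can drive an induction.\<close>

definition window :: "('g \<Rightarrow> 'k) \<Rightarrow> int \<Rightarrow> nat \<Rightarrow> bool" where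
  "window f m n \<longleftrightarrow> (\<forall>g\<in>supp f. m \<le> deg g \<and> deg g < m + int n)"

lemma window_shrink:
  assumes "window f m (Suc n)" "part (m + int n) f = 0" shows "window f m n"
proof -
  have "deg g \<noteq> m + int n" if "g \<in> supp f" for g
    using that fun_cong[OF assms(2), of g] by (auto simp: part_def supp_def)
  then show ?thesis using assms(1) unfolding window_def by force
qed

lemma window_ex: assumes "f \<in> S" obtains m n where "window f m n"
proof -
  have fin: "finite (deg ` supp f)" using assms by (rule S_finite_deg)
  obtain m where m: "\<And>i. i \<in> deg ` supp f \<Longrightarrow> m \<le> i" using finite_has_minimal2 fin bdd_below_finite by (metis bdd_below_def)
  obtain M where M: "\<And>i. i \<in> deg ` supp f \<Longrightarrow> i \<le> M" using fin bdd_above_finite by (metis bdd_above_def)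
  have "window f m (nat (M - m + 1))" using m M unfolding window_def by force
  then show ?thesis using that by blast
qed

text \<open>Euclid: the top part of the wider element is cancelled by a homogeneous multiple of the
  other one.\<close>

lemma euclid_step:
  assumes a: "a \<in> S" "a \<noteq> 0" "window a m (Suc n)" and b: "b \<in> S" "b \<noteq> 0" "window b m' (Suc n')"
    and le: "n' \<le> n" and top: "part (m + int n) a \<noteq> 0" "part (m' + int n') b \<noteq> 0"
  shows "\<exists>h\<in>S. window (a - MN_mult G b h) m n"
proof -
  let ?i = "m + int n" and ?j = "m' + int n'"
  have pb: "part ?j b \<in> S" using b part_S by simp
  obtain k where k: "k \<in> S" "\<And>g. g \<in> supp k \<Longrightarrow> deg g = - ?j" "MN_mult G (part ?j b) k = one"
    using homogeneous_inverse[OF pb top(2), of ?j] by (auto simp: supp_part)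
  define h where "h = MN_mult G k (part ?i a)"
  have pa: "part ?i a \<in> S" using a part_S by simp
  have h: "h \<in> S" unfolding h_def using S_mult k pa by blast
  have hdeg: "deg g = ?i - ?j" if g: "g \<in> supp h" for g
  proof -
    obtain u v where "u \<in> supp k" "v \<in> supp (part ?i a)" "deg g = deg u + deg v"
      using g D_mult_suppE[of k "part ?i a" g] k pa unfolding h_def by (metis S_D)
    then show ?thesis using k(2)[of u] by (auto simp: supp_part)
  qed
  \<comment> \<open>The top degrees match and \<open>n' \<le> n\<close>, so the product does not
    reach below \<open>m\<close>.\<close>
  have bh: "window (MN_mult G b h) m (Suc n)"
    unfolding window_def
  proof
    fix g assume "g \<in> supp (MN_mult G b h)"
    then obtain u v where uv: "u \<in> supp b" "v \<in> supp h" "deg g = deg u + deg v"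
      using D_mult_suppE[of b h g] b h by (metis S_D)
    then show "m \<le> deg g \<and> deg g < m + int (Suc n)"
      using b(3) hdeg[OF uv(2)] le unfolding window_def by force
  qed
  have topbh: "part ?i (MN_mult G b h) = part ?i a"
  proof
    fix g
    have "MN_mult G (part ?j b) h = part ?i a"
      unfolding h_def using k(1,3) pb pa D.assoc[of "part ?j b" k "part ?i a"] by simp
    moreover have "MN_mult G b h = MN_mult G (part ?j b) h + MN_mult G (b - part ?j b) h"
      using D.distr[of h "part ?j b" "b - part ?j b"] b h pb by simp
    moreover have "MN_mult G (b - part ?j b) h g = 0" if "deg g = ?i"
    proof (rule ccontr)
      assume "MN_mult G (b - part ?j b) h g \<noteq> 0"
      then have "g \<in> supp (MN_mult G (b - part ?j b) h)" by (simp add: supp_def)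
      then obtain u v where uv: "u \<in> supp (b - part ?j b)" "v \<in> supp h" "deg g = deg u + deg v"
        using D_mult_suppE[of "b - part ?j b" h g] b h pb by (metis S_D D.diff_closed)
      then show False using hdeg[OF uv(2)] that by (auto simp: supp_def part_def split: if_splits)
    qed
    ultimately show "part ?i (MN_mult G b h) g = part ?i a g" by (auto simp: part_def)
  qed
  have "window (a - MN_mult G b h) m (Suc n)"
    using a(3) bh supp_diff_subset[of a "MN_mult G b h"] unfolding window_def by blast
  moreover have "part ?i (a - MN_mult G b h) = part ?i a - part ?i (MN_mult G b h)"
    by (auto simp: part_def fun_eq_iff)
  ultimately show ?thesis using window_shrink topbh h by auto
qed

lemma window_zero: "window f m 0 \<Longrightarrow> f = 0"
  unfolding window_def supp_empty_iff[symmetric] by force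

text \<open>If the remainder \<open>a - b h\<close> is zero, \<open>a\<close> itself is a common
  right multiple. Otherwise a common multiple \<open>(a - b h) c = b d\<close> gives
  \<open>a c = b (h c + d)\<close>.\<close>

lemma ore_window:
  "a \<in> S \<Longrightarrow> b \<in> S \<Longrightarrow> a \<noteq> 0 \<Longrightarrow> b \<noteq> 0 \<Longrightarrow> window a m n \<Longrightarrow> window b m' n' \<Longrightarrow>
    \<exists>c\<in>S. \<exists>d\<in>S. MN_mult G a c = MN_mult G b d \<and> MN_mult G a c \<noteq> 0"
proof (induction "n + n'" arbitrary: a b m n m' n' rule: less_induct)
  case less
  \<comment> \<open>The induction hypothesis is an explicit premise here, so that the case
    \<open>n < n'\<close> can be obtained with \<open>a\<close> and \<open>b\<close>
    exchanged.\<close>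
  have step: "\<exists>c\<in>S. \<exists>d\<in>S. MN_mult G a c = MN_mult G b d \<and> MN_mult G a c \<noteq> 0"
    if ab: "a \<in> S" "b \<in> S" "a \<noteq> 0" "b \<noteq> 0" "window a m n" "window b m' n'" and le: "n' \<le> n"
      and IH: "\<And>a b m k m' k'. k + k' < n + n' \<Longrightarrow> a \<in> S \<Longrightarrow> b \<in> S \<Longrightarrow> a \<noteq> 0 \<Longrightarrow> b \<noteq> 0 \<Longrightarrow>
        window a m k \<Longrightarrow> window b m' k' \<Longrightarrow> \<exists>c\<in>S. \<exists>d\<in>S. MN_mult G a c = MN_mult G b d \<and> MN_mult G a c \<noteq> 0"
    for a b m n m' n'
  proof -
    obtain k where n: "n = Suc k" using ab window_zero by (cases n) auto
    obtain k' where n': "n' = Suc k'" using ab window_zero by (cases n') auto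
    show ?thesis
    proof (cases "part (m + int k) a = 0 \<or> part (m' + int k') b = 0")
      case True
      then consider "window a m k" | "window b m' k'" using window_shrink ab n n' by auto
      then show ?thesis using IH[of k n' a b m m'] IH[of n k' a b m m'] ab n n' by cases auto
    next
      case False
      then obtain h where h: "h \<in> S" "window (a - MN_mult G b h) m k"
        using euclid_step[of a m k b m' k'] ab le n n' by auto
      let ?a = "a - MN_mult G b h"
      have aS: "?a \<in> S" using ab h S_diff S_mult by blast
      show ?thesis
      proof (cases "?a = 0")
        case True
        then have "MN_mult G a one = MN_mult G b h" using ab by simp
        then show ?thesis using ab h S_single[of \<one> 1] by (intro bexI[of _ one] bexI[of _ h]) auto
      next
        case False
        then obtain c d where cd: "c \<in> S" "d \<in> S" "MN_mult G ?a c = MN_mult G b d" "MN_mult G ?a c \<noteq> 0"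
          using IH[of k n' ?a b m m'] ab aS h n by auto
        have "c \<noteq> 0" using cd aS by auto
        have "MN_mult G a c = MN_mult G b (MN_mult G h c + d)"
          using cd(3) ab h cd(1,2) S_mult by (simp add: D.ring_rules algebra_simps)
        moreover have "MN_mult G a c \<noteq> 0" using D.no_zero_divisors[of a c] ab cd \<open>c \<noteq> 0\<close> by simp
        ultimately show ?thesis using cd h S_mult S_add by blast
      qed
    qed
  qed
  show ?case
  proof (cases "n' \<le> n")
    case True
    show ?thesis using step[OF less.prems True] less.hyps by blast
  next
    case False
    have "\<exists>c\<in>S. \<exists>d\<in>S. MN_mult G b c = MN_mult G a d \<and> MN_mult G b c \<noteq> 0"
    proof (rule step[of b a m' n' m n])
      fix a b m k m' k'
      assume "k + k' < n' + n" "a \<in> S" "b \<in> S" "a \<noteq> 0" "b \<noteq> 0" "window a m k" "window b m' k'"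
      then show "\<exists>c\<in>S. \<exists>d\<in>S. MN_mult G a c = MN_mult G b d \<and> MN_mult G a c \<noteq> 0"
        using less.hyps[of k k' a b m m'] by simp
    qed (use less.prems False in auto)
    then show ?thesis by metis
  qed
qed

sublocale D: ore_domain D "MN_mult G" one S
proof
  fix a b assume "a \<in> S" "b \<in> S" "a \<noteq> 0" "b \<noteq> 0"
  then show "\<exists>c\<in>S. \<exists>d\<in>S. MN_mult G a c = MN_mult G b d \<and> MN_mult G a c \<noteq> 0"
    using window_ex[of a] window_ex[of b] ore_window by metis
qed (use S_add S_uminus S_mult S_single in auto)

lemma ore_pair_E: "e * e = 1 \<Longrightarrow> ore_pair D (MN_mult G) one S (E e)"
proof -
  assume e: "e * e = 1"
  interpret E: div_ring "E e" "MN_mult G" one by (rule div_ring_E[OF e])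
  show ?thesis by unfold_locales (use S_E e in blast)
qed

end

lemma well_ordered_on_image:
  assumes "well_ordered_on r A" "\<And>a b. a \<in> A \<Longrightarrow> b \<in> A \<Longrightarrow> r' (\<phi> a) (\<phi> b) \<Longrightarrow> r a b"
  shows "well_ordered_on r' (\<phi> ` A)"
  unfolding well_ordered_on_def
proof (intro allI impI)
  fix T assume T: "T \<subseteq> \<phi> ` A" "T \<noteq> {}"
  have "{a\<in>A. \<phi> a \<in> T} \<noteq> {}" "{a\<in>A. \<phi> a \<in> T} \<subseteq> A" using T by auto
  then obtain m where m: "m \<in> {a\<in>A. \<phi> a \<in> T}" "\<forall>s\<in>{a\<in>A. \<phi> a \<in> T}. \<not> r s m"
    using assms(1) unfolding well_ordered_on_def by meson
  have "\<not> r' s (\<phi> m)" if s: "s \<in> T" for s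
  proof -
    obtain a where a: "s = \<phi> a" "a \<in> A" using s T by blast
    then have "a \<in> {a\<in>A. \<phi> a \<in> T}" using s by simp
    then show ?thesis using m assms(2)[of a m] a by blast
  qed
  then show "\<exists>m\<in>T. \<forall>s\<in>T. \<not> r' s m" using m by blast
qed

section \<open>Geometric series\<close>

context ordered_grp
begin

lemma pow_less: assumes h: "h \<in> carrier G" "\<one> \<lessdot> h" and "m < n" shows "h [^] (m::nat) \<lessdot> h [^] (n::nat)"
  using \<open>m < n\<close>
proof (induction n)
  case (Suc n)
  have 1: "h [^] n \<lessdot> h [^] Suc n" using lt_mult_left[of \<one> h "h [^] n"] h by simp
  show ?case
  proof (cases "m = n")
    case False
    then show ?thesis using Suc 1 lt_trans[of "h [^] m" "h [^] n" "h [^] Suc n"] h by simp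
  qed (use 1 in simp)
qed simp

lemma pow_inj: assumes h: "h \<in> carrier G" "\<one> \<lessdot> h" and "h [^] (m::nat) = h [^] (n::nat)" shows "m = n"
  using pow_less[OF h, of m n] pow_less[OF h, of n m] lt_irrefl[of "h [^] n"] assms
  by (metis linorder_neqE_nat nat_pow_closed)

text \<open>The series with coefficient \<open>\<epsilon> ^ n\<close> at the \<open>n\<close>-th
  power of \<open>h\<close>. The exponent picked by \<open>SOME\<close> is unique once
  \<open>\<one> \<lessdot> h\<close>, by \<open>pow_inj\<close>.\<close>

definition geo :: "'k::field \<Rightarrow> 'g \<Rightarrow> 'g \<Rightarrow> 'k" where
  "geo \<epsilon> h g = (if \<exists>n::nat. g = h [^] n then \<epsilon> ^ (SOME n. g = h [^] n) else 0)"

lemma geo_pow: assumes h: "h \<in> carrier G" "\<one> \<lessdot> h" shows "geo \<epsilon> h (h [^] (n::nat)) = \<epsilon> ^ n"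
proof -
  have "(SOME m. h [^] n = h [^] m) = n" using pow_inj[OF h] by (metis (mono_tags, lifting) someI_ex)
  then show ?thesis unfolding geo_def by auto
qed

lemma geo_nonzeroE: assumes "geo \<epsilon> h g \<noteq> 0" obtains n :: nat where "g = h [^] n"
  using assms unfolding geo_def by (auto split: if_splits)

lemma geo_MN: assumes h: "h \<in> carrier G" "\<one> \<lessdot> h" shows "geo \<epsilon> h \<in> MN"
proof -
  have "well_ordered_on lt ((\<lambda>n::nat. h [^] n) ` UNIV)"
  proof (rule well_ordered_on_image[where r = "(<)"])
    show "well_ordered_on (<) (UNIV :: nat set)"
      unfolding well_ordered_on_def
    proof (intro allI impI)
      fix T :: "nat set" assume "T \<noteq> {}"
      then have "(LEAST n. n \<in> T) \<in> T" by (meson LeastI_ex all_not_in_conv)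
      moreover have "\<forall>s\<in>T. \<not> s < (LEAST n. n \<in> T)"
      proof (intro ballI notI)
        fix s assume s: "s \<in> T" "s < (LEAST n. n \<in> T)"
        show False by (rule notE[OF not_less_Least[OF s(2)] s(1)])
      qed
      ultimately show "\<exists>m\<in>T. \<forall>s\<in>T. \<not> s < m" by (intro bexI)
    qed
    show "a < b" if "h [^] a \<lessdot> h [^] b" for a b :: nat
    proof (rule ccontr)
      assume "\<not> a < b"
      then have "h [^] b \<lessdot> h [^] a \<or> a = b" using pow_less[OF h, of b a] by (cases "a = b") auto
      then show False using that lt_asym[of "h [^] a" "h [^] b"] lt_irrefl[of "h [^] b"] h by auto
    qed
  qed
  moreover have "supp (geo \<epsilon> h) \<subseteq> (\<lambda>n::nat. h [^] n) ` UNIV"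
    by (auto simp: supp_def elim!: geo_nonzeroE)
  ultimately show ?thesis using h by (intro MN_I well_ordered_on_subset[of lt _ "supp (geo \<epsilon> h)"]) auto
qed

lemma single_mult_geo:
  assumes h: "h \<in> carrier G" "\<one> \<lessdot> h" shows "single h \<epsilon> \<star> geo \<epsilon> h = geo \<epsilon> h - single \<one> 1"
proof
  fix g
  show "(single h \<epsilon> \<star> geo \<epsilon> h) g = (geo \<epsilon> h - single \<one> 1) g"
  proof (cases "g \<in> carrier G")
    case g: True
    have lhs: "(single h \<epsilon> \<star> geo \<epsilon> h) g = \<epsilon> * geo \<epsilon> h (inv h \<otimes> g)"
      using g h by (simp add: single_mult geo_MN)
    show ?thesis
    proof (cases "\<exists>n::nat. g = h [^] n")
      case True
      then obtain n :: nat where n: "g = h [^] n" by blast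
      show ?thesis
      proof (cases n)
        case 0
        have "geo \<epsilon> h (inv h) = 0"
        proof (rule ccontr)
          assume "geo \<epsilon> h (inv h) \<noteq> 0"
          then obtain m :: nat where "inv h = h [^] m" by (rule geo_nonzeroE)
          then have "h [^] Suc m = h [^] (0::nat)" using h by (metis l_inv nat_pow_0 nat_pow_Suc)
          then show False using pow_inj[OF h] by blast
        qed
        then show ?thesis using lhs n 0 h geo_pow[OF h, of \<epsilon> 0] by (simp add: single_apply)
      next
        case (Suc m)
        have "g = h \<otimes> h [^] m" using n Suc h nat_pow_Suc2[of h m] by simp
        then have "inv h \<otimes> g = h [^] m" using h by simp
        moreover have "g \<noteq> \<one>" using pow_inj[OF h, of n 0] n Suc by auto
        ultimately show ?thesis using lhs n Suc geo_pow[OF h, of \<epsilon> n] geo_pow[OF h, of \<epsilon> m] by (simp add: single_apply del: nat_pow_Suc)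
      qed
    next
      case False
      have "geo \<epsilon> h (inv h \<otimes> g) = 0"
      proof (rule ccontr)
        assume "geo \<epsilon> h (inv h \<otimes> g) \<noteq> 0"
        then obtain m :: nat where "inv h \<otimes> g = h [^] m" by (rule geo_nonzeroE)
        then have "g = h \<otimes> h [^] m" using inv_cancel_left(2)[OF h(1) g] by simp
        then have "g = h [^] Suc m" using h nat_pow_Suc2[of h m] by simp
        then show False using False by blast
      qed
      moreover have "g \<noteq> \<one>" using False by (metis nat_pow_0)
      ultimately show ?thesis using False lhs by (simp add: geo_def single_apply)
    qed
  next
    case False
    then show ?thesis using h geo_MN[OF h, of \<epsilon>] MN_outside[OF geo_MN[OF h, of \<epsilon>] False]
      by (auto simp: mult_outside MN_supp single_apply supp_single_subset[THEN subset_trans])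
  qed
qed

lemma geo_inverse:
  assumes h: "h \<in> carrier G" "\<one> \<lessdot> h" shows "(single \<one> 1 - single h \<epsilon>) \<star> geo \<epsilon> h = single \<one> 1"
  using mult_distrib_right[of "geo \<epsilon> h" "single \<one> 1 - single h \<epsilon>" "single h \<epsilon>"] h geo_MN[OF h, of \<epsilon>]
  by (simp add: single_mult_geo)

end

section \<open>Conjugation by \<open>x\<close> on series, fractions and their expansions\<close>

context graded
begin

text \<open>This is the series \<open>c f c\<^sup>-\<^sup>1\<close>, as \<open>cj_eq_mult\<close>
  shows inside \<open>A\<close>. The pointwise form also makes sense in the completions
  \<open>E e\<close>, which consist of series on \<open>L\<close> and do not contain
  \<open>x\<close>.\<close>

definition cj :: "'g \<Rightarrow> ('g \<Rightarrow> 'k) \<Rightarrow> 'g \<Rightarrow> 'k" where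
  "cj c f = (\<lambda>g. if g \<in> carrier G then f (inv c \<otimes> g \<otimes> c) else 0)"

lemma x_cases: "c = x \<or> c = inv x \<Longrightarrow> c \<in> carrier G"
  "c = x \<or> c = inv x \<Longrightarrow> g \<in> L \<Longrightarrow> c \<otimes> g \<otimes> inv c \<in> L"
  "c = x \<or> c = inv x \<Longrightarrow> g \<in> L \<Longrightarrow> inv c \<otimes> g \<otimes> c \<in> L"
  "c = x \<or> c = inv x \<Longrightarrow> g \<in> L \<Longrightarrow> deg (c \<otimes> g \<otimes> inv c) = deg g"
  using x_L x_L' deg_x deg_x' by auto

lemma conj_inverse:
  assumes "c \<in> carrier G" "g \<in> carrier G"
  shows "inv c \<otimes> (c \<otimes> g \<otimes> inv c) \<otimes> c = g" "c \<otimes> (inv c \<otimes> g \<otimes> c) \<otimes> inv c = g"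
  using assms by (simp_all add: m_assoc)

lemma supp_cj:
  assumes "c \<in> carrier G" "supp f \<subseteq> carrier G"
  shows "supp (cj c f) = (\<lambda>g. c \<otimes> g \<otimes> inv c) ` supp f"
proof (intro equalityI subsetI)
  fix g assume "g \<in> supp (cj c f)"
  then have "g \<in> carrier G" "inv c \<otimes> g \<otimes> c \<in> supp f" by (auto simp: supp_def cj_def split: if_splits)
  then show "g \<in> (\<lambda>g. c \<otimes> g \<otimes> inv c) ` supp f" using conj_inverse(2)[OF assms(1)] by (metis imageI)
next
  fix g assume "g \<in> (\<lambda>g. c \<otimes> g \<otimes> inv c) ` supp f"
  then obtain a where a: "a \<in> supp f" "g = c \<otimes> a \<otimes> inv c" by blast
  then have "a \<in> carrier G" using assms by blast
  then show "g \<in> supp (cj c f)" using a assms conj_inverse(1)[of c a] by (auto simp: supp_def cj_def)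
qed

lemma cj_mult:
  assumes c: "c \<in> carrier G" and f: "supp f \<subseteq> carrier G" and g: "supp g \<subseteq> carrier G"
  shows "cj c (MN_mult G f g) = MN_mult G (cj c f) (cj c g)"
proof
  fix z
  show "cj c (MN_mult G f g) z = MN_mult G (cj c f) (cj c g) z"
  proof (cases "z \<in> carrier G")
    case z: True
    let ?\<phi> = "\<lambda>a. c \<otimes> a \<otimes> inv c"
    let ?P = "{(y, w). y \<in> supp f \<and> w \<in> supp g \<and> y \<otimes> w = inv c \<otimes> z \<otimes> c}"
    let ?Q = "{(y, w). y \<in> supp (cj c f) \<and> w \<in> supp (cj c g) \<and> y \<otimes> w = z}"
    have hom: "?\<phi> a \<otimes> ?\<phi> b = ?\<phi> (a \<otimes> b)" if "a \<in> carrier G" "b \<in> carrier G" for a b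
      using c that by (simp add: m_assoc)
    have inj: "a = b" if "a \<in> carrier G" "b \<in> carrier G" "?\<phi> a = ?\<phi> b" for a b
      using conj_inverse(1)[OF c that(1)] conj_inverse(1)[OF c that(2)] that(3) by metis
    have "?Q = (\<lambda>(a, b). (?\<phi> a, ?\<phi> b)) ` ?P"
    proof (intro equalityI subsetI)
      fix q assume "q \<in> ?Q"
      then obtain a b where q: "q = (?\<phi> a, ?\<phi> b)" "a \<in> supp f" "b \<in> supp g" "?\<phi> a \<otimes> ?\<phi> b = z"
        unfolding supp_cj[OF c f] supp_cj[OF c g] by blast
      moreover have ab: "a \<in> carrier G" "b \<in> carrier G" using q f g by auto
      ultimately have "a \<otimes> b = inv c \<otimes> z \<otimes> c" using hom[OF ab] conj_inverse(1)[OF c, of "a \<otimes> b"] by simp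
      then show "q \<in> (\<lambda>(a, b). (?\<phi> a, ?\<phi> b)) ` ?P" using q by auto
    next
      fix q assume "q \<in> (\<lambda>(a, b). (?\<phi> a, ?\<phi> b)) ` ?P"
      then obtain a b where q: "q = (?\<phi> a, ?\<phi> b)" "a \<in> supp f" "b \<in> supp g" "a \<otimes> b = inv c \<otimes> z \<otimes> c" by auto
      moreover have ab: "a \<in> carrier G" "b \<in> carrier G" using q f g by auto
      ultimately have "?\<phi> a \<otimes> ?\<phi> b = z" using hom[OF ab] conj_inverse(2)[OF c z] by simp
      then show "q \<in> ?Q" unfolding supp_cj[OF c f] supp_cj[OF c g] using q by auto
    qed
    moreover have "inj_on (\<lambda>(a, b). (?\<phi> a, ?\<phi> b)) ?P"
      by (rule inj_onI) (use inj f g in \<open>auto simp: subset_iff\<close>)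
    ultimately have "MN_mult G (cj c f) (cj c g) z = (\<Sum>p\<in>?P. f (fst p) * g (snd p))"
      unfolding MN_mult_def
      by (subst sum.reindex_cong[of "\<lambda>(a, b). (?\<phi> a, ?\<phi> b)" ?P ?Q])
         (use f g c in \<open>auto simp: cj_def conj_inverse subset_iff intro!: sum.cong\<close>)
    then show ?thesis using z by (simp add: cj_def MN_mult_def)
  next
    case False
    have "supp (cj c f) \<subseteq> carrier G" "supp (cj c g) \<subseteq> carrier G" by (auto simp: supp_def cj_def)
    then show ?thesis using False mult_outside[of "cj c f" "cj c g" z] by (simp add: cj_def)
  qed
qed

lemma cj_add: "cj c (f + g) = cj c f + cj c g"
  and cj_diff: "cj c (f - g) = cj c f - cj c g"
  by (auto simp: cj_def fun_eq_iff)

lemma cj_cj: "supp f \<subseteq> carrier G \<Longrightarrow> c \<in> carrier G \<Longrightarrow> cj c (cj (inv c) f) = f"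
  by (auto simp: cj_def fun_eq_iff conj_inverse supp_def)

lemma cj_single: "h \<in> carrier G \<Longrightarrow> c \<in> carrier G \<Longrightarrow> cj c (single h a) = single (c \<otimes> h \<otimes> inv c) a"
proof -
  assume h: "h \<in> carrier G" "c \<in> carrier G"
  have "inv c \<otimes> g \<otimes> c = h \<longleftrightarrow> g = c \<otimes> h \<otimes> inv c" if "g \<in> carrier G" for g
    using conj_inverse[OF h(2) that] conj_inverse[OF h(2,1)] by metis
  then show ?thesis using h by (auto simp: cj_def single_def fun_eq_iff)
qed

lemma cj_eq_mult:
  assumes "f \<in> A" "c \<in> carrier G"
  shows "cj c f = single c 1 \<star> f \<star> single (inv c) 1"
proof -
  have "single c 1 \<star> f \<in> A" using assms by simp
  then show ?thesis
    using assms by (subst mult_single) (auto simp: single_mult cj_def fun_eq_iff m_assoc)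
qed

lemma lt_conj:
  assumes "c \<in> carrier G" "a \<in> carrier G" "b \<in> carrier G" "c \<otimes> a \<otimes> inv c \<lessdot> c \<otimes> b \<otimes> inv c" shows "a \<lessdot> b"
proof -
  have "inv c \<otimes> (c \<otimes> a \<otimes> inv c) \<otimes> c \<lessdot> inv c \<otimes> (c \<otimes> b \<otimes> inv c) \<otimes> c"
    using assms lt_mult_right[OF _ _ _ lt_mult_left[OF _ _ _ assms(4), of "inv c"], of c] by simp
  then show ?thesis using assms by (simp add: conj_inverse)
qed

lemma cj_MN:
  assumes c: "c = x \<or> c = inv x" and f: "f \<in> MN_series GL r"
    and r: "\<And>a b. a \<in> L \<Longrightarrow> b \<in> L \<Longrightarrow> r (c \<otimes> a \<otimes> inv c) (c \<otimes> b \<otimes> inv c) \<Longrightarrow> r a b"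
  shows "cj c f \<in> MN_series GL r"
proof -
  have s: "supp f \<subseteq> L" "well_ordered_on r (supp f)" using f by (simp_all add: MN_series_def)
  then have "supp (cj c f) = (\<lambda>g. c \<otimes> g \<otimes> inv c) ` supp f" using c x_cases(1) L_G by (intro supp_cj) auto
  moreover have "well_ordered_on r ((\<lambda>g. c \<otimes> g \<otimes> inv c) ` supp f)"
    by (rule well_ordered_on_image[OF s(2)]) (use s r in blast)
  moreover have "(\<lambda>g. c \<otimes> g \<otimes> inv c) ` supp f \<subseteq> L" using s c x_cases(2) by auto
  ultimately show ?thesis by (simp add: MN_series_def)
qed

lemma cj_D: assumes "c = x \<or> c = inv x" "f \<in> D" shows "cj c f \<in> D"
  by (rule cj_MN[OF assms]) (erule lt_conj[OF x_cases(1)[OF assms(1)] L_G L_G])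

lemma cj_E: assumes c: "c = x \<or> c = inv x" and "f \<in> E e" shows "cj c f \<in> E e"
proof (rule cj_MN[OF c assms(2)])
  fix a b assume "a \<in> L" "b \<in> L" "ltd e (c \<otimes> a \<otimes> inv c) (c \<otimes> b \<otimes> inv c)"
  then show "ltd e a b" using lt_conj[OF x_cases(1)[OF c], of a b] x_cases(4)[OF c] L_G unfolding ltd_def by metis
qed

lemma cj_S: assumes c: "c = x \<or> c = inv x" and f: "f \<in> S" shows "cj c f \<in> S"
proof -
  have L: "supp f \<subseteq> L" using D_supp[OF S_D[OF f]] by blast
  then have "supp (cj c f) = (\<lambda>g. c \<otimes> g \<otimes> inv c) ` supp f"
    using c x_cases(1) L_G by (intro supp_cj) auto
  then have "deg ` supp (cj c f) \<subseteq> deg ` supp f" using L x_cases(4)[OF c] by (auto simp: subset_iff)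
  then have "finite (deg ` supp (cj c f))" using S_finite_deg[OF f] by (rule finite_subset)
  then show ?thesis using cj_D[OF c S_D[OF f]] unfolding S_def by blast
qed

lemma D_supp_carrier: "f \<in> D \<Longrightarrow> supp f \<subseteq> carrier G"
  using D_supp L_G by blast

lemma E_supp_carrier: "f \<in> E e \<Longrightarrow> supp f \<subseteq> carrier G"
  by (auto simp: MN_series_def)

lemma cj_zero_iff: "supp f \<subseteq> carrier G \<Longrightarrow> c \<in> carrier G \<Longrightarrow> cj c f = 0 \<longleftrightarrow> f = 0"
  using supp_cj[of c f] by (metis image_is_empty supp_empty_iff)

text \<open>Conjugation is multiplicative and preserves \<open>S\<close>, so it carries a
  denominator of \<open>f\<close> to a denominator of \<open>cj c f\<close>, for the same
  value.\<close>

lemma cj_realises: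
  assumes e: "e * e = 1" and c: "c = x \<or> c = inv x"
    and r: "ore_pair.realises D (MN_mult G) S (E e) f f'"
  shows "ore_pair.realises D (MN_mult G) S (E e) (cj c f) (cj c f')"
proof -
  interpret P: ore_pair D "MN_mult G" one S "E e" by (rule ore_pair_E[OF e])
  obtain b where b: "b \<in> S" "b \<noteq> 0" "f \<star> b \<in> S" "f' \<star> b = f \<star> b" and ff: "f \<in> D" "f' \<in> E e"
    using r unfolding P.realises_def by blast
  note cc = x_cases(1)[OF c]
  have "cj c (f \<star> b) = cj c f \<star> cj c b" "cj c (f' \<star> b) = cj c f' \<star> cj c b"
    using cj_mult[OF cc D_supp_carrier[OF ff(1)] D_supp_carrier[OF S_D[OF b(1)]]]
      cj_mult[OF cc E_supp_carrier[OF ff(2)] D_supp_carrier[OF S_D[OF b(1)]]] by simp_all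
  then show ?thesis
    using b ff cj_S[OF c b(1)] cj_S[OF c b(3)] cj_D[OF c ff(1)] cj_E[OF c ff(2)]
      cj_zero_iff[OF D_supp_carrier[OF S_D[OF b(1)]] cc]
    unfolding P.realises_def by (auto intro!: bexI[of _ "cj c b"])
qed

lemma cj_frac: assumes c: "c = x \<or> c = inv x" and f: "f \<in> D.frac" shows "cj c f \<in> D.frac"
proof -
  interpret P: ore_pair D "MN_mult G" one S "E 1" by (rule ore_pair_E) simp
  obtain f' where "P.realises f f'" using P.realises_ex f by blast
  then show ?thesis using cj_realises[OF _ c] P.realises_D(3) by force
qed

text \<open>A coboundary \<open>c - cj x c\<close> vanishes at every element commuting with \<open>x\<close>,
  in every completion.\<close>

lemma coboundary_vanishes:
  assumes e: "e * e = 1" and c: "c \<in> D.frac"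
    and r: "ore_pair.realises D (MN_mult G) S (E e) (c - cj x c) b"
    and g: "g \<in> carrier G" "x \<otimes> g = g \<otimes> x"
  shows "b g = 0"
proof -
  interpret P: ore_pair D "MN_mult G" one S "E e" by (rule ore_pair_E[OF e])
  obtain c' where c': "P.realises c c'" using P.realises_ex c by blast
  then have "P.realises (c - cj x c) (c' - cj x c')" using cj_realises[OF e, of x] P.realises_diff by blast
  then have "b = c' - cj x c'" using r P.realises_unique by blast
  moreover have "inv x \<otimes> g \<otimes> x = g" using g by (simp add: m_assoc flip: g(2))
  ultimately show ?thesis using g by (simp add: cj_def)
qed

definition cobound :: "('g \<Rightarrow> 'k) set" where "cobound = {c - cj x c |c. c \<in> D.frac}"

end

section \<open>The letters as elements of the division ring\<close>

context free_letters
begin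

fun letter :: "bool \<times> bool \<Rightarrow> 'a" where
  "letter (j, False) = d j \<star> ((one - t) \<star> (lam \<star> (p \<star> (\<kappa> \<star> (p \<star> (lam' \<star> ((one - t) \<star> e j)))))))"
| "letter (j, True) = rinv (e j) \<star> (p \<star> (rinv lam' \<star> ((one - t) \<star> (rinv \<kappa> \<star> ((one - t) \<star> (rinv lam \<star> (p \<star> rinv (d j))))))))"

lemma letter_D: "letter l \<in> D"
  by (cases l rule: letter.cases) (simp_all add: K_closed)

lemma act_eq: "y \<in> D \<Longrightarrow> act l y = letter l \<star> y"
  by (cases "(l, y)" rule: act.cases) (simp_all add: K_closed assoc)

lemma p_nonzero: "p \<noteq> 0" and one_minus_t_nonzero: "one - t \<noteq> 0"
  using p_inverse one_neq_zero by (metis mult_zero_right mult_zero_left diff_closed one_closed t_D p_D)+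

lemma p_right_inverse: "p \<star> (one - t) = one"
  using rinv_unique[OF _ p_D p_inverse] rinv_left[OF _ one_minus_t_nonzero] by simp

lemma p_cancel: "y \<in> D \<Longrightarrow> p \<star> ((one - t) \<star> y) = y" "y \<in> D \<Longrightarrow> (one - t) \<star> (p \<star> y) = y"
  using assoc[of p "one - t" y] assoc[of "one - t" p y] p_right_inverse p_inverse by simp_all

lemma letter_inverse: "letter (j, False) \<star> letter (j, True) = one" "letter (j, True) \<star> letter (j, False) = one"
proof -
  have ej: "\<And>z. z \<in> D \<Longrightarrow> e j \<star> (rinv (e j) \<star> z) = z" "\<And>z. z \<in> D \<Longrightarrow> rinv (e j) \<star> (e j \<star> z) = z"
    "\<And>z. z \<in> D \<Longrightarrow> d j \<star> (rinv (d j) \<star> z) = z" "\<And>z. z \<in> D \<Longrightarrow> rinv (d j) \<star> (d j \<star> z) = z"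
    using e_K d_K by simp_all
  have kk: "rinv (e j) \<star> e j = one" "d j \<star> rinv (d j) = one" using e_K[of j] d_K[of j] by simp_all
  \<comment> \<open>Read as an action, the product is a right-nested chain in which adjacent factors
    cancel from the inside outwards.\<close>
  have "letter (j, False) \<star> letter (j, True) = act (j, False) (letter (j, True))"
    by (rule act_eq[OF letter_D, symmetric])
  also have "\<dots> = one"
    by (simp add: K_closed ej p_cancel lam_K lam'_K \<kappa>_K kk)
  finally show "letter (j, False) \<star> letter (j, True) = one" .
  have "letter (j, True) \<star> letter (j, False) = act (j, True) (letter (j, False))"
    by (rule act_eq[OF letter_D, symmetric])
  also have "\<dots> = one"
    by (simp add: K_closed ej p_cancel lam_K lam'_K \<kappa>_K kk)
  finally show "letter (j, True) \<star> letter (j, False) = one" .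
qed

abbreviation "word w \<equiv> eval_word mult one (letter (False, False)) (letter (False, True))
   (letter (True, False)) (letter (True, True)) w"

lemma word_acts: "word w \<in> D \<and> (y \<in> D \<longrightarrow> word w \<star> y = foldr act w y \<and> foldr act w y \<in> D)"
proof (induction w)
  case Nil
  then show ?case by (simp add: eval_word_def)
next
  case (Cons l w)
  obtain i s where l: "l = (i, s)" by (cases l)
  have "word (l # w) = letter l \<star> word w"
    unfolding eval_word_def l by (cases i; cases s) simp_all
  then show ?case using Cons letter_D[of l] act_eq[of "foldr act w y" l] by (simp add: assoc)
qed

theorem reduced_word_nontrivial:
  assumes "stable M" "one \<in> M" "p \<notin> M" "w \<noteq> []" "reduced_word w"
  shows "word w \<noteq> one"
proof
  assume "word w = one"
  then have "foldr act w y = y" if "y \<in> D" for y using word_acts[of w y] that by simp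
  then show False using reduced_word_acts_nontrivially[OF assms] by blast
qed

end

section \<open>The starting module and the coefficient test\<close>

context graded
begin

lemma rinv_D_A: "a \<in> D \<Longrightarrow> a \<noteq> 0 \<Longrightarrow> A.rinv a = D.rinv a"
  using D.rinv_closed[of a] by (intro A.rinv_unique) simp_all

abbreviation t :: "'g \<Rightarrow> 'k" where "t \<equiv> single x 1"
abbreviation p :: "'g \<Rightarrow> 'k" where "p \<equiv> geo 1 x"

lemma t_commute: "c \<in> A \<Longrightarrow> t \<star> c = cj x c \<star> t"
  using cj_eq_mult[of c x] A.assoc[of "t \<star> c" "single (inv x) 1" t] by simp

lemma pole_graded: "pole A (MN_mult G) one D.frac t p (cj x)"
proof
  show "D.frac \<subseteq> A" using D.frac_D D_A by blast
  show "a \<in> D.frac \<Longrightarrow> a \<noteq> 0 \<Longrightarrow> A.rinv a \<in> D.frac" for a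
    using D.frac_rinv[of a] rinv_D_A[of a] D.frac_D by simp
  show "c \<in> D.frac \<Longrightarrow> t \<star> c = cj x c \<star> t" for c using t_commute by simp
  show "(one - t) \<star> p = one" by (rule geo_inverse[OF x_G x_pos])
  show "p \<in> A" by (rule geo_MN[OF x_G x_pos])
  show "c \<in> D.frac \<Longrightarrow> cj x c \<in> D.frac" for c using cj_frac by blast
qed (use D.frac_add D.frac_uminus D.frac_mult D.frac_S S_single in auto)

text \<open>Series meeting only finitely many of the cosets of \<open>L\<close> by natural powers of
  \<open>x\<close>. Multiplication by \<open>K\<close> keeps these cosets and \<open>t\<close>
  shifts them by one, whereas \<open>p\<close> meets all of them; so this is a stable module that
  contains \<open>one\<close> but not \<open>p\<close>.\<close>

definition bounded :: "('g \<Rightarrow> 'k) set" where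
  "bounded = {f\<in>A. finite {n::nat. \<exists>l\<in>L. f (l \<otimes> x [^] n) \<noteq> 0}}"

lemma p_not_bounded: "p \<notin> bounded"
proof
  assume "p \<in> bounded"
  then have f: "finite {n::nat. \<exists>l\<in>L. p (l \<otimes> x [^] n) \<noteq> 0}" by (simp add: bounded_def)
  have "\<exists>l\<in>L. p (l \<otimes> x [^] n) \<noteq> 0" for n :: nat
    using geo_pow[OF x_G x_pos, of "1::'k" n] by (intro bexI[of _ \<one>]) auto
  then show False using f by simp
qed

lemma coset_unique:
  assumes "l \<in> L" "l' \<in> L" "l \<otimes> x [^] (n::nat) = l' \<otimes> x [^] (m::nat)" shows "n = m"
proof -
  have *: False if "l \<in> L" "l' \<in> L" "l \<otimes> x [^] (n::nat) = l' \<otimes> x [^] (m::nat)" "n < m" for l l' n m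
  proof -
    have "x [^] m = x [^] (m - n) \<otimes> x [^] n" using that(4) by (simp add: nat_pow_mult)
    then have "l \<otimes> x [^] n = (l' \<otimes> x [^] (m - n)) \<otimes> x [^] n" using that by (simp add: m_assoc)
    then have "l = l' \<otimes> x [^] (m - n)" using that by simp
    then have "inv l' \<otimes> l = x [^] (m - n)" using that by simp
    then show False using x_pow[of "m - n"] that L_closed by (metis zero_less_diff)
  qed
  show ?thesis using *[OF assms] *[OF assms(2,1) assms(3)[symmetric]] by (cases n m rule: linorder_cases) auto
qed

lemma one_bounded: "one \<in> bounded"
proof -
  have "n = 0" if "l \<in> L" "one (l \<otimes> x [^] n) \<noteq> 0" for n :: nat and l
    using that coset_unique[of l \<one> n 0] by (simp add: single_apply split: if_splits)
  then have "{n::nat. \<exists>l\<in>L. one (l \<otimes> x [^] n) \<noteq> 0} \<subseteq> {0}" by auto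
  then show ?thesis unfolding bounded_def by (auto intro: finite_subset)
qed

lemma stable_bounded: "pole.stable A (MN_mult G) D.frac t bounded"
proof -
  interpret pole A "MN_mult G" one D.frac t p "cj x" by (rule pole_graded)
  define J where "J f = {n::nat. \<exists>l\<in>L. f (l \<otimes> x [^] n) \<noteq> 0}" for f :: "'g \<Rightarrow> 'k"
  have B: "f \<in> bounded \<longleftrightarrow> f \<in> A \<and> finite (J f)" for f by (simp add: bounded_def J_def)
  show ?thesis
    unfolding stable_def
  proof (intro conjI ballI)
    show "bounded \<subseteq> A" by (auto simp: B)
    show "0 \<in> bounded" by (simp add: B J_def)
  next
    fix a b assume ab: "a \<in> bounded" "b \<in> bounded"
    have "J (a + b) \<subseteq> J a \<union> J b" unfolding J_def by fastforce
    then show "a + b \<in> bounded" using ab by (auto simp: B intro: finite_subset)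
  next
    fix c a assume c: "c \<in> D.frac" and a: "a \<in> bounded"
    have "J (c \<star> a) \<subseteq> J a"
    proof
      fix n assume "n \<in> J (c \<star> a)"
      then obtain l where l: "l \<in> L" "(c \<star> a) (l \<otimes> x [^] n) \<noteq> 0" unfolding J_def by blast
      then obtain u v where uv: "u \<in> supp c" "v \<in> supp a" "l \<otimes> x [^] n = u \<otimes> v" by (metis mult_nonzeroE)
      have u: "u \<in> L" using uv c D_supp D.frac_D by blast
      have v: "v \<in> carrier G" using uv a MN_supp by (auto simp: B)
      have "v = inv u \<otimes> (u \<otimes> v)" using u v by simp
      also have "\<dots> = (inv u \<otimes> l) \<otimes> x [^] n" using uv(3)[symmetric] u l by (simp add: m_assoc)
      finally show "n \<in> J a" using uv(2) u l unfolding J_def by (auto simp: supp_def intro!: bexI[of _ "inv u \<otimes> l"])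
    qed
    then show "c \<star> a \<in> bounded" using a c by (auto simp: B intro: finite_subset)
  next
    fix a assume a: "a \<in> bounded"
    \<comment> \<open>Index zero is added because it may be reached from the coset of
      \<open>inv x\<close>, which \<open>J\<close> does not count.\<close>
    have "J (t \<star> a) \<subseteq> insert 0 (Suc ` J a)"
    proof
      fix n assume "n \<in> J (t \<star> a)"
      then obtain l where l: "l \<in> L" "(t \<star> a) (l \<otimes> x [^] n) \<noteq> 0" unfolding J_def by blast
      show "n \<in> insert 0 (Suc ` J a)"
      proof (cases n)
        case (Suc m)
        have "a (inv x \<otimes> (l \<otimes> x [^] n)) \<noteq> 0" using l a by (simp add: single_mult B split: if_splits)
        moreover have "inv x \<otimes> (l \<otimes> x [^] n) = (inv x \<otimes> l \<otimes> x) \<otimes> x [^] m"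
          using Suc l nat_pow_Suc2[of x m] by (simp add: m_assoc)
        ultimately have "m \<in> J a" using x_L'[OF l(1)] unfolding J_def by auto
        then show ?thesis using Suc by blast
      qed simp
    qed
    then show "t \<star> a \<in> bounded" using a by (auto simp: B intro: finite_subset)
  qed
qed

lemma coboundaries_eq: "pole.coboundaries D.frac (cj x) = cobound"
proof -
  interpret pole A "MN_mult G" one D.frac t p "cj x" by (rule pole_graded)
  show ?thesis unfolding coboundaries_def cobound_def ..
qed

abbreviation realises where "realises e f f' \<equiv> ore_pair.realises D (MN_mult G) S (E e) f f'"

definition hom :: "('g \<Rightarrow> 'k) \<Rightarrow> int \<Rightarrow> bool" where
  "hom f i \<longleftrightarrow> f \<in> S \<and> (\<forall>g\<in>supp f. deg g = i)"

lemma hom_S: "hom f i \<Longrightarrow> f \<in> S" by (simp add: hom_def)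

lemma hom_single: "g \<in> L \<Longrightarrow> deg g = i \<Longrightarrow> hom (single g c) i"
  using supp_single_subset[of g c] S_single by (auto simp: hom_def)

lemma hom_diff: "hom f i \<Longrightarrow> hom g i \<Longrightarrow> hom (f - g) i"
  using supp_diff_subset[of f g] S_diff by (auto simp: hom_def)

lemma E_suppE:
  assumes "f \<in> E e" "g \<in> E e" "(f \<star> g) z \<noteq> 0"
  obtains a b where "a \<in> supp f" "b \<in> supp g" "z = a \<otimes> b" "deg z = deg a + deg b" "a \<in> L" "b \<in> L"
proof -
  obtain a b where ab: "a \<in> supp f" "b \<in> supp g" "z = a \<otimes> b" using assms(3) by (rule mult_nonzeroE)
  moreover have "a \<in> L" "b \<in> L" using ab assms by (auto simp: MN_series_def)
  ultimately show ?thesis using that deg_mult by simp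
qed

lemma part_E: "f \<in> E e \<Longrightarrow> part k f \<in> E e"
  using well_ordered_on_subset[of "ltd e" "supp f" "supp (part k f)"]
  by (auto simp: MN_series_def supp_part)

lemma part_sandwich:
  assumes e: "e * e = 1" and u: "hom u i" and v: "hom v j" and f: "f \<in> E e" and z: "deg z = i + k + j"
  shows "(u \<star> (f \<star> v)) z = (u \<star> (part k f \<star> v)) z"
proof -
  interpret E: div_ring "E e" "MN_mult G" one by (rule div_ring_E[OF e])
  let ?p = "part k f"
  have cl: "u \<in> E e" "v \<in> E e" "?p \<in> E e" using u v f part_E S_E[OF _ e] by (auto simp: hom_def)
  have d: "f - ?p \<in> E e" using E.diff_closed[OF f cl(3)] .
  then have dv: "(f - ?p) \<star> v \<in> E e" using E.mult_closed cl by blast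
  have "u \<star> (f \<star> v) = u \<star> (?p \<star> v) + u \<star> ((f - ?p) \<star> v)"
    using cl f by (simp add: E.diffr E.diffl)
  moreover have "(u \<star> ((f - ?p) \<star> v)) z = 0"
  proof (rule ccontr)
    assume "(u \<star> ((f - ?p) \<star> v)) z \<noteq> 0"
    then obtain a w where a: "a \<in> supp u" "w \<in> supp ((f - ?p) \<star> v)" "z = a \<otimes> w" "deg z = deg a + deg w" "a \<in> L" "w \<in> L"
      by (rule E_suppE[OF cl(1) dv])
    from a(2) have "((f - ?p) \<star> v) w \<noteq> 0" by (simp add: supp_def)
    then obtain b c where b: "b \<in> supp (f - ?p)" "c \<in> supp v" "w = b \<otimes> c" "deg w = deg b + deg c" "b \<in> L" "c \<in> L"
      by (rule E_suppE[OF d cl(2)])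
    have "deg a = i" "deg c = j" using a b u v by (auto simp: hom_def)
    then have "deg b = k" using a(4) b(4) z by simp
    then show False using b(1) by (simp add: supp_def part_def)
  qed
  ultimately show ?thesis by simp
qed

text \<open>The value of \<open>u f v\<close> in \<open>E e\<close> at \<open>g\<close> depends only
  on the part of \<open>f'\<close> in degree \<open>k\<close>, since degrees add. A coboundary would
  vanish there, so one nonzero coefficient decides the matter.\<close>

lemma not_cobound:
  assumes e: "e * e = 1" and r: "realises e f f'" and u: "hom u i" and v: "hom v j" and k: "i + k + j = 0"
    and g: "g \<in> L" "deg g = 0" "x \<otimes> g = g \<otimes> x" and ne: "(u \<star> (part k f' \<star> v)) g \<noteq> 0"
  shows "u \<star> (f \<star> v) \<notin> cobound"
proof
  interpret P: ore_pair D "MN_mult G" one S "E e" by (rule ore_pair_E[OF e])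
  assume "u \<star> (f \<star> v) \<in> cobound"
  then obtain c where c: "u \<star> (f \<star> v) = c - cj x c" "c \<in> D.frac" unfolding cobound_def by blast
  have "P.realises (u \<star> (f \<star> v)) (u \<star> (f' \<star> v))"
    by (intro P.realises_mult r P.realises_S hom_S[OF u] hom_S[OF v])
  then have "(u \<star> (f' \<star> v)) g = 0" using coboundary_vanishes[OF e c(2) _ L_G[OF g(1)] g(3)] c(1) by simp
  moreover have "f' \<in> E e" using P.realises_D(2)[OF r] .
  ultimately show False using part_sandwich[OF e u v, of f' g k] g(2) k ne by simp
qed

text \<open>The expansion starts in degree zero, and its degree zero part is the scalar
  \<open>c\<close>. Such expansions multiply like power series in one variable, with constant terms
  multiplying.\<close>

definition low :: "int \<Rightarrow> ('g \<Rightarrow> 'k) \<Rightarrow> 'k \<Rightarrow> bool" where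
  "low e f c \<longleftrightarrow> f \<in> E e \<and> (\<forall>z\<in>supp f. e * deg z \<ge> 0) \<and> part 0 f = single \<one> c"

lemma low_mult:
  assumes e: "e * e = 1" and f: "low e f c" and g: "low e g d" shows "low e (f \<star> g) (c * d)"
proof -
  interpret E: div_ring "E e" "MN_mult G" one by (rule div_ring_E[OF e])
  have e0: "e \<noteq> 0" using e by auto
  have cl: "f \<in> E e" "g \<in> E e" using f g by (auto simp: low_def)
  have s1: "single \<one> c \<in> E e" using S_E[OF S_single e] by simp
  have pos: "e * deg z \<ge> 0" if "z \<in> supp (f \<star> g)" for z
  proof -
    have "(f \<star> g) z \<noteq> 0" using that by (simp add: supp_def)
    then obtain a b where "a \<in> supp f" "b \<in> supp g" "z = a \<otimes> b" "deg z = deg a + deg b" "a \<in> L" "b \<in> L"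
      by (rule E_suppE[OF cl])
    then show ?thesis using f g by (simp add: low_def distrib_left)
  qed
  have "part 0 (f \<star> g) z = single \<one> (c * d) z" for z
  proof (cases "deg z = 0 \<and> z \<in> L")
    case True
    \<comment> \<open>What remains of \<open>f\<close> beyond its constant term has only degrees
      that are strictly positive in the direction \<open>e\<close>, so it cannot contribute in
      degree zero.\<close>
    let ?r = "f - single \<one> c"
    have "(?r \<star> g) z = 0"
    proof (rule ccontr)
      assume "(?r \<star> g) z \<noteq> 0"
      then obtain a b where ab: "a \<in> supp ?r" "b \<in> supp g" "deg z = deg a + deg b" "z = a \<otimes> b" "a \<in> L" "b \<in> L"
        by (rule E_suppE[OF E.diff_closed[OF cl(1) s1] cl(2)])
      have "deg a \<noteq> 0"
      proof
        assume "deg a = 0"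
        then have "f a = part 0 f a" by (simp add: part_def)
        then have "f a = single \<one> c a" using f by (simp add: low_def)
        then show False using ab(1) by (simp add: supp_def)
      qed
      moreover have "a \<in> supp f \<or> a = \<one>" using ab(1) supp_diff_subset[of f "single \<one> c"] supp_single_subset[of \<one> c] by blast
      ultimately have "e * deg a > 0" using f e0 by (force simp: low_def order_less_le)
      moreover have "e * deg b \<ge> 0" using g ab by (simp add: low_def)
      ultimately show False using ab(3) True by (metis add_pos_nonneg distrib_left less_irrefl mult_zero_right)
    qed
    moreover have "f \<star> g = single \<one> c \<star> g + ?r \<star> g" using cl s1 by (simp add: E.diffr)
    moreover have "single \<one> c \<star> g = (\<lambda>y. if y \<in> L then c * g y else 0)"
      using ordered_grp.single_mult[OF ordered_grp_ltd[OF e], of g \<one> c] cl(2)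
      by (simp add: fun_eq_iff m_inv_consistent[OF L_sub])
    moreover have "g z = part 0 g z" using True by (simp add: part_def)
    then have "g z = single \<one> d z" using g by (simp add: low_def)
    ultimately show ?thesis using True by (simp add: part_def single_apply)
  next
    case False
    then show ?thesis using E.mult_closed[OF cl] by (auto simp: part_def single_apply MN_series_def supp_def)
  qed
  then show ?thesis using pos E.mult_closed[OF cl] unfolding low_def by blast
qed

lemma low_uminus: "low e f c \<Longrightarrow> low e (- f) (- c)"
proof -
  have "part 0 (- f) = - part 0 f" "single \<one> (- c) = - single \<one> c"
    by (auto simp: part_def single_def fun_eq_iff)
  then show "low e f c \<Longrightarrow> low e (- f) (- c)" by (simp add: low_def MN_series_def)
qed

lemma low_one: "e * e = 1 \<Longrightarrow> low e one 1"
  using S_E[OF S_single, of \<one> e 1] by (auto simp: low_def supp_def single_apply part_def fun_eq_iff)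

end

section \<open>Cayley transforms and their expansions\<close>

context graded
begin

lemma GL_pow: "h \<in> L \<Longrightarrow> h [^]\<^bsub>GL\<^esub> (n::nat) = h [^] n"
  using nat_pow_consistent by simp

lemma deg_pow: "h \<in> L \<Longrightarrow> h [^] (n::nat) \<in> L \<and> deg (h [^] n) = int n * deg h"
  by (induction n) (auto simp: deg_mult algebra_simps)

definition quot :: "'k \<Rightarrow> 'g \<Rightarrow> 'g \<Rightarrow> 'k" where "quot \<epsilon> h = D.rinv (one - single h \<epsilon>)"

text \<open>The Cayley transform
  \<open>(1 + \<epsilon> h)(1 - \<epsilon> h)\<^sup>-\<^sup>1\<close>, by \<open>cayley_eq\<close>.
  It suits the letters because the family is closed under inverses, \<open>\<epsilon>\<close>
  becoming \<open>- \<epsilon>\<close>, and because replacing \<open>h\<close> by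
  \<open>inv h\<close> only changes the sign when
  \<open>\<epsilon> * \<epsilon> = 1\<close>.\<close>

definition cayley :: "'k \<Rightarrow> 'g \<Rightarrow> 'g \<Rightarrow> 'k" where "cayley \<epsilon> h = quot \<epsilon> h + quot \<epsilon> h - one"

lemma one_minus_single:
  assumes "h \<in> L" "h \<noteq> \<one>" shows "one - single h \<epsilon> \<in> S" "one - single h \<epsilon> \<noteq> (0 :: 'g \<Rightarrow> 'k)"
proof -
  have "(one - single h \<epsilon>) \<one> \<noteq> 0" using assms by (simp add: single_apply)
  then show "one - single h \<epsilon> \<noteq> 0" by (metis zero_fun_apply)
qed (use assms S_diff S_single in auto)

lemma quot:
  assumes "h \<in> L" "h \<noteq> \<one>"
  shows quot_frac: "quot \<epsilon> h \<in> D.frac" and quot_right: "(one - single h \<epsilon>) \<star> quot \<epsilon> h = one"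
    and quot_left: "quot \<epsilon> h \<star> (one - single h \<epsilon>) = one"
  unfolding quot_def using one_minus_single[OF assms] D.frac_S D.frac_rinv D.rinv by auto

lemma quot_D: "h \<in> L \<Longrightarrow> h \<noteq> \<one> \<Longrightarrow> quot \<epsilon> h \<in> D"
  using quot_frac D.frac_D by blast

lemma cayley_eq:
  assumes h: "h \<in> L" "h \<noteq> \<one>"
  shows "(one + single h \<epsilon>) \<star> quot \<epsilon> h = cayley \<epsilon> h" "quot \<epsilon> h \<star> (one + single h \<epsilon>) = cayley \<epsilon> h"
proof -
  have cl: "quot \<epsilon> h \<in> D" "single h \<epsilon> \<in> D" using quot_D[OF h] S_single h by auto
  have "quot \<epsilon> h - single h \<epsilon> \<star> quot \<epsilon> h = one" using quot_right[OF h, of \<epsilon>] cl by (simp add: D.diffr)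
  then have "single h \<epsilon> \<star> quot \<epsilon> h = quot \<epsilon> h - one" by (metis diff_diff_eq2 add_diff_cancel_left')
  then show "(one + single h \<epsilon>) \<star> quot \<epsilon> h = cayley \<epsilon> h"
    unfolding cayley_def using cl by (simp add: D.distr add_diff_eq)
  have "quot \<epsilon> h - quot \<epsilon> h \<star> single h \<epsilon> = one" using quot_left[OF h, of \<epsilon>] cl by (simp add: D.diffl)
  then have "quot \<epsilon> h \<star> single h \<epsilon> = quot \<epsilon> h - one" by (metis diff_diff_eq2 add_diff_cancel_left')
  then show "quot \<epsilon> h \<star> (one + single h \<epsilon>) = cayley \<epsilon> h"
    unfolding cayley_def using cl by (simp add: D.distl add_diff_eq)
qed

lemma cayley_frac: "h \<in> L \<Longrightarrow> h \<noteq> \<one> \<Longrightarrow> cayley \<epsilon> h \<in> D.frac"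
  unfolding cayley_def using quot_frac D.frac_add D.frac_uminus D.frac_S[OF S_single, of \<one>]
  by (metis diff_conv_add_uminus L_closed(3))

lemma cayley_inverse:
  assumes h: "h \<in> L" "h \<noteq> \<one>" shows "cayley \<epsilon> h \<star> cayley (- \<epsilon>) h = one"
proof -
  have m: "single h (- \<epsilon>) = - single h \<epsilon>" by (auto simp: single_def fun_eq_iff)
  have cl: "quot \<epsilon> h \<in> D" "quot (- \<epsilon>) h \<in> D" "single h \<epsilon> \<in> D" using quot_D[OF h] S_single h by auto
  have "cayley \<epsilon> h \<star> cayley (- \<epsilon>) h = ((one + single h \<epsilon>) \<star> quot \<epsilon> h) \<star> ((one - single h \<epsilon>) \<star> quot (- \<epsilon>) h)"
    using cayley_eq(1)[OF h, of \<epsilon>] cayley_eq(1)[OF h, of "- \<epsilon>"] m by simp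
  also have "\<dots> = (one + single h \<epsilon>) \<star> ((quot \<epsilon> h \<star> (one - single h \<epsilon>)) \<star> quot (- \<epsilon>) h)"
    using cl by (simp add: D.assoc)
  also have "\<dots> = (one - single h (- \<epsilon>)) \<star> quot (- \<epsilon>) h" using quot_left[OF h] cl m by simp
  also have "\<dots> = one" using quot_right[OF h] by simp
  finally show ?thesis .
qed

lemma cayley_nonzero: "h \<in> L \<Longrightarrow> h \<noteq> \<one> \<Longrightarrow> cayley \<epsilon> h \<noteq> 0"
  using cayley_inverse[of h \<epsilon>] cayley_frac[of h "- \<epsilon>"] D.frac_D by force

lemma rinv_cayley:
  assumes h: "h \<in> L" "h \<noteq> \<one>" shows "A.rinv (cayley \<epsilon> h) = cayley (- \<epsilon>) h"
  using cayley_inverse[OF h] cayley_frac[OF h] by (intro A.rinv_unique) simp_all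

text \<open>The identity \<open>(1 - \<epsilon> h\<^sup>-\<^sup>1)\<^sup>-\<^sup>1 = 1 - (1 -
  \<epsilon> h)\<^sup>-\<^sup>1\<close> holds for \<open>\<epsilon> * \<epsilon> = 1\<close>;
  doubling it and subtracting \<open>one\<close> changes the sign.\<close>

lemma cayley_inv:
  assumes h: "h \<in> L" "h \<noteq> \<one>" and \<epsilon>: "\<epsilon> * \<epsilon> = 1"
  shows "cayley \<epsilon> (inv h) = - cayley \<epsilon> h"
proof -
  let ?q = "quot \<epsilon> h" and ?i = "single (inv h) \<epsilon>"
  have cl: "?q \<in> D" "?i \<in> D" "single h \<epsilon> \<in> D" using quot_D[OF h] S_single h by auto
  have q: "?q - single h \<epsilon> \<star> ?q = one" using quot_right[OF h, of \<epsilon>] cl by (simp add: D.diffr)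
  have "?i \<star> ?q - ?i \<star> (single h \<epsilon> \<star> ?q) = ?i" using arg_cong[OF q, of "\<lambda>z. ?i \<star> z"] cl by (simp add: D.diffl)
  moreover have "?i \<star> (single h \<epsilon> \<star> ?q) = ?q"
    using cl h \<epsilon> by (simp add: D.assoc[symmetric])
  ultimately have "?i \<star> ?q = ?q + ?i" by (simp add: algebra_simps)
  then have "(one - ?i) \<star> (one - ?q) = one" using cl by (simp add: D.diffl D.diffr)
  then have "quot \<epsilon> (inv h) = one - ?q"
    unfolding quot_def[of \<epsilon> "inv h"] using cl by (intro D.rinv_unique) simp_all
  then show ?thesis by (simp add: cayley_def)
qed

text \<open>If the degree of \<open>h\<close> is positive in the direction \<open>e\<close>, then
  \<open>h\<close> exceeds \<open>\<one>\<close> for \<open>ltd e\<close>, and the value in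
  \<open>E e\<close> is the geometric series. Its parts in degrees \<open>0\<close> and
  \<open>deg h\<close> can be read off.\<close>

lemma quot_realises:
  assumes e: "e * e = 1" and h: "h \<in> L" "e * deg h > 0"
  obtains f where "realises e (quot \<epsilon> h) f" "low e f 1" "part (deg h) f = single h \<epsilon>"
proof -
  interpret P: ore_pair D "MN_mult G" one S "E e" by (rule ore_pair_E[OF e])
  interpret Ge: ordered_grp GL "ltd e" by (rule ordered_grp_ltd[OF e])
  let ?f = "Ge.geo \<epsilon> h"
  have h1: "h \<noteq> \<one>" using h by auto
  have hG: "h \<in> carrier GL" "ltd e \<one>\<^bsub>GL\<^esub> h" using h by (auto simp: ltd_def)
  have f: "?f \<in> E e" by (rule Ge.geo_MN[OF hG])
  have pow: "?f (h [^] n) = \<epsilon> ^ n" for n :: nat using Ge.geo_pow[OF hG, of \<epsilon> n] GL_pow[OF h(1)] by simp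
  have supp: "\<exists>n::nat. z = h [^] n" if z: "z \<in> supp ?f" for z
  proof -
    have "?f z \<noteq> 0" using z by (simp add: supp_def)
    then obtain n :: nat where "z = h [^]\<^bsub>GL\<^esub> n" by (rule Ge.geo_nonzeroE)
    then show ?thesis using GL_pow[OF h(1)] by blast
  qed
  have d: "deg h \<noteq> 0" using h by auto
  have "P.realises (one - single h \<epsilon>) (one - single h \<epsilon>)"
    using P.realises_S one_minus_single[OF h(1) h1] by blast
  then have "P.realises (quot \<epsilon> h) (P.E.rinv (one - single h \<epsilon>))"
    unfolding quot_def by (rule P.realises_rinv[OF _ one_minus_single(2)[OF h(1) h1]])
  moreover have "P.E.rinv (one - single h \<epsilon>) = ?f"
    using Ge.geo_inverse[OF hG, of \<epsilon>] f P.S_E' one_minus_single[OF h(1) h1] by (intro P.E.rinv_unique) simp_all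
  ultimately have "P.realises (quot \<epsilon> h) ?f" by simp
  moreover have "part 0 ?f = one"
  proof
    fix z show "part 0 ?f z = one z"
    proof (cases "deg z = 0 \<and> ?f z \<noteq> 0")
      case True
      then obtain n :: nat where n: "z = h [^] n" using supp by (auto simp: supp_def)
      then have "n = 0" using True deg_pow[OF h(1), of n] d by simp
      then show ?thesis using n pow[of 0] by (simp add: part_def single_apply)
    next
      case False
      then have "z \<noteq> \<one>" using pow[of 0] by auto
      then show ?thesis using False by (auto simp: part_def single_apply)
    qed
  qed
  moreover have "part (deg h) ?f = single h \<epsilon>"
  proof
    fix z show "part (deg h) ?f z = single h \<epsilon> z"
    proof (cases "deg z = deg h \<and> ?f z \<noteq> 0")
      case True
      then obtain n :: nat where n: "z = h [^] n" using supp by (auto simp: supp_def)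
      then have "int n * deg h = deg h" using True deg_pow[OF h(1), of n] by simp
      then have "n = 1" using d by simp
      then show ?thesis using n pow[of 1] h by (simp add: part_def single_apply)
    next
      case False
      have "?f h = \<epsilon>" using pow[of 1] h by simp
      then show ?thesis using False by (auto simp: part_def single_apply)
    qed
  qed
  moreover have "e * deg z \<ge> 0" if z: "z \<in> supp ?f" for z
  proof -
    obtain n :: nat where n: "z = h [^] n" using supp[OF z] by blast
    then have "e * deg z = int n * (e * deg h)" using deg_pow[OF h(1), of n] by simp
    also have "\<dots> \<ge> 0" by (rule mult_nonneg_nonneg[of "int n" "e * deg h"]) (use h(2) in auto)
    finally show ?thesis .
  qed
  ultimately show ?thesis using f that by (auto simp: low_def)
qed

lemma part_add: "part k (f + g) = part k f + part k g" and part_diff: "part k (f - g) = part k f - part k g"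
  by (auto simp: part_def fun_eq_iff)

lemma part_single: "part k (single h c) = (if deg h = k then single h c else 0)"
  by (auto simp: part_def fun_eq_iff single_apply)

lemma cayley_realises:
  assumes e: "e * e = 1" and h: "h \<in> L" "e * deg h > 0"
  obtains f where "realises e (cayley \<epsilon> h) f" "low e f 1" "part (deg h) f = single h (2 * \<epsilon>)"
proof -
  interpret P: ore_pair D "MN_mult G" one S "E e" by (rule ore_pair_E[OF e])
  obtain q where q: "P.realises (quot \<epsilon> h) q" "low e q 1" "part (deg h) q = single h \<epsilon>"
    using quot_realises[OF assms] .
  let ?f = "q + q - one"
  have "P.realises (cayley \<epsilon> h) ?f" unfolding cayley_def
    by (intro P.realises_add P.realises_diff q P.realises_S S_single) simp
  moreover have "deg h \<noteq> 0" using h by auto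
  then have "part (deg h) ?f = single h (2 * \<epsilon>)"
    unfolding part_add part_diff q(3) by (simp add: part_single) (simp add: fun_eq_iff single_apply)
  moreover have "part 0 ?f = single \<one> 1" using q(2) unfolding part_add part_diff low_def by (simp add: part_single)
  moreover have "e * deg z \<ge> 0" if "z \<in> supp ?f" for z
  proof -
    have "z \<in> supp q \<or> z = \<one>" using that by (auto simp: supp_def single_apply split: if_splits)
    then show ?thesis using q(2) by (auto simp: low_def)
  qed
  ultimately show ?thesis using that P.realises_D(2) by (auto simp: low_def)
qed

text \<open>When \<open>h\<close> points against the direction \<open>e\<close>, the expansion is
  that of the transform of \<open>inv h\<close> with opposite sign, so the constant term becomes
  -1.\<close>

lemma cayley_realises':
  assumes e: "e * e = 1" and h: "h \<in> L" "e * deg h < 0" and \<epsilon>: "\<epsilon> * \<epsilon> = 1"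
  obtains f where "realises e (cayley \<epsilon> h) f" "low e f (- 1)"
proof -
  interpret P: ore_pair D "MN_mult G" one S "E e" by (rule ore_pair_E[OF e])
  obtain f where "P.realises (cayley \<epsilon> (inv h)) f" "low e f 1"
    using cayley_realises[OF e, of "inv h"] h by (auto simp: deg_inv)
  moreover have "h \<noteq> \<one>" using h by auto
  ultimately have "P.realises (cayley \<epsilon> h) (- f)" "low e (- f) (- 1)"
    using cayley_inv[OF h(1) _ \<epsilon>] P.realises_uminus low_uminus by (metis minus_minus)+
  then show ?thesis using that by blast
qed

text \<open>Compared with the locale, the products are rebracketed so that a fraction to be expanded
  stands between the differences, which will be homogeneous. This is the form that
  \<open>not_cobound\<close> can test.\<close>

lemma free_letters_graded:
  assumes "lam \<in> D.frac" "lam \<noteq> 0" "lam' \<in> D.frac" "lam' \<noteq> 0" "\<kappa> \<in> D.frac" "\<kappa> \<noteq> 0"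
    and "\<And>i. d i \<in> D.frac" "\<And>i. d i \<noteq> 0" "\<And>i. e i \<in> D.frac" "\<And>i. e i \<noteq> 0"
    and "\<kappa> \<notin> cobound"
    and "(A.rinv lam' - cj (inv x) (A.rinv lam')) \<star> (A.rinv \<kappa> \<star> (A.rinv lam - cj x (A.rinv lam))) \<notin> cobound"
    and "\<And>i j. (lam' - cj (inv x) lam') \<star> ((e j \<star> d i) \<star> (lam - cj x lam)) \<notin> cobound"
    and "\<And>i j. i \<noteq> j \<Longrightarrow> (A.rinv (d j) \<star> d i) \<star> (lam - cj x lam) \<notin> cobound"
    and "\<And>i j. i \<noteq> j \<Longrightarrow> (lam' - cj (inv x) lam') \<star> (e j \<star> A.rinv (e i)) \<notin> cobound"
    and "\<And>i j. A.rinv (d j) \<star> A.rinv (e i) \<notin> cobound"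
  shows "free_letters A (MN_mult G) one D.frac t p (cj x) (cj (inv x)) lam lam' \<kappa> d e"
proof -
  interpret P: pole A "MN_mult G" one D.frac t p "cj x" by (rule pole_graded)
  have A: "d i \<in> A" "e i \<in> A" "lam \<in> A" "cj x lam \<in> A" "A.rinv (d i) \<in> A" for i
    using assms cj_frac[of x] A.rinv_closed by simp_all
  show ?thesis
  proof (unfold_locales, unfold coboundaries_eq)
    show "cj x (a \<star> b) = cj x a \<star> cj x b" if "a \<in> D.frac" "b \<in> D.frac" for a b
      using that by (intro cj_mult D_supp_carrier) simp_all
    show "cj x (cj (inv x) a) = a" if "a \<in> D.frac" for a
      using that by (intro cj_cj D_supp_carrier) simp_all
    show "(lam' - cj (inv x) lam') \<star> (e j \<star> (d i \<star> (lam - cj x lam))) \<notin> cobound" for i j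
      using assms(13)[of j i] A by (simp add: A.assoc)
    show "A.rinv (d j) \<star> (d i \<star> (lam - cj x lam)) \<notin> cobound" if "i \<noteq> j" for i j
      using assms(14)[OF that] A by (simp add: A.assoc)
  qed (use assms cj_add cj_frac in auto)
qed

lemma rinv_single: "g \<in> carrier G \<Longrightarrow> A.rinv (single g 1) = single (inv g) 1"
  by (intro A.rinv_unique) simp_all

lemma single_nonzero: "single g 1 \<noteq> (0 :: 'g \<Rightarrow> 'k)"
  by (auto simp: fun_eq_iff single_apply)

lemma single_frac: "g \<in> L \<Longrightarrow> single g c \<in> D.frac"
  by (intro D.frac_S S_single)

lemma not_cobound_low:
  assumes e: "e * e = 1" and r: "realises e f f'" and f: "low e f' c" "c \<noteq> 0" shows "f \<notin> cobound"
proof -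
  have "(one \<star> (part 0 f' \<star> one)) \<one> \<noteq> 0" using f by (simp add: low_def)  (simp add: single_apply)
  then have "one \<star> (f \<star> one) \<notin> cobound"
    using not_cobound[OF e r hom_single hom_single, of \<one> 0 \<one> 0 0 \<one> 1 1] by simp
  moreover have "f \<in> D" using r ore_pair.realises_D(1)[OF ore_pair_E[OF e]] by blast
  ultimately show ?thesis by simp
qed

lemma scaled_sandwich:
  "u \<in> A \<Longrightarrow> v \<in> A \<Longrightarrow> (u \<star> (single \<one> c \<star> v)) g = c * (u \<star> v) g"
proof -
  assume uv: "u \<in> A" "v \<in> A"
  have "u \<star> single \<one> c = single \<one> c \<star> u" using uv by (auto simp: single_mult mult_single MN_outside fun_eq_iff)
  then have "u \<star> (single \<one> c \<star> v) = single \<one> c \<star> (u \<star> v)"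
    using uv A.assoc[of u "single \<one> c" v] A.assoc[of "single \<one> c" u v] by simp
  then show ?thesis using uv MN_mult[OF uv] MN_outside[OF MN_mult[OF uv], of g] by (simp add: single_mult)
qed

end

section \<open>Verification of the six conditions for two systems of letters\<close>

context graded
begin

lemma hom_A: "hom f i \<Longrightarrow> f \<in> A"
  using hom_S by simp

lemma conj_single:
  "g \<in> L \<Longrightarrow> cj x (single g c) = single (x \<otimes> g \<otimes> inv x) c"
  "g \<in> L \<Longrightarrow> cj (inv x) (single g c) = single (inv x \<otimes> g \<otimes> x) c"
  by (simp_all add: cj_single)

lemma hom_coboundary:
  "g \<in> L \<Longrightarrow> deg g = i \<Longrightarrow> hom (single g 1 - single (x \<otimes> g \<otimes> inv x) 1) i"
  "g \<in> L \<Longrightarrow> deg g = i \<Longrightarrow> hom (single g 1 - single (inv x \<otimes> g \<otimes> x) 1) i"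
  using deg_x deg_x' x_L x_L' by (auto intro!: hom_diff hom_single)

text \<open>The product has a nonzero coefficient at an element of degree zero commuting with
  \<open>x\<close>, that is, at a point where every coboundary vanishes.\<close>

abbreviation pairing :: "('g \<Rightarrow> 'k) \<Rightarrow> ('g \<Rightarrow> 'k) \<Rightarrow> ('g \<Rightarrow> 'k) \<Rightarrow> bool" where "pairing u s v \<equiv> \<exists>g\<in>L. deg g = 0 \<and> x \<otimes> g = g \<otimes> x \<and> (u \<star> (s \<star> v)) g \<noteq> 0"

lemma not_cobound_pairing:
  assumes e: "e * e = 1" and r: "realises e f f'" and u: "hom u i" and v: "hom v j" and k: "i + k + j = 0"
    and s: "part k f' = s" "pairing u s v"
  shows "u \<star> (f \<star> v) \<notin> cobound"
  using not_cobound[OF e r u v k] s by blast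

text \<open>The two systems of letters. For an involution which inverts degrees one uses Cayley
  transforms, for one which preserves degrees linear polynomials; in the second case the middle
  coefficient \<open>\<kappa> = (1 + y\<^sup>-\<^sup>2)\<^sup>-\<^sup>1\<close> is seen only in the completion at infinity.\<close>

lemma free_letters_reversing:
  fixes nu nu' mu mu' :: "'g \<Rightarrow> 'k"
  assumes two: "(2::'k) \<noteq> 0"
    and y: "y \<in> L" "deg y = 1" and y': "y' \<in> L" "deg y' = - 1" and l: "l \<in> L" "deg l = 1"
    and nu: "nu = single (inv y) 1 - single (x \<otimes> inv y \<otimes> inv x) 1"
    and nu': "nu' = single l 1 - single (inv x \<otimes> l \<otimes> x) 1"
    and mu: "mu = single y 1 - single (x \<otimes> y \<otimes> inv x) 1"
    and mu': "mu' = single (inv l) 1 - single (inv x \<otimes> inv l \<otimes> x) 1"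
    and c1: "pairing nu' one nu" and c2: "pairing (single y 1) one nu"
    and c3: "pairing nu' one (single y' 1)" and c4: "pairing mu' one mu"
  shows "free_letters A (MN_mult G) one D.frac t p (cj x) (cj (inv x)) (single (inv y) 1) (single l 1) one
    (\<lambda>i. if i then cayley 1 y else one) (\<lambda>i. if i then cayley 1 y' else one)"
proof -
  have ne: "y \<noteq> \<one>" "y' \<noteq> \<one>" using y y' by auto
  have sq: "(1::int) * 1 = 1" "(-1::int) * (-1) = 1" by simp_all
  let ?d = "\<lambda>i. if i then cayley 1 y else one" and ?e = "\<lambda>i. if i then cayley 1 y' else one"
  interpret P: ore_pair D "MN_mult G" one S "E 1" by (rule ore_pair_E) simp
  interpret N: ore_pair D "MN_mult G" one S "E (-1)" by (rule ore_pair_E) simp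
  have hnu: "hom nu (-1)" unfolding nu using y by (intro hom_coboundary) (auto simp: deg_inv)
  have hnu': "hom nu' 1" unfolding nu' using l by (intro hom_coboundary) auto
  have hmu: "hom mu 1" unfolding mu using y by (intro hom_coboundary) auto
  have hmu': "hom mu' (-1)" unfolding mu' using l by (intro hom_coboundary) (auto simp: deg_inv)
  have h1: "hom one 0" by (intro hom_single) auto
  note MA = hom_A[OF hnu] hom_A[OF hnu'] hom_A[OF hmu] hom_A[OF hmu']
  have r1: "P.realises one one" by (rule P.realises_S[OF S_single]) simp
  have l1: "low 1 one 1" by (rule low_one) simp
  have "\<exists>f. P.realises (cayley \<epsilon> y) f \<and> low 1 f 1" for \<epsilon>
    by (rule cayley_realises[OF sq(1) y(1), of \<epsilon>]) (use y(2) in auto)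
  then have lowd: "\<exists>f. P.realises (?d i) f \<and> low 1 f 1" and lowd': "\<exists>f. P.realises (A.rinv (?d i)) f \<and> low 1 f 1" for i
    using r1 l1 rinv_cayley[OF y(1) ne(1), of 1] by (cases i; force)+
  \<comment> \<open>As \<open>y'\<close> has degree -1, it is expanded in \<open>E 1\<close> through
    its inverse, with constant term -1. Only the nonvanishing of the constant is used below.\<close>
  have "\<exists>f. P.realises (cayley \<epsilon> y') f \<and> low 1 f (- 1)" if "\<epsilon> * \<epsilon> = 1" for \<epsilon>
    by (rule cayley_realises'[OF sq(1) y'(1) _ that]) (use y'(2) in auto)
  from this[of 1] this[of "- 1"]
  have lowe: "\<exists>f c. P.realises (?e i) f \<and> low 1 f c \<and> c \<noteq> 0" and lowe': "\<exists>f c. P.realises (A.rinv (?e i)) f \<and> low 1 f c \<and> c \<noteq> 0" for i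
    using r1 l1 rinv_cayley[OF y'(1) ne(2), of 1] by (cases i; force)+
  have low_prod: "\<exists>f c. P.realises (a \<star> b) f \<and> low 1 f c \<and> c \<noteq> 0"
    if "\<exists>f c. P.realises a f \<and> low 1 f c \<and> c \<noteq> 0" "\<exists>f c. P.realises b f \<and> low 1 f c \<and> c \<noteq> 0" for a b
    using that P.realises_mult low_mult[OF sq(1)] by (metis no_zero_divisors)
  have scaled: "pairing u (single \<one> c) v" if "pairing u one v" "c \<noteq> 0" "u \<in> A" "v \<in> A" for u v c
    using that scaled_sandwich[OF that(3,4), of c] scaled_sandwich[OF that(3,4), of 1] by auto
  show ?thesis
  proof (rule free_letters_graded)
    have lam: "A.rinv (single (inv y) 1) = single y 1" "A.rinv (single l 1) = single (inv l) 1"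
      using y l by (simp_all add: rinv_single)
    have nus: "single (inv y) 1 - cj x (single (inv y) 1) = nu" "single l 1 - cj (inv x) (single l 1) = nu'"
      "single y 1 - cj x (single y 1) = mu" "single (inv l) 1 - cj (inv x) (single (inv l) 1) = mu'"
      using y l by (simp_all add: nu nu' mu mu' conj_single)
    show "one \<notin> cobound" using not_cobound_low[OF sq(1) P.realises_S[OF S_single] low_one] by simp
    show "(A.rinv (single l 1) - cj (inv x) (A.rinv (single l 1))) \<star>
        (A.rinv one \<star> (A.rinv (single (inv y) 1) - cj x (A.rinv (single (inv y) 1)))) \<notin> cobound"
      unfolding lam nus A.rinv_one
      by (rule not_cobound_pairing[OF sq(1) P.realises_S[OF S_single] hmu' hmu, of \<one> 0]) (use c4 in \<open>auto simp: part_single\<close>)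
    show "(single l 1 - cj (inv x) (single l 1)) \<star> (?e j \<star> ?d i \<star> (single (inv y) 1 - cj x (single (inv y) 1))) \<notin> cobound" for i j
    proof -
      obtain f c where f: "P.realises (?e j \<star> ?d i) f" "low 1 f c" "c \<noteq> 0"
        using low_prod[OF lowe[of j]] lowd[of i] by (metis one_neq_zero)
      have "pairing nu' (single \<one> c) nu" using scaled[OF c1 f(3) MA(2,1)] .
      then show ?thesis unfolding nus
        using not_cobound_pairing[OF sq(1) f(1) hnu' hnu, of 0 "single \<one> c"] f(2) by (simp add: low_def)
    qed
    show "A.rinv (?d j) \<star> A.rinv (?e i) \<notin> cobound" for i j
    proof -
      obtain f c where f: "P.realises (A.rinv (?d j) \<star> A.rinv (?e i)) f" "low 1 f c" "c \<noteq> 0"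
        using low_prod[OF _ lowe'[of i]] lowd'[of j] by (metis one_neq_zero)
      then show ?thesis using not_cobound_low[OF sq(1)] by blast
    qed
    show "A.rinv (?d j) \<star> ?d i \<star> (single (inv y) 1 - cj x (single (inv y) 1)) \<notin> cobound" if ij: "i \<noteq> j" for i j
    proof -
      \<comment> \<open>One of the two coefficients is \<open>one\<close>, so the quotient is a
        Cayley transform or its inverse. The constant term does not help in this condition; the
        linear part \<open>2 \<epsilon> y\<close> supplies the degree that \<open>nu\<close> lacks,
        and is nonzero outside characteristic two.\<close>
      let ?s = "if i then 1 else (- 1)"
      have eq: "A.rinv (?d j) \<star> ?d i = cayley ?s y"
        using ij rinv_cayley[OF y(1) ne(1), of 1] cayley_frac[OF y(1) ne(1)] by (cases i) auto
      obtain \<epsilon> where eps: "A.rinv (?d j) \<star> ?d i = cayley \<epsilon> y" "\<epsilon> * \<epsilon> = 1"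
        by (rule that[OF eq]) simp
      obtain f where f: "P.realises (cayley \<epsilon> y) f" "part (deg y) f = single y (2 * \<epsilon>)"
        using cayley_realises[OF sq(1) y(1), of \<epsilon>] y(2) by auto
      have eps0: "2 * \<epsilon> \<noteq> 0" using two eps by auto
      have "(single y (2 * \<epsilon>) \<star> nu) g = 2 * \<epsilon> * (single y 1 \<star> nu) g" for g
        using y MA(1) by (simp add: single_mult)
      then have "(one \<star> (single y (2 * \<epsilon>) \<star> nu)) g = 2 * \<epsilon> * (single y 1 \<star> (one \<star> nu)) g" for g
        using y MA(1) by simp
      then have "pairing one (single y (2 * \<epsilon>)) nu" using c2 eps0 by auto
      then have "one \<star> (cayley \<epsilon> y \<star> nu) \<notin> cobound"
        using not_cobound_pairing[OF sq(1) f(1) h1 hnu, of 1 "single y (2 * \<epsilon>)"] f(2) y(2) by simp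
      then show ?thesis unfolding nus eps using MA(1) cayley_frac[OF y(1) ne(1), of \<epsilon>] by simp
    qed
    show "(single l 1 - cj (inv x) (single l 1)) \<star> (?e j \<star> A.rinv (?e i)) \<notin> cobound" if ij: "i \<noteq> j" for i j
    proof -
      let ?s = "if i then (- 1) else 1"
      have eq: "?e j \<star> A.rinv (?e i) = cayley ?s y'"
        using ij rinv_cayley[OF y'(1) ne(2), of 1] cayley_frac[OF y'(1) ne(2)] by (cases i) auto
      obtain \<epsilon> where eps: "?e j \<star> A.rinv (?e i) = cayley \<epsilon> y'" "\<epsilon> * \<epsilon> = 1"
        by (rule that[OF eq]) simp
      \<comment> \<open>The linear term in \<open>y'\<close> has degree -1 and is visible only in
        \<open>E (-1)\<close>; the expansion in \<open>E 1\<close> has no negative degrees.\<close>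
      obtain f where f: "N.realises (cayley \<epsilon> y') f" "part (deg y') f = single y' (2 * \<epsilon>)"
        using cayley_realises[OF sq(2) y'(1), of \<epsilon>] y'(2) by auto
      have eps0: "2 * \<epsilon> \<noteq> 0" using two eps by auto
      have "pairing nu' (single \<one> (2 * \<epsilon>)) (single y' 1)"
        using scaled[OF c3 eps0 MA(2)] y' by simp
      then have "pairing nu' (single y' (2 * \<epsilon>)) one" using y' by simp
      then have "nu' \<star> (cayley \<epsilon> y' \<star> one) \<notin> cobound"
        using not_cobound_pairing[OF sq(2) f(1) hnu' h1, of "-1" "single y' (2 * \<epsilon>)"] f(2) y'(2) by simp
      then show ?thesis unfolding nus eps using cayley_frac[OF y'(1) ne(2), of \<epsilon>] by simp
    qed
  qed (use y l y' ne single_frac single_nonzero cayley_frac cayley_nonzero in auto)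
qed

lemma free_letters_preserving:
  fixes nu nu' mu mu' :: "'g \<Rightarrow> 'k"
  assumes two: "(2::'k) \<noteq> 0"
    and y: "y \<in> L" "deg y = 1"
    and nu: "nu = single (inv y) 1 - single (x \<otimes> inv y \<otimes> inv x) 1"
    and nu': "nu' = single (inv y) 1 - single (inv x \<otimes> inv y \<otimes> x) 1"
    and mu: "mu = single y 1 - single (x \<otimes> y \<otimes> inv x) 1"
    and mu': "mu' = single y 1 - single (inv x \<otimes> y \<otimes> x) 1"
    and c1: "pairing nu' (single (y \<otimes> y) 1) nu" and c2: "pairing (single y 1) one nu"
    and c3: "pairing nu' one (single y 1)" and c4: "pairing mu' (single (inv y \<otimes> inv y) 1) mu"
  shows "free_letters A (MN_mult G) one D.frac t p (cj x) (cj (inv x)) (single (inv y) 1) (single (inv y) 1)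
    (quot (- 1) (inv y \<otimes> inv y)) (\<lambda>i. one + single y (if i then 1 else - 1)) (\<lambda>i. one + single y (if i then 1 else - 1))"
proof -
  define \<sigma> :: "bool \<Rightarrow> 'k" where "\<sigma> i = (if i then 1 else - 1)" for i
  \<comment> \<open>Here both outer differences have the same degree, so the middle factor must
    compensate by two. For \<open>nu'\<close> and \<open>nu\<close>, of degree -1, this is the term
    in \<open>y \<otimes> y\<close> of \<open>?d j \<star> ?d i\<close>; for \<open>mu'\<close> and
    \<open>mu\<close>, of degree 1, it is the term \<open>?h\<close> of the inverse
    \<open>1 + ?h\<close> of the middle coefficient.\<close>
  let ?d = "\<lambda>i. one + single y (\<sigma> i)" and ?h = "inv y \<otimes> inv y"
  have ne: "y \<noteq> \<one>" using y by auto
  have h: "?h \<in> L" "deg ?h = - 2" using y by (auto simp: deg_mult deg_inv)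
  have hne: "?h \<noteq> \<one>" using h by auto
  have sq: "(1::int) * 1 = 1" "(-1::int) * (-1) = 1" by simp_all
  have \<sigma>: "\<sigma> i * \<sigma> i = 1" "\<sigma> i \<noteq> 0" "i \<noteq> j \<Longrightarrow> \<sigma> j = - \<sigma> i" for i j by (auto simp: \<sigma>_def)
  interpret P: ore_pair D "MN_mult G" one S "E 1" by (rule ore_pair_E) simp
  interpret N: ore_pair D "MN_mult G" one S "E (-1)" by (rule ore_pair_E) simp
  have hnu: "hom nu (-1)" unfolding nu using y by (intro hom_coboundary) (auto simp: deg_inv)
  have hnu': "hom nu' (-1)" unfolding nu' using y by (intro hom_coboundary) (auto simp: deg_inv)
  have hmu: "hom mu 1" unfolding mu using y by (intro hom_coboundary) auto
  have hmu': "hom mu' 1" unfolding mu' using y by (intro hom_coboundary) auto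
  have h1: "hom one 0" by (intro hom_single) auto
  note MA = hom_A[OF hnu] hom_A[OF hnu'] hom_A[OF hmu] hom_A[OF hmu']
  have neg: "single z (- c) = - single z c" for z and c :: 'k by (auto simp: single_def fun_eq_iff)
  have dS: "?d i \<in> S" for i using S_add S_single y by auto
  have dne: "?d i \<noteq> 0" for i using one_minus_single(2)[OF y(1) ne, of "- \<sigma> i"] by (simp add: neg)
  have rd: "A.rinv (?d i) = quot (- \<sigma> i) y" for i
    using rinv_D_A[OF S_D[OF dS] dne] by (simp add: quot_def neg)
  have scaled: "pairing u (single \<one> c) v" if "pairing u one v" "c \<noteq> 0" "u \<in> A" "v \<in> A" for u v c
    using that scaled_sandwich[OF that(3,4), of c] scaled_sandwich[OF that(3,4), of 1] by auto
  show ?thesis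
    unfolding \<sigma>_def[symmetric]
  proof (rule free_letters_graded)
    have lam: "A.rinv (single (inv y) 1) = single y 1" using y by (simp add: rinv_single)
    have nus: "single (inv y) 1 - cj x (single (inv y) 1) = nu" "single (inv y) 1 - cj (inv x) (single (inv y) 1) = nu'"
      "single y 1 - cj x (single y 1) = mu" "single y 1 - cj (inv x) (single y 1) = mu'"
      using y by (simp_all add: nu nu' mu mu' conj_single)
    have kap: "A.rinv (quot (- 1) ?h) = one + single ?h 1"
      using quot_left[OF h(1) hne, of "- 1"] quot_D[OF h(1) hne] S_single[OF h(1)]
      by (intro A.rinv_unique) (simp_all add: neg)
    show "quot (- 1) ?h \<notin> cobound"
    proof -
      \<comment> \<open>In \<open>E (-1)\<close> this is \<open>1 - y\<^sup>-\<^sup>2 + ...\<close>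
        with constant term 1, while in \<open>E 1\<close> it is \<open>y\<^sup>2 - ...\<close> and
        its constant term vanishes.\<close>
      obtain f where f: "N.realises (quot (- 1) ?h) f" "low (- 1) f 1"
        by (rule quot_realises[OF sq(2) h(1)]) (use h in auto)
      then show ?thesis using not_cobound_low[OF sq(2)] by force
    qed
    show "(A.rinv (single (inv y) 1) - cj (inv x) (A.rinv (single (inv y) 1))) \<star>
        (A.rinv (quot (- 1) ?h) \<star> (A.rinv (single (inv y) 1) - cj x (A.rinv (single (inv y) 1)))) \<notin> cobound"
      unfolding lam nus kap
    proof (rule not_cobound_pairing[OF sq(1) P.realises_S hmu' hmu])
      show "one + single ?h 1 \<in> S" using S_add S_single h by auto
      show "part (- 2) (one + single ?h 1) = single ?h 1" using h by (simp add: part_add part_single)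
    qed (use c4 in auto)
    show "(single (inv y) 1 - cj (inv x) (single (inv y) 1)) \<star> (?d j \<star> ?d i \<star> (single (inv y) 1 - cj x (single (inv y) 1))) \<notin> cobound" for i j
    proof -
      have sD: "single y c \<in> D" for c using S_single y by simp
      have "?d j \<star> ?d i = one + single y (\<sigma> i) + (single y (\<sigma> j) + single (y \<otimes> y) (\<sigma> j * \<sigma> i))"
        using y sD by (simp add: D.distl D.distr)
      then have prt: "part 2 (?d j \<star> ?d i) = single (y \<otimes> y) (\<sigma> j * \<sigma> i)"
        using y by (simp add: part_add part_single deg_mult)
      have "\<sigma> j * \<sigma> i \<noteq> 0" using \<sigma>(2) by simp
      moreover have "nu' \<star> (single (y \<otimes> y) (\<sigma> j * \<sigma> i) \<star> nu) = nu' \<star> (single \<one> (\<sigma> j * \<sigma> i) \<star> (single (y \<otimes> y) 1 \<star> nu))"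
        using A.assoc[of "single \<one> (\<sigma> j * \<sigma> i)" "single (y \<otimes> y) 1" nu] MA y by simp
      ultimately have "pairing nu' (single (y \<otimes> y) (\<sigma> j * \<sigma> i)) nu"
        using c1 scaled_sandwich[OF MA(2), of "single (y \<otimes> y) 1 \<star> nu" "\<sigma> j * \<sigma> i"] MA y by auto
      then show ?thesis unfolding nus
        by (intro not_cobound_pairing[OF sq(1) P.realises_S hnu' hnu _ prt]) (use dS S_mult in auto)
    qed
    show "A.rinv (?d j) \<star> A.rinv (?d i) \<notin> cobound" for i j
    proof -
      obtain f where f: "P.realises (quot (- \<sigma> i) y) f" "low 1 f 1"
        by (rule quot_realises[OF sq(1) y(1)]) (use y in auto)
      obtain g where g: "P.realises (quot (- \<sigma> j) y) g" "low 1 g 1"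
        by (rule quot_realises[OF sq(1) y(1)]) (use y in auto)
      show ?thesis unfolding rd
        using not_cobound_low[OF sq(1) P.realises_mult[OF g(1) f(1)] low_mult[OF sq(1) g(2) f(2)]] by simp
    qed
    show "A.rinv (?d j) \<star> ?d i \<star> (single (inv y) 1 - cj x (single (inv y) 1)) \<notin> cobound" if ij: "i \<noteq> j" for i j
    proof -
      have eq: "A.rinv (?d j) \<star> ?d i = cayley (\<sigma> i) y"
        unfolding rd using \<sigma>(3)[OF ij] cayley_eq(2)[OF y(1) ne] by simp
      obtain f where f: "P.realises (cayley (\<sigma> i) y) f" "part (deg y) f = single y (2 * \<sigma> i)"
        by (rule cayley_realises[OF sq(1) y(1), of "\<sigma> i"]) (use y in auto)
      have eps0: "2 * \<sigma> i \<noteq> 0" using two \<sigma>(2) by auto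
      have "(single y (2 * \<sigma> i) \<star> nu) g = 2 * \<sigma> i * (single y 1 \<star> nu) g" for g
        using y MA(1) by (simp add: single_mult)
      then have "(one \<star> (single y (2 * \<sigma> i) \<star> nu)) g = 2 * \<sigma> i * (single y 1 \<star> (one \<star> nu)) g" for g
        using y MA(1) by simp
      then have "pairing one (single y (2 * \<sigma> i)) nu" using c2 eps0 by auto
      then have "one \<star> (cayley (\<sigma> i) y \<star> nu) \<notin> cobound"
        using not_cobound_pairing[OF sq(1) f(1) h1 hnu, of 1 "single y (2 * \<sigma> i)"] f(2) y(2) by simp
      then show ?thesis unfolding nus eq using MA(1) cayley_frac[OF y(1) ne, of "\<sigma> i"] by simp
    qed
    show "(single (inv y) 1 - cj (inv x) (single (inv y) 1)) \<star> (?d j \<star> A.rinv (?d i)) \<notin> cobound" if ij: "i \<noteq> j" for i j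
    proof -
      have eq: "?d j \<star> A.rinv (?d i) = cayley (\<sigma> j) y"
        unfolding rd using \<sigma>(3)[OF ij] cayley_eq(1)[OF y(1) ne] by simp
      obtain f where f: "P.realises (cayley (\<sigma> j) y) f" "part (deg y) f = single y (2 * \<sigma> j)"
        by (rule cayley_realises[OF sq(1) y(1), of "\<sigma> j"]) (use y in auto)
      have eps0: "2 * \<sigma> j \<noteq> 0" using two \<sigma>(2) by auto
      have "pairing nu' (single \<one> (2 * \<sigma> j)) (single y 1)"
        using scaled[OF c3 eps0 MA(2)] y by simp
      then have "pairing nu' (single y (2 * \<sigma> j)) one" using y by simp
      then have "nu' \<star> (cayley (\<sigma> j) y \<star> one) \<notin> cobound"
        using not_cobound_pairing[OF sq(1) f(1) hnu' h1, of 1 "single y (2 * \<sigma> j)"] f(2) y(2) by simp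
      then show ?thesis unfolding nus eq using cayley_frac[OF y(1) ne, of "\<sigma> j"] by simp
    qed
    show "quot (- 1) ?h \<noteq> 0" using quot_left[OF h(1) hne, of "- 1"] one_minus_single(1)[OF h(1) hne] by force
  qed (use y h hne single_frac single_nonzero quot_frac dS dne D.frac_S in auto)
qed

end

section \<open>Heisenberg pairs\<close>

context group
begin

definition commutator :: "'a \<Rightarrow> 'a \<Rightarrow> 'a" where "commutator g h = g \<otimes> h \<otimes> inv g \<otimes> inv h"

lemma commutator_closed [simp]: "g \<in> carrier G \<Longrightarrow> h \<in> carrier G \<Longrightarrow> commutator g h \<in> carrier G"
  by (simp add: commutator_def)

lemma commutator_eq_one_iff: "g \<in> carrier G \<Longrightarrow> h \<in> carrier G \<Longrightarrow> commutator g h = \<one> \<longleftrightarrow> g \<otimes> h = h \<otimes> g"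
proof -
  assume gh: "g \<in> carrier G" "h \<in> carrier G"
  have e: "commutator g h \<otimes> (h \<otimes> g) = g \<otimes> h" using gh by (simp add: commutator_def m_assoc)
  have "commutator g h \<in> carrier G" using gh by (simp add: commutator_def)
  then show ?thesis using e gh r_cancel_one[of "h \<otimes> g" "commutator g h"] by auto
qed

lemma commutator_swap: "g \<in> carrier G \<Longrightarrow> h \<in> carrier G \<Longrightarrow> g \<otimes> h = commutator g h \<otimes> (h \<otimes> g)"
  by (simp add: commutator_def m_assoc)

lemma pow_swap:
  assumes "g \<in> carrier G" "h \<in> carrier G" "c \<in> carrier G" "c \<otimes> g = g \<otimes> c" "g \<otimes> h = c \<otimes> (h \<otimes> g)"
  shows "g [^] (n::nat) \<otimes> h = c [^] n \<otimes> (h \<otimes> g [^] n)"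
proof (induction n)
  case (Suc n)
  have cg: "g \<otimes> c [^] n = c [^] n \<otimes> g" using assms by (induction n) (simp_all, metis m_assoc nat_pow_closed)
  have "g [^] Suc n \<otimes> h = g \<otimes> (g [^] n \<otimes> h)" using assms nat_pow_Suc2[of g n] by (simp add: m_assoc)
  also have "\<dots> = (g \<otimes> c [^] n) \<otimes> (h \<otimes> g [^] n)" unfolding Suc using assms by (simp add: m_assoc)
  also have "\<dots> = c [^] n \<otimes> ((g \<otimes> h) \<otimes> g [^] n)" unfolding cg using assms(1-3) by (simp add: m_assoc)
  also have "(g \<otimes> h) \<otimes> g [^] n = c \<otimes> (h \<otimes> g [^] Suc n)"
    unfolding assms(5) using assms(1-3) nat_pow_Suc2[of g n] by (simp add: m_assoc)
  finally show ?case using assms by (simp add: m_assoc)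
qed (use assms in simp)

text \<open>For normal \<open>N\<close>, the preimages in \<open>G\<close> of the terms of the upper
  central series of the quotient by \<open>N\<close>.\<close>

fun upper :: "'a set \<Rightarrow> nat \<Rightarrow> 'a set" where
  "upper N 0 = N"
| "upper N (Suc n) = {g \<in> carrier G. \<forall>h\<in>carrier G. commutator g h \<in> upper N n}"

lemma quotient_hom:
  assumes "N \<lhd> G"
  obtains Q :: "'a set monoid" and \<phi> where "Q = G Mod N" "group_hom G Q \<phi>" "kernel G Q \<phi> = N"
proof -
  have g: "group (G Mod N)" using assms by (rule normal.factorgroup_is_group)
  have h: "(\<lambda>g. N #> g) \<in> hom G (G Mod N)" using assms by (rule normal.r_coset_hom_Mod)
  have "subgroup N G" using assms by (rule normal_imp_subgroup)
  then have "kernel G (G Mod N) (\<lambda>g. N #> g) = N"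
    using coset_join1[of N] coset_join2[of _ N] subgroup.subset[of N G] by (auto simp: kernel_def)
  then show ?thesis using that[OF refl, of "\<lambda>g. N #> g"] g h is_group by (auto simp: group_hom_def group_hom_axioms_def)
qed

end

context group_hom
begin

lemma hom_commutator: "a \<in> carrier G \<Longrightarrow> b \<in> carrier G \<Longrightarrow> h (G.commutator a b) = H.commutator (h a) (h b)"
  by (simp add: G.commutator_def H.commutator_def)

lemma commutator_in_kernel:
  "a \<in> carrier G \<Longrightarrow> b \<in> carrier G \<Longrightarrow> G.commutator a b \<in> kernel G H h \<longleftrightarrow> h a \<otimes>\<^bsub>H\<^esub> h b = h b \<otimes>\<^bsub>H\<^esub> h a"
  by (simp add: kernel_def hom_commutator H.commutator_eq_one_iff)

text \<open>By \<open>commutator_in_kernel\<close> this is the set of elements whose image commutes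
  with the whole image of \<open>h\<close>, so it is invariant under products, inverses and
  conjugation.\<close>

lemma central_mod_kernel_normal:
  "{g \<in> carrier G. \<forall>k\<in>carrier G. G.commutator g k \<in> kernel G H h} \<lhd> G" (is "?Z \<lhd> G")
proof -
  have Z: "g \<in> ?Z \<longleftrightarrow> g \<in> carrier G \<and> (\<forall>k\<in>carrier G. h g \<otimes>\<^bsub>H\<^esub> h k = h k \<otimes>\<^bsub>H\<^esub> h g)" for g
    using commutator_in_kernel[of g] by blast
  have "subgroup ?Z G"
  proof
    show "?Z \<subseteq> carrier G" by blast
    show "\<one> \<in> ?Z" unfolding Z by simp
  next
    fix a b assume "a \<in> ?Z" "b \<in> ?Z"
    then have ab: "a \<in> carrier G" "b \<in> carrier G"
      "\<And>k. k \<in> carrier G \<Longrightarrow> h a \<otimes>\<^bsub>H\<^esub> h k = h k \<otimes>\<^bsub>H\<^esub> h a" "\<And>k. k \<in> carrier G \<Longrightarrow> h b \<otimes>\<^bsub>H\<^esub> h k = h k \<otimes>\<^bsub>H\<^esub> h b"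
      unfolding Z by auto
    have "h a \<otimes>\<^bsub>H\<^esub> h b \<otimes>\<^bsub>H\<^esub> h k = h k \<otimes>\<^bsub>H\<^esub> (h a \<otimes>\<^bsub>H\<^esub> h b)" if k: "k \<in> carrier G" for k
    proof -
      have "h a \<otimes>\<^bsub>H\<^esub> h b \<otimes>\<^bsub>H\<^esub> h k = h a \<otimes>\<^bsub>H\<^esub> (h k \<otimes>\<^bsub>H\<^esub> h b)"
        using ab(1,2) k ab(4)[OF k] by (simp add: H.m_assoc)
      also have "\<dots> = h a \<otimes>\<^bsub>H\<^esub> h k \<otimes>\<^bsub>H\<^esub> h b"
        using ab(1,2) k by (simp add: H.m_assoc)
      also have "h a \<otimes>\<^bsub>H\<^esub> h k = h k \<otimes>\<^bsub>H\<^esub> h a" by (rule ab(3)[OF k])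
      finally show ?thesis using ab(1,2) k by (simp add: H.m_assoc)
    qed
    then show "a \<otimes> b \<in> ?Z" unfolding Z using ab(1,2) by simp
  next
    fix a assume "a \<in> ?Z"
    then have a: "a \<in> carrier G" "\<And>k. k \<in> carrier G \<Longrightarrow> h a \<otimes>\<^bsub>H\<^esub> h k = h k \<otimes>\<^bsub>H\<^esub> h a" unfolding Z by auto
    have "inv\<^bsub>H\<^esub> h a \<otimes>\<^bsub>H\<^esub> h k = h k \<otimes>\<^bsub>H\<^esub> inv\<^bsub>H\<^esub> h a" if k: "k \<in> carrier G" for k
    proof -
      have "inv\<^bsub>H\<^esub> h a \<otimes>\<^bsub>H\<^esub> (h a \<otimes>\<^bsub>H\<^esub> h k) \<otimes>\<^bsub>H\<^esub> inv\<^bsub>H\<^esub> h a = h k \<otimes>\<^bsub>H\<^esub> inv\<^bsub>H\<^esub> h a"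
        using a(1) k by simp
      then show ?thesis unfolding a(2)[OF k] using a(1) k by (simp add: H.m_assoc)
    qed
    then show "inv a \<in> ?Z" unfolding Z using a(1) by simp
  qed
  moreover have "k \<otimes> g \<otimes> inv k \<in> ?Z" if k: "k \<in> carrier G" and g: "g \<in> ?Z" for g k
  proof -
    have gc: "g \<in> carrier G" and com: "h g \<otimes>\<^bsub>H\<^esub> h k = h k \<otimes>\<^bsub>H\<^esub> h g" using g k unfolding Z by auto
    have "h (k \<otimes> g \<otimes> inv k) = h k \<otimes>\<^bsub>H\<^esub> h g \<otimes>\<^bsub>H\<^esub> inv\<^bsub>H\<^esub> h k" using gc k by simp
    also have "\<dots> = h g" unfolding com[symmetric] using gc k by (simp add: H.m_assoc)
    finally have "h (k \<otimes> g \<otimes> inv k) = h g" .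
    then show ?thesis using g gc k unfolding Z by simp
  qed
  ultimately show ?thesis by (simp add: G.normal_inv_iff)
qed

end

section \<open>Upper central series of a torsion-free nilpotent quotient\<close>

context group
begin

lemma upper_normal: "N \<lhd> G \<Longrightarrow> upper N n \<lhd> G"
proof (induction n)
  case (Suc n)
  obtain Q :: "'a set monoid" and \<phi> where "group_hom G Q \<phi>" "kernel G Q \<phi> = upper N n"
    using quotient_hom[OF Suc.IH[OF Suc.prems]] by metis
  then show ?case using group_hom.central_mod_kernel_normal[of G Q \<phi>] by simp
qed simp

text \<open>The usual comparison of central series: if the lower series of the quotient is trivial
  at stage \<open>m\<close>, then its stage \<open>m - i\<close> lies in stage \<open>i\<close> of
  the upper series. Taking \<open>i = m\<close> gives the whole group.\<close>

lemma upper_exhausts: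
  assumes N: "N \<lhd> G" and nil: "nilpotent_group (G Mod N)" shows "\<exists>m. upper N m = carrier G"
proof -
  obtain Q :: "'a set monoid" and \<phi> where Q: "Q = G Mod N" "group_hom G Q \<phi>" "kernel G Q \<phi> = N"
    by (rule quotient_hom[OF N])
  interpret p: group_hom G Q \<phi> by (rule Q(2))
  obtain m where m: "lower_central Q m = {\<one>\<^bsub>Q\<^esub>}" using nil Q(1) by (auto simp: nilpotent_group_def)
  have "g \<in> upper N i" if "i \<le> m" "g \<in> carrier G" "\<phi> g \<in> lower_central Q (m - i)" for i g
    using that
  proof (induction i arbitrary: g)
    case 0
    then show ?case using m Q(3) by (auto simp: kernel_def)
  next
    case (Suc i)
    have "commutator g h \<in> upper N i" if h: "h \<in> carrier G" for h
    proof (rule Suc.IH)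
      have k: "m - i = Suc (m - Suc i)" using Suc.prems by simp
      have "p.H.commutator (\<phi> g) (\<phi> h) \<in> lower_central Q (m - i)"
        unfolding k lower_central.simps p.H.commutator_def using Suc.prems(3) p.hom_closed[OF h] by (blast intro: generate.incl)
      then show "\<phi> (commutator g h) \<in> lower_central Q (m - i)"
        using p.hom_commutator Suc.prems(2) h by simp
    qed (use Suc.prems h in auto)
    then show ?case using Suc.prems by simp
  qed
  from this[of m] have "carrier G \<subseteq> upper N m" by auto
  moreover have "upper N m \<subseteq> carrier G" using upper_normal[OF N] normal_imp_subgroup subgroup.subset by blast
  ultimately show ?thesis by blast
qed

text \<open>For \<open>g\<close> in stage \<open>i + 2\<close>, the commutator of \<open>g\<close>
  and \<open>h\<close> is central modulo stage \<open>i\<close>, so its \<open>n\<close>-th power is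
  the commutator of the \<open>n\<close>-th power of \<open>g\<close> with \<open>h\<close>. If that
  power of \<open>g\<close> lies in stage \<open>i + 1\<close>, the induction hypothesis applies to
  the commutator.\<close>

lemma upper_torsion_free:
  assumes N: "N \<lhd> G" and tf: "torsion_free (G Mod N)" and n: "n > 0"
  shows "g \<in> upper N (Suc i) \<Longrightarrow> g [^] (n::nat) \<in> upper N i \<Longrightarrow> g \<in> upper N i"
proof (induction i arbitrary: g)
  case 0
  obtain Q :: "'a set monoid" and \<phi> where Q: "Q = G Mod N" "group_hom G Q \<phi>" "kernel G Q \<phi> = N"
    by (rule quotient_hom[OF N])
  interpret p: group_hom G Q \<phi> by (rule Q(2))
  have g: "g \<in> carrier G" "g [^] n \<in> kernel G Q \<phi>" using 0 Q(3) by auto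
  then have "\<phi> g [^]\<^bsub>Q\<^esub> n = \<one>\<^bsub>Q\<^esub>" by (simp add: kernel_def p.hom_nat_pow)
  then have "\<phi> g = \<one>\<^bsub>Q\<^esub>" using tf[folded Q(1)] n p.hom_closed[OF g(1)] unfolding torsion_free_def by blast
  then show ?case using Q(3) g(1) by (auto simp: kernel_def)
next
  case (Suc i)
  obtain Q :: "'a set monoid" and \<phi> where Q: "group_hom G Q \<phi>" "kernel G Q \<phi> = upper N i"
    using quotient_hom[OF upper_normal[OF N, of i]] by metis
  interpret p: group_hom G Q \<phi> by (rule Q(1))
  have g: "g \<in> carrier G" using Suc.prems by simp
  have "commutator g h \<in> upper N i" if h: "h \<in> carrier G" for h
  proof (rule Suc.IH)
    show c: "commutator g h \<in> upper N (Suc i)" using Suc.prems(1) h by simp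
    let ?c = "\<phi> (commutator g h)"
    have cl: "\<phi> g \<in> carrier Q" "\<phi> h \<in> carrier Q" "?c \<in> carrier Q" using g h by auto
    have "?c \<otimes>\<^bsub>Q\<^esub> \<phi> g = \<phi> g \<otimes>\<^bsub>Q\<^esub> ?c"
      using p.commutator_in_kernel[of "commutator g h" g] c g h Q(2) by simp
    moreover have "\<phi> g \<otimes>\<^bsub>Q\<^esub> \<phi> h = ?c \<otimes>\<^bsub>Q\<^esub> (\<phi> h \<otimes>\<^bsub>Q\<^esub> \<phi> g)"
      unfolding p.hom_commutator[OF g h] by (rule p.H.commutator_swap[OF cl(1,2)])
    ultimately have sw: "\<phi> g [^]\<^bsub>Q\<^esub> n \<otimes>\<^bsub>Q\<^esub> \<phi> h = ?c [^]\<^bsub>Q\<^esub> n \<otimes>\<^bsub>Q\<^esub> (\<phi> h \<otimes>\<^bsub>Q\<^esub> \<phi> g [^]\<^bsub>Q\<^esub> n)"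
      using cl by (intro p.H.pow_swap) auto
    have "commutator (g [^] n) h \<in> kernel G Q \<phi>" using Suc.prems(2) h Q(2) by simp
    then have "\<phi> g [^]\<^bsub>Q\<^esub> n \<otimes>\<^bsub>Q\<^esub> \<phi> h = \<phi> h \<otimes>\<^bsub>Q\<^esub> \<phi> g [^]\<^bsub>Q\<^esub> n"
      using p.commutator_in_kernel[of "g [^] n" h] g h by (simp add: p.hom_nat_pow)
    then have "?c [^]\<^bsub>Q\<^esub> n = \<one>\<^bsub>Q\<^esub>" using sw cl
      by (metis p.H.l_cancel_one' p.H.m_closed p.H.nat_pow_closed p.H.r_cancel_one')
    then have "commutator g h [^] n \<in> kernel G Q \<phi>" using g h by (simp add: kernel_def p.hom_nat_pow)
    then show "commutator g h [^] n \<in> upper N i" using Q(2) by simp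
  qed
  then show ?case using g by simp
qed

end

text \<open>Modulo the kernel of \<open>\<phi>\<close>, the elements \<open>x\<close> and \<open>y\<close> generate a discrete Heisenberg group
  whose centre is central in the whole image.\<close>

definition heisenberg_pair ::
  "('a, 'm) monoid_scheme \<Rightarrow> ('c, 'n) monoid_scheme \<Rightarrow> ('a \<Rightarrow> 'c) \<Rightarrow> 'a \<Rightarrow> 'a \<Rightarrow> bool" where
  "heisenberg_pair G Q \<phi> x y \<longleftrightarrow> x \<in> carrier G \<and> y \<in> carrier G \<and>
    (\<exists>c\<in>carrier Q. (\<forall>g\<in>carrier G. c \<otimes>\<^bsub>Q\<^esub> \<phi> g = \<phi> g \<otimes>\<^bsub>Q\<^esub> c) \<and> (\<forall>n::nat. n > 0 \<longrightarrow> c [^]\<^bsub>Q\<^esub> n \<noteq> \<one>\<^bsub>Q\<^esub>) \<and>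
      \<phi> x \<otimes>\<^bsub>Q\<^esub> \<phi> y = c \<otimes>\<^bsub>Q\<^esub> (\<phi> y \<otimes>\<^bsub>Q\<^esub> \<phi> x))"

text \<open>Take the least stage of the upper series containing all commutators of \<open>B\<close>
  with \<open>y\<close>, and an \<open>x\<close> in \<open>B\<close> whose commutator lies outside
  the stage before it. Modulo that earlier stage all these commutators are central, and the one of
  \<open>x\<close> has infinite order because successive stages have torsion-free quotients.\<close>

lemma (in group) heisenberg_pair_exists:
  assumes res: "residually_tfn G" and y: "y \<in> carrier G" and B: "B \<subseteq> carrier G" "b \<in> B" "b \<otimes> y \<noteq> y \<otimes> b"
  obtains Q :: "'a set monoid" and \<phi> x where "group_hom G Q \<phi>" "x \<in> B" "heisenberg_pair G Q \<phi> x y"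
    "\<And>b h. b \<in> B \<Longrightarrow> h \<in> carrier G \<Longrightarrow> \<phi> (commutator b y) \<otimes>\<^bsub>Q\<^esub> \<phi> h = \<phi> h \<otimes>\<^bsub>Q\<^esub> \<phi> (commutator b y)"
proof -
  have b: "b \<in> carrier G" using B by blast
  have "commutator b y \<noteq> \<one>" using commutator_eq_one_iff[OF b y] B by simp
  then obtain N where N: "N \<lhd> G" "commutator b y \<notin> N" "torsion_free (G Mod N)" "nilpotent_group (G Mod N)"
    using res b y unfolding residually_tfn_def by (meson commutator_closed)
  let ?P = "\<lambda>j. \<forall>b\<in>B. commutator b y \<in> upper N j"
  obtain m where "upper N m = carrier G" using upper_exhausts[OF N(1,4)] by blast
  then have "?P m" using B y by auto
  then have P: "?P (LEAST j. ?P j)" by (rule LeastI)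
  have "(LEAST j. ?P j) \<noteq> 0" using P N(2) B(2) by (metis upper.simps(1))
  then obtain i where i: "(LEAST j. ?P j) = Suc i" by (metis not0_implies_Suc)
  have "\<not> ?P i" using not_less_Least[of i ?P] i by simp
  then obtain x where x: "x \<in> B" "commutator x y \<notin> upper N i" by blast
  have xc: "x \<in> carrier G" using x B by blast
  have Pi: "commutator b y \<in> upper N (Suc i)" if "b \<in> B" for b using P that unfolding i by blast
  obtain Q :: "'a set monoid" and \<phi> where Q: "group_hom G Q \<phi>" "kernel G Q \<phi> = upper N i"
    using quotient_hom[OF upper_normal[OF N(1), of i]] by metis
  interpret p: group_hom G Q \<phi> by (rule Q(1))
  have central: "\<phi> (commutator b y) \<otimes>\<^bsub>Q\<^esub> \<phi> h = \<phi> h \<otimes>\<^bsub>Q\<^esub> \<phi> (commutator b y)"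
    if b: "b \<in> B" and h: "h \<in> carrier G" for b h
  proof -
    have "commutator b y \<in> carrier G" using b B y by auto
    then show ?thesis using p.commutator_in_kernel[of "commutator b y" h] Pi[OF b] h Q(2) by simp
  qed
  have tf: "\<phi> (commutator x y) [^]\<^bsub>Q\<^esub> n \<noteq> \<one>\<^bsub>Q\<^esub>" if n: "n > 0" for n :: nat
  proof
    assume "\<phi> (commutator x y) [^]\<^bsub>Q\<^esub> n = \<one>\<^bsub>Q\<^esub>"
    then have "commutator x y [^] n \<in> upper N i" unfolding Q(2)[symmetric] using xc y by (simp add: kernel_def p.hom_nat_pow)
    then show False using upper_torsion_free[OF N(1,3) n Pi[OF x(1)]] x(2) by blast
  qed
  have sw: "\<phi> x \<otimes>\<^bsub>Q\<^esub> \<phi> y = \<phi> (commutator x y) \<otimes>\<^bsub>Q\<^esub> (\<phi> y \<otimes>\<^bsub>Q\<^esub> \<phi> x)"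
    unfolding p.hom_commutator[OF xc y] by (rule p.H.commutator_swap[OF p.hom_closed[OF xc] p.hom_closed[OF y]])
  have "\<phi> (commutator x y) \<in> carrier Q" using xc y by simp
  then have "heisenberg_pair G Q \<phi> x y"
    unfolding heisenberg_pair_def using xc y tf sw central[OF x(1)] by blast
  then show ?thesis using that Q(1) x(1) central by blast
qed

context group_hom
begin

lemma heisenberg_pair_inv:
  assumes hp: "heisenberg_pair G H h x y" shows "heisenberg_pair G H h (inv x) y"
proof -
  obtain c where xy: "x \<in> carrier G" "y \<in> carrier G" and c: "c \<in> carrier H"
    "\<And>g. g \<in> carrier G \<Longrightarrow> c \<otimes>\<^bsub>H\<^esub> h g = h g \<otimes>\<^bsub>H\<^esub> c" "\<And>n::nat. n > 0 \<Longrightarrow> c [^]\<^bsub>H\<^esub> n \<noteq> \<one>\<^bsub>H\<^esub>"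
    "h x \<otimes>\<^bsub>H\<^esub> h y = c \<otimes>\<^bsub>H\<^esub> (h y \<otimes>\<^bsub>H\<^esub> h x)"
    using hp unfolding heisenberg_pair_def by blast
  let ?c = "inv\<^bsub>H\<^esub> c"
  have central: "?c \<otimes>\<^bsub>H\<^esub> h g = h g \<otimes>\<^bsub>H\<^esub> ?c" if g: "g \<in> carrier G" for g
  proof -
    have "?c \<otimes>\<^bsub>H\<^esub> (c \<otimes>\<^bsub>H\<^esub> h g) \<otimes>\<^bsub>H\<^esub> ?c = h g \<otimes>\<^bsub>H\<^esub> ?c" using c(1) g by simp
    then show ?thesis unfolding c(2)[OF g] using c(1) g by (simp add: H.m_assoc)
  qed
  have "?c [^]\<^bsub>H\<^esub> n \<noteq> \<one>\<^bsub>H\<^esub>" if "n > 0" for n :: nat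
    using c(3)[OF that] c(1) by (simp add: H.nat_pow_inv)
  moreover have "h (inv x) \<otimes>\<^bsub>H\<^esub> h y = ?c \<otimes>\<^bsub>H\<^esub> (h y \<otimes>\<^bsub>H\<^esub> h (inv x))"
  proof -
    let ?X = "h x" and ?Y = "h y"
    have cl: "?X \<in> carrier H" "?Y \<in> carrier H" "?c \<in> carrier H" using xy c(1) by auto
    have "?c \<otimes>\<^bsub>H\<^esub> (?X \<otimes>\<^bsub>H\<^esub> ?Y) = ?Y \<otimes>\<^bsub>H\<^esub> ?X" using c(1,4) cl by simp
    then have "?Y \<otimes>\<^bsub>H\<^esub> ?X = ?X \<otimes>\<^bsub>H\<^esub> (?c \<otimes>\<^bsub>H\<^esub> ?Y)" using central[OF xy(1)] cl by (metis H.m_assoc)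
    then have "inv\<^bsub>H\<^esub> ?X \<otimes>\<^bsub>H\<^esub> (?Y \<otimes>\<^bsub>H\<^esub> ?X) \<otimes>\<^bsub>H\<^esub> inv\<^bsub>H\<^esub> ?X = ?c \<otimes>\<^bsub>H\<^esub> ?Y \<otimes>\<^bsub>H\<^esub> inv\<^bsub>H\<^esub> ?X" using cl by simp
    then show ?thesis using xy cl by (simp add: H.m_assoc)
  qed
  ultimately show ?thesis unfolding heisenberg_pair_def using xy c(1) central by blast
qed

end

text \<open>The degree is well defined because the central element \<open>c\<close> has infinite
  order, and additive because \<open>c\<close> commutes with the image of \<open>\<phi>\<close>.
  Positive powers of \<open>x\<close> stay outside \<open>L\<close> since they commute with
  \<open>y\<close> only up to positive powers of \<open>c\<close>. The final clause is what later
  places \<open>y \<otimes> s y\<close> in \<open>L\<close> with degree zero.\<close>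

lemma graded_exists:
  fixes G :: "('g, 'b) monoid_scheme"
  assumes og: "ordered_grp G lt" and hom: "group_hom G Q \<phi>" and hp: "heisenberg_pair G Q \<phi> x y"
    and pos: "lt \<one>\<^bsub>G\<^esub> x"
  obtains L deg where "graded G lt L deg x" "y \<in> L" "deg y = 1"
    "\<And>g. g \<in> carrier G \<Longrightarrow> \<phi> g \<otimes>\<^bsub>Q\<^esub> \<phi> y = \<phi> y \<otimes>\<^bsub>Q\<^esub> \<phi> g \<Longrightarrow> x \<otimes>\<^bsub>G\<^esub> g = g \<otimes>\<^bsub>G\<^esub> x \<Longrightarrow> g \<in> L \<and> deg g = 0"
proof -
  interpret G: ordered_grp G lt by (rule og)
  interpret p: group_hom G Q \<phi> by (rule hom)
  obtain c where xy [simp]: "x \<in> carrier G" "y \<in> carrier G" and c [simp]: "c \<in> carrier Q"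
    and cc: "\<And>g. g \<in> carrier G \<Longrightarrow> c \<otimes>\<^bsub>Q\<^esub> \<phi> g = \<phi> g \<otimes>\<^bsub>Q\<^esub> c"
    and tf: "\<And>n::nat. n > 0 \<Longrightarrow> c [^]\<^bsub>Q\<^esub> n \<noteq> \<one>\<^bsub>Q\<^esub>"
    and sw: "\<phi> x \<otimes>\<^bsub>Q\<^esub> \<phi> y = c \<otimes>\<^bsub>Q\<^esub> (\<phi> y \<otimes>\<^bsub>Q\<^esub> \<phi> x)"
    using hp unfolding heisenberg_pair_def by blast
  let ?P = "\<lambda>i::int. c [^]\<^bsub>Q\<^esub> i"
  have ccn: "?P i \<otimes>\<^bsub>Q\<^esub> \<phi> g = \<phi> g \<otimes>\<^bsub>Q\<^esub> ?P i" if g: "g \<in> carrier G" for g i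
  proof -
    have nat: "c [^]\<^bsub>Q\<^esub> n \<otimes>\<^bsub>Q\<^esub> \<phi> g = \<phi> g \<otimes>\<^bsub>Q\<^esub> c [^]\<^bsub>Q\<^esub> n" for n :: nat
    proof (induction n)
      case (Suc n)
      have "c [^]\<^bsub>Q\<^esub> Suc n \<otimes>\<^bsub>Q\<^esub> \<phi> g = c [^]\<^bsub>Q\<^esub> n \<otimes>\<^bsub>Q\<^esub> (c \<otimes>\<^bsub>Q\<^esub> \<phi> g)" using g by (simp add: p.H.m_assoc)
      also have "\<dots> = c [^]\<^bsub>Q\<^esub> n \<otimes>\<^bsub>Q\<^esub> \<phi> g \<otimes>\<^bsub>Q\<^esub> c" unfolding cc[OF g] using g by (simp add: p.H.m_assoc)
      also have "\<dots> = \<phi> g \<otimes>\<^bsub>Q\<^esub> c [^]\<^bsub>Q\<^esub> Suc n" unfolding Suc using g by (simp add: p.H.m_assoc)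
      finally show ?case .
    qed (use g in simp)
    show ?thesis
    proof (cases i)
      case (nonneg n)
      then show ?thesis using nat by (simp add: int_pow_int)
    next
      case (neg n)
      let ?q = "c [^]\<^bsub>Q\<^esub> Suc n"
      have i: "?P i = inv\<^bsub>Q\<^esub> ?q" unfolding neg by (rule p.H.int_pow_neg_int[OF c])
      have q: "?q \<in> carrier Q" by simp
      have "inv\<^bsub>Q\<^esub> ?q \<otimes>\<^bsub>Q\<^esub> (?q \<otimes>\<^bsub>Q\<^esub> \<phi> g) \<otimes>\<^bsub>Q\<^esub> inv\<^bsub>Q\<^esub> ?q = \<phi> g \<otimes>\<^bsub>Q\<^esub> inv\<^bsub>Q\<^esub> ?q"
        using q g p.hom_closed[OF g] by (simp only: p.H.inv_cancel_left p.H.inv_closed)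
      then have "inv\<^bsub>Q\<^esub> ?q \<otimes>\<^bsub>Q\<^esub> (\<phi> g \<otimes>\<^bsub>Q\<^esub> ?q) \<otimes>\<^bsub>Q\<^esub> inv\<^bsub>Q\<^esub> ?q = \<phi> g \<otimes>\<^bsub>Q\<^esub> inv\<^bsub>Q\<^esub> ?q"
        unfolding nat[of "Suc n"] .
      moreover have "inv\<^bsub>Q\<^esub> ?q \<otimes>\<^bsub>Q\<^esub> (\<phi> g \<otimes>\<^bsub>Q\<^esub> ?q) \<otimes>\<^bsub>Q\<^esub> inv\<^bsub>Q\<^esub> ?q = inv\<^bsub>Q\<^esub> ?q \<otimes>\<^bsub>Q\<^esub> \<phi> g"
        using q g by (simp add: p.H.m_assoc del: nat_pow_Suc)
      ultimately show ?thesis unfolding i by simp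
    qed
  qed
  have inj: "i = j" if "?P i = ?P j" for i j
  proof -
    have *: False if "?P i = ?P j" "i < j" for i j
    proof -
      have "?P (j - i) = \<one>\<^bsub>Q\<^esub>" using that(1) p.H.int_pow_diff[OF c, of j i] by simp
      moreover have "j - i = int (nat (j - i))" using that(2) by simp
      ultimately have "c [^]\<^bsub>Q\<^esub> nat (j - i) = \<one>\<^bsub>Q\<^esub>" by (metis int_pow_int)
      then show False using tf[of "nat (j - i)"] that(2) by simp
    qed
    show ?thesis using *[OF that] *[OF that[symmetric]] by (cases i j rule: linorder_cases) auto
  qed
  define R where "R g i \<longleftrightarrow> \<phi> x \<otimes>\<^bsub>Q\<^esub> \<phi> g = ?P i \<otimes>\<^bsub>Q\<^esub> (\<phi> g \<otimes>\<^bsub>Q\<^esub> \<phi> x)" for g i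
  define L where "L = {g \<in> carrier G. \<phi> g \<otimes>\<^bsub>Q\<^esub> \<phi> y = \<phi> y \<otimes>\<^bsub>Q\<^esub> \<phi> g \<and> (\<exists>i. R g i)}"
  define deg where "deg g = (THE i. R g i)" for g
  have R_unique: "i = j" if "R g i" "R g j" "g \<in> carrier G" for g i j
  proof -
    have "?P i \<otimes>\<^bsub>Q\<^esub> (\<phi> g \<otimes>\<^bsub>Q\<^esub> \<phi> x) = ?P j \<otimes>\<^bsub>Q\<^esub> (\<phi> g \<otimes>\<^bsub>Q\<^esub> \<phi> x)" using that by (simp add: R_def)
    then have "?P i = ?P j" using that(3) by simp
    then show ?thesis by (rule inj)
  qed
  have degI: "deg g = i" if "R g i" "g \<in> carrier G" for g i
    unfolding deg_def using that R_unique by blast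
  have degR: "R g (deg g)" if "g \<in> L" for g
    using that degI unfolding L_def by blast
  have R_mult: "R (g \<otimes>\<^bsub>G\<^esub> k) (i + j)" if "R g i" "R k j" "g \<in> carrier G" "k \<in> carrier G" for g k i j
  proof -
    have "\<phi> x \<otimes>\<^bsub>Q\<^esub> (\<phi> g \<otimes>\<^bsub>Q\<^esub> \<phi> k) = ?P i \<otimes>\<^bsub>Q\<^esub> (\<phi> g \<otimes>\<^bsub>Q\<^esub> (\<phi> x \<otimes>\<^bsub>Q\<^esub> \<phi> k))"
      using that(1,3,4) p.H.m_assoc[of "\<phi> x" "\<phi> g" "\<phi> k"] unfolding R_def by (simp add: p.H.m_assoc)
    also have "\<dots> = ?P i \<otimes>\<^bsub>Q\<^esub> ((\<phi> g \<otimes>\<^bsub>Q\<^esub> ?P j) \<otimes>\<^bsub>Q\<^esub> (\<phi> k \<otimes>\<^bsub>Q\<^esub> \<phi> x))"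
      using that(2-4) unfolding R_def by (simp add: p.H.m_assoc)
    also have "\<dots> = (?P i \<otimes>\<^bsub>Q\<^esub> ?P j) \<otimes>\<^bsub>Q\<^esub> (\<phi> g \<otimes>\<^bsub>Q\<^esub> \<phi> k \<otimes>\<^bsub>Q\<^esub> \<phi> x)"
      unfolding ccn[OF that(3), symmetric] using that(3,4) by (simp add: p.H.m_assoc)
    also have "?P i \<otimes>\<^bsub>Q\<^esub> ?P j = ?P (i + j)" by (simp add: p.H.int_pow_mult)
    finally show ?thesis using that(3,4) by (simp add: R_def)
  qed
  have R_zero: "R g 0 \<longleftrightarrow> \<phi> x \<otimes>\<^bsub>Q\<^esub> \<phi> g = \<phi> g \<otimes>\<^bsub>Q\<^esub> \<phi> x" if "g \<in> carrier G" for g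
    using that by (simp add: R_def)
  have R_inv: "R (inv\<^bsub>G\<^esub> g) (- i)" if "R g i" "g \<in> carrier G" for g i
  proof -
    have g: "\<phi> g \<in> carrier Q" "\<phi> x \<in> carrier Q" using that(2) by auto
    have "\<phi> x \<otimes>\<^bsub>Q\<^esub> inv\<^bsub>Q\<^esub> \<phi> g = (?P (- i) \<otimes>\<^bsub>Q\<^esub> inv\<^bsub>Q\<^esub> \<phi> g) \<otimes>\<^bsub>Q\<^esub> (?P i \<otimes>\<^bsub>Q\<^esub> (\<phi> g \<otimes>\<^bsub>Q\<^esub> \<phi> x)) \<otimes>\<^bsub>Q\<^esub> inv\<^bsub>Q\<^esub> \<phi> g"
    proof -
      have 1: "?P (- i) \<otimes>\<^bsub>Q\<^esub> ?P i = \<one>\<^bsub>Q\<^esub>" by (simp add: p.H.int_pow_neg)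
      have 2: "inv\<^bsub>Q\<^esub> \<phi> g \<otimes>\<^bsub>Q\<^esub> ?P i = ?P i \<otimes>\<^bsub>Q\<^esub> inv\<^bsub>Q\<^esub> \<phi> g"
        using ccn[of "inv\<^bsub>G\<^esub> g" i] that(2) by simp
      have "(?P (- i) \<otimes>\<^bsub>Q\<^esub> inv\<^bsub>Q\<^esub> \<phi> g) \<otimes>\<^bsub>Q\<^esub> (?P i \<otimes>\<^bsub>Q\<^esub> (\<phi> g \<otimes>\<^bsub>Q\<^esub> \<phi> x)) = ?P (- i) \<otimes>\<^bsub>Q\<^esub> (inv\<^bsub>Q\<^esub> \<phi> g \<otimes>\<^bsub>Q\<^esub> ?P i) \<otimes>\<^bsub>Q\<^esub> (\<phi> g \<otimes>\<^bsub>Q\<^esub> \<phi> x)"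
        using g by (simp add: p.H.m_assoc)
      also have "\<dots> = (?P (- i) \<otimes>\<^bsub>Q\<^esub> ?P i) \<otimes>\<^bsub>Q\<^esub> \<phi> x" unfolding 2 using g by (simp add: p.H.m_assoc)
      finally show ?thesis unfolding 1 using g by simp
    qed
    also have "\<dots> = ?P (- i) \<otimes>\<^bsub>Q\<^esub> inv\<^bsub>Q\<^esub> \<phi> g \<otimes>\<^bsub>Q\<^esub> (\<phi> x \<otimes>\<^bsub>Q\<^esub> \<phi> g) \<otimes>\<^bsub>Q\<^esub> inv\<^bsub>Q\<^esub> \<phi> g"
      using that(1) unfolding R_def by simp
    also have "\<dots> = ?P (- i) \<otimes>\<^bsub>Q\<^esub> (inv\<^bsub>Q\<^esub> \<phi> g \<otimes>\<^bsub>Q\<^esub> \<phi> x)" using g by (simp add: p.H.m_assoc)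
    finally show ?thesis using that(2) by (simp add: R_def)
  qed
  have commute_inv: "\<phi> (inv\<^bsub>G\<^esub> g) \<otimes>\<^bsub>Q\<^esub> \<phi> y = \<phi> y \<otimes>\<^bsub>Q\<^esub> \<phi> (inv\<^bsub>G\<^esub> g)"
    if g: "g \<in> carrier G" and e: "\<phi> g \<otimes>\<^bsub>Q\<^esub> \<phi> y = \<phi> y \<otimes>\<^bsub>Q\<^esub> \<phi> g" for g
  proof -
    have "inv\<^bsub>Q\<^esub> \<phi> g \<otimes>\<^bsub>Q\<^esub> (\<phi> g \<otimes>\<^bsub>Q\<^esub> \<phi> y) \<otimes>\<^bsub>Q\<^esub> inv\<^bsub>Q\<^esub> \<phi> g = \<phi> y \<otimes>\<^bsub>Q\<^esub> inv\<^bsub>Q\<^esub> \<phi> g" using g by simp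
    then show ?thesis unfolding e using g by (simp add: p.H.m_assoc)
  qed
  have commute_mult: "\<phi> (g \<otimes>\<^bsub>G\<^esub> k) \<otimes>\<^bsub>Q\<^esub> \<phi> y = \<phi> y \<otimes>\<^bsub>Q\<^esub> \<phi> (g \<otimes>\<^bsub>G\<^esub> k)"
    if "g \<in> carrier G" "k \<in> carrier G" "\<phi> g \<otimes>\<^bsub>Q\<^esub> \<phi> y = \<phi> y \<otimes>\<^bsub>Q\<^esub> \<phi> g" "\<phi> k \<otimes>\<^bsub>Q\<^esub> \<phi> y = \<phi> y \<otimes>\<^bsub>Q\<^esub> \<phi> k" for g k
  proof -
    have "\<phi> g \<otimes>\<^bsub>Q\<^esub> \<phi> k \<otimes>\<^bsub>Q\<^esub> \<phi> y = \<phi> g \<otimes>\<^bsub>Q\<^esub> (\<phi> k \<otimes>\<^bsub>Q\<^esub> \<phi> y)" using that(1,2) by (simp add: p.H.m_assoc)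
    also have "\<dots> = (\<phi> g \<otimes>\<^bsub>Q\<^esub> \<phi> y) \<otimes>\<^bsub>Q\<^esub> \<phi> k" unfolding that(4) using that(1,2) by (simp add: p.H.m_assoc)
    also have "\<dots> = \<phi> y \<otimes>\<^bsub>Q\<^esub> (\<phi> g \<otimes>\<^bsub>Q\<^esub> \<phi> k)" unfolding that(3) using that(1,2) by (simp add: p.H.m_assoc)
    finally show ?thesis using that(1,2) by simp
  qed
  \<comment> \<open>Conjugation by \<open>x\<close> multiplies \<open>\<phi> g\<close> by a power of the central element \<open>c\<close>.\<close>
  have conj: "x' \<otimes>\<^bsub>G\<^esub> g \<otimes>\<^bsub>G\<^esub> inv\<^bsub>G\<^esub> x' \<in> L \<and> R (x' \<otimes>\<^bsub>G\<^esub> g \<otimes>\<^bsub>G\<^esub> inv\<^bsub>G\<^esub> x') i"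
    if x': "x' \<in> carrier G" and e: "\<phi> x' \<otimes>\<^bsub>Q\<^esub> \<phi> g = ?P j \<otimes>\<^bsub>Q\<^esub> (\<phi> g \<otimes>\<^bsub>Q\<^esub> \<phi> x')" and g: "g \<in> L" "R g i" for x' g i j
  proof -
    have gc: "g \<in> carrier G" and gy: "\<phi> g \<otimes>\<^bsub>Q\<^esub> \<phi> y = \<phi> y \<otimes>\<^bsub>Q\<^esub> \<phi> g" using g(1) by (auto simp: L_def)
    let ?g = "x' \<otimes>\<^bsub>G\<^esub> g \<otimes>\<^bsub>G\<^esub> inv\<^bsub>G\<^esub> x'"
    have \<phi>g: "\<phi> ?g = ?P j \<otimes>\<^bsub>Q\<^esub> \<phi> g" using x' gc e by (simp add: p.H.m_assoc)
    have "\<phi> ?g \<otimes>\<^bsub>Q\<^esub> \<phi> y = ?P j \<otimes>\<^bsub>Q\<^esub> (\<phi> g \<otimes>\<^bsub>Q\<^esub> \<phi> y)" unfolding \<phi>g using gc by (simp add: p.H.m_assoc)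
    also have "\<dots> = (?P j \<otimes>\<^bsub>Q\<^esub> \<phi> y) \<otimes>\<^bsub>Q\<^esub> \<phi> g" unfolding gy using gc by (simp add: p.H.m_assoc)
    also have "\<dots> = \<phi> y \<otimes>\<^bsub>Q\<^esub> \<phi> ?g" unfolding ccn[OF xy(2)] \<phi>g using gc by (simp add: p.H.m_assoc)
    finally have 1: "\<phi> ?g \<otimes>\<^bsub>Q\<^esub> \<phi> y = \<phi> y \<otimes>\<^bsub>Q\<^esub> \<phi> ?g" .
    have "\<phi> x \<otimes>\<^bsub>Q\<^esub> \<phi> ?g = (\<phi> x \<otimes>\<^bsub>Q\<^esub> ?P j) \<otimes>\<^bsub>Q\<^esub> \<phi> g" unfolding \<phi>g using gc by (simp add: p.H.m_assoc)
    also have "\<dots> = ?P j \<otimes>\<^bsub>Q\<^esub> (\<phi> x \<otimes>\<^bsub>Q\<^esub> \<phi> g)" unfolding ccn[OF xy(1), symmetric] using gc by (simp add: p.H.m_assoc)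
    also have "\<dots> = (?P j \<otimes>\<^bsub>Q\<^esub> ?P i) \<otimes>\<^bsub>Q\<^esub> (\<phi> g \<otimes>\<^bsub>Q\<^esub> \<phi> x)" using g(2) gc unfolding R_def by (simp add: p.H.m_assoc)
    also have "?P j \<otimes>\<^bsub>Q\<^esub> ?P i = ?P i \<otimes>\<^bsub>Q\<^esub> ?P j" by (metis c p.H.int_pow_mult add.commute)
    also have "?P i \<otimes>\<^bsub>Q\<^esub> ?P j \<otimes>\<^bsub>Q\<^esub> (\<phi> g \<otimes>\<^bsub>Q\<^esub> \<phi> x) = ?P i \<otimes>\<^bsub>Q\<^esub> (\<phi> ?g \<otimes>\<^bsub>Q\<^esub> \<phi> x)" unfolding \<phi>g using gc by (simp add: p.H.m_assoc)
    finally have "R ?g i" by (simp add: R_def)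
    then show ?thesis using 1 x' gc unfolding L_def by auto
  qed
  have L_carrier: "g \<in> carrier G" if "g \<in> L" for g using that by (simp add: L_def)
  have conj_x: "x \<otimes>\<^bsub>G\<^esub> g \<otimes>\<^bsub>G\<^esub> inv\<^bsub>G\<^esub> x \<in> L \<and> R (x \<otimes>\<^bsub>G\<^esub> g \<otimes>\<^bsub>G\<^esub> inv\<^bsub>G\<^esub> x) (deg g)" if "g \<in> L" for g
    using conj[OF xy(1) _ that degR[OF that], of "deg g"] degR[OF that] by (simp add: R_def)
  have conj_x': "inv\<^bsub>G\<^esub> x \<otimes>\<^bsub>G\<^esub> g \<otimes>\<^bsub>G\<^esub> x \<in> L" if g: "g \<in> L" for g
  proof -
    let ?i = "deg g"
    have gc: "\<phi> g \<in> carrier Q" "\<phi> x \<in> carrier Q" using g L_carrier by auto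
    have "\<phi> (inv\<^bsub>G\<^esub> x) \<otimes>\<^bsub>Q\<^esub> \<phi> g = ?P (- ?i) \<otimes>\<^bsub>Q\<^esub> (\<phi> g \<otimes>\<^bsub>Q\<^esub> \<phi> (inv\<^bsub>G\<^esub> x))"
    proof -
      have 1: "?P (- ?i) \<otimes>\<^bsub>Q\<^esub> ?P ?i = \<one>\<^bsub>Q\<^esub>" by (simp add: p.H.int_pow_neg)
      have 2: "inv\<^bsub>Q\<^esub> \<phi> x \<otimes>\<^bsub>Q\<^esub> ?P (- ?i) = ?P (- ?i) \<otimes>\<^bsub>Q\<^esub> inv\<^bsub>Q\<^esub> \<phi> x"
        using ccn[of "inv\<^bsub>G\<^esub> x" "- ?i"] by simp
      have "?P (- ?i) \<otimes>\<^bsub>Q\<^esub> (\<phi> x \<otimes>\<^bsub>Q\<^esub> \<phi> g) = (?P (- ?i) \<otimes>\<^bsub>Q\<^esub> ?P ?i) \<otimes>\<^bsub>Q\<^esub> (\<phi> g \<otimes>\<^bsub>Q\<^esub> \<phi> x)"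
        using degR[OF g] gc unfolding R_def by (simp add: p.H.m_assoc)
      then have "\<phi> g \<otimes>\<^bsub>Q\<^esub> \<phi> x = ?P (- ?i) \<otimes>\<^bsub>Q\<^esub> (\<phi> x \<otimes>\<^bsub>Q\<^esub> \<phi> g)" unfolding 1 using gc by simp
      then have "inv\<^bsub>Q\<^esub> \<phi> x \<otimes>\<^bsub>Q\<^esub> (\<phi> g \<otimes>\<^bsub>Q\<^esub> \<phi> x) \<otimes>\<^bsub>Q\<^esub> inv\<^bsub>Q\<^esub> \<phi> x = inv\<^bsub>Q\<^esub> \<phi> x \<otimes>\<^bsub>Q\<^esub> ?P (- ?i) \<otimes>\<^bsub>Q\<^esub> (\<phi> x \<otimes>\<^bsub>Q\<^esub> \<phi> g) \<otimes>\<^bsub>Q\<^esub> inv\<^bsub>Q\<^esub> \<phi> x"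
        using gc by (simp add: p.H.m_assoc)
      then show ?thesis unfolding 2 using gc by (simp add: p.H.m_assoc)
    qed
    then show ?thesis using conj[of "inv\<^bsub>G\<^esub> x" g "- ?i" ?i] g degR[OF g] by simp
  qed
  have sub: "subgroup L G"
  proof
    show "L \<subseteq> carrier G" using L_carrier by blast
    show "a \<otimes>\<^bsub>G\<^esub> b \<in> L" if "a \<in> L" "b \<in> L" for a b
      using that R_mult commute_mult unfolding L_def by blast
    show "\<one>\<^bsub>G\<^esub> \<in> L" using R_zero[of "\<one>\<^bsub>G\<^esub>"] unfolding L_def by auto
    show "inv\<^bsub>G\<^esub> a \<in> L" if "a \<in> L" for a
      using that R_inv commute_inv unfolding L_def by (auto simp del: p.hom_inv)
  qed
  have "x [^]\<^bsub>G\<^esub> n \<notin> L" if n: "n > 0" for n :: nat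
  proof
    assume "x [^]\<^bsub>G\<^esub> n \<in> L"
    then have "\<phi> x [^]\<^bsub>Q\<^esub> n \<otimes>\<^bsub>Q\<^esub> \<phi> y = \<phi> y \<otimes>\<^bsub>Q\<^esub> \<phi> x [^]\<^bsub>Q\<^esub> n" by (simp add: L_def p.hom_nat_pow)
    moreover have "\<phi> x [^]\<^bsub>Q\<^esub> n \<otimes>\<^bsub>Q\<^esub> \<phi> y = c [^]\<^bsub>Q\<^esub> n \<otimes>\<^bsub>Q\<^esub> (\<phi> y \<otimes>\<^bsub>Q\<^esub> \<phi> x [^]\<^bsub>Q\<^esub> n)"
      using cc[OF xy(1)] sw by (intro p.H.pow_swap) auto
    ultimately have "c [^]\<^bsub>Q\<^esub> n = \<one>\<^bsub>Q\<^esub>"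
      using p.H.r_cancel_one'[of "\<phi> y \<otimes>\<^bsub>Q\<^esub> \<phi> x [^]\<^bsub>Q\<^esub> n" "c [^]\<^bsub>Q\<^esub> n"] by simp
    then show False using tf n by blast
  qed
  then have "graded G lt L deg x"
    using pos conj_x conj_x' L_carrier degI R_mult degR subgroup.m_closed[OF sub] subgroup.one_closed[OF sub]
      subgroup.m_inv_closed[OF sub]
    by unfold_locales (auto intro!: degI)
  moreover have "R y 1" using sw by (simp add: R_def p.H.int_pow_1)
  then have "y \<in> L" "deg y = 1" using degI unfolding L_def by auto
  moreover have "g \<in> L \<and> deg g = 0"
    if g: "g \<in> carrier G" and "\<phi> g \<otimes>\<^bsub>Q\<^esub> \<phi> y = \<phi> y \<otimes>\<^bsub>Q\<^esub> \<phi> g" "x \<otimes>\<^bsub>G\<^esub> g = g \<otimes>\<^bsub>G\<^esub> x" for g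
  proof -
    have "\<phi> x \<otimes>\<^bsub>Q\<^esub> \<phi> g = \<phi> g \<otimes>\<^bsub>Q\<^esub> \<phi> x" using that(3) g by (metis p.hom_mult xy(1))
    then have "R g 0" using R_zero[OF g] by blast
    then show ?thesis using that degI[OF _ g] unfolding L_def by auto
  qed
  ultimately show ?thesis using that by blast
qed

section \<open>Symmetric letters\<close>

locale star_field = ordered_grp G lt for G :: "('g, 'b) monoid_scheme" (structure) and lt (infix "\<lessdot>" 50) +
  fixes s :: "'g \<Rightarrow> 'g" and \<sigma> :: "('g \<Rightarrow> 'k::field) \<Rightarrow> ('g \<Rightarrow> 'k)"
  assumes involution: "group_involution G s" and extension: "extending_k_involution G lt s \<sigma>"
begin

abbreviation F :: "('g \<Rightarrow> 'k) set" where "F \<equiv> division_closure G lt"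
abbreviation unit :: "'g \<Rightarrow> 'k" where "unit \<equiv> single \<one> 1"

sublocale A: div_ring MN "MN_mult G" unit by (rule div_ring_MN)

lemma s_closed [simp]: "g \<in> carrier G \<Longrightarrow> s g \<in> carrier G"
  and s_mult: "g \<in> carrier G \<Longrightarrow> h \<in> carrier G \<Longrightarrow> s (g \<otimes> h) = s h \<otimes> s g"
  and s_s [simp]: "g \<in> carrier G \<Longrightarrow> s (s g) = g"
  using involution by (simp_all add: group_involution_def)

lemma s_one [simp]: "s \<one> = \<one>"
  using s_mult[of \<one> \<one>] by simp

lemma s_inv: "g \<in> carrier G \<Longrightarrow> s (inv g) = inv (s g)"
  using s_mult[of g "inv g"] by (intro inv_equality[symmetric]) simp_all

lemma F_A [simp]: "f \<in> F \<Longrightarrow> f \<in> MN"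
proof (induction rule: division_closure.induct)
  case (base f)
  then show ?case by (intro MN_I well_ordered_on_finite) (auto simp: group_algebra_def)
next
  case (add f g)
  then show ?case using MN_add[of f g] by (simp add: plus_fun_def)
next
  case (neg f)
  then show ?case using MN_uminus[of f] by (simp add: fun_Compl_def)
qed simp_all

lemma F_add [simp]: "f \<in> F \<Longrightarrow> g \<in> F \<Longrightarrow> f + g \<in> F"
  using division_closure.add[of f G lt g] by (simp add: plus_fun_def)

lemma F_uminus [simp]: "f \<in> F \<Longrightarrow> - f \<in> F"
  using division_closure.neg[of f G lt] by (simp add: fun_Compl_def)

lemma F_diff [simp]: "f \<in> F \<Longrightarrow> g \<in> F \<Longrightarrow> f - g \<in> F"
  using F_add[of f "- g"] by simp

lemma F_mult [simp]: "f \<in> F \<Longrightarrow> g \<in> F \<Longrightarrow> f \<star> g \<in> F"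
  by (rule division_closure.mult)

lemma single_group_algebra: "g \<in> carrier G \<Longrightarrow> single g c \<in> group_algebra G"
  using supp_single_subset[of g c] by (auto simp: group_algebra_def intro: finite_subset)

lemma F_single [simp]: "g \<in> carrier G \<Longrightarrow> single g c \<in> F"
  by (rule division_closure.base[OF single_group_algebra])

lemma F_rinv [simp]: "f \<in> F \<Longrightarrow> f \<noteq> 0 \<Longrightarrow> A.rinv f \<in> F"
  using A.rinv[of f] by (intro division_closure.inverse[of f G lt "A.rinv f"]) (auto simp: MN_one_eq zero_fun_def)

lemma \<sigma>_F [simp]: "f \<in> F \<Longrightarrow> \<sigma> f \<in> F"
  and \<sigma>_mult: "f \<in> F \<Longrightarrow> g \<in> F \<Longrightarrow> \<sigma> (f \<star> g) = \<sigma> g \<star> \<sigma> f"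
  and \<sigma>_\<sigma> [simp]: "f \<in> F \<Longrightarrow> \<sigma> (\<sigma> f) = f"
  using extension by (simp_all add: extending_k_involution_def)

lemma \<sigma>_linear: "f \<in> F \<Longrightarrow> g \<in> F \<Longrightarrow> \<sigma> (\<lambda>x. a * f x + b * g x) = (\<lambda>x. a * \<sigma> f x + b * \<sigma> g x)"
  using extension by (simp add: extending_k_involution_def)

lemma \<sigma>_add: "f \<in> F \<Longrightarrow> g \<in> F \<Longrightarrow> \<sigma> (f + g) = \<sigma> f + \<sigma> g"
  and \<sigma>_diff: "f \<in> F \<Longrightarrow> g \<in> F \<Longrightarrow> \<sigma> (f - g) = \<sigma> f - \<sigma> g"
  using \<sigma>_linear[of f g 1 1] \<sigma>_linear[of f g 1 "-1"] by (simp_all add: plus_fun_def fun_diff_def)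

lemma \<sigma>_single: assumes "g \<in> carrier G" shows "\<sigma> (single g c) = single (s g) c"
proof -
  have "\<sigma> (single g c) = (\<lambda>x. if x \<in> carrier G then single g c (s x) else 0)"
    using extension single_group_algebra[OF assms, of c] unfolding extending_k_involution_def by blast
  moreover have "s x = g \<longleftrightarrow> x = s g" if "x \<in> carrier G" for x using that assms s_s by metis
  ultimately show ?thesis using assms by (auto simp: single_apply fun_eq_iff)
qed

lemma \<sigma>_rinv:
  assumes "f \<in> F" "f \<noteq> 0" shows "\<sigma> (A.rinv f) = A.rinv (\<sigma> f)"
proof -
  have "\<sigma> (A.rinv f) \<star> \<sigma> f = \<sigma> (f \<star> A.rinv f)" using assms by (intro \<sigma>_mult[symmetric]) simp_all
  also have "\<dots> = unit" using assms by (simp add: \<sigma>_single)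
  finally show ?thesis using assms A.rinv_unique'[of "\<sigma> f" "\<sigma> (A.rinv f)"] by simp
qed

text \<open>Square roots are unique in an ordered group, and \<open>g\<close> and its conjugate by
  \<open>h\<close> have the same square.\<close>

lemma square_commute:
  assumes g: "g \<in> carrier G" "h \<in> carrier G" and e: "(g \<otimes> g) \<otimes> h = h \<otimes> (g \<otimes> g)"
  shows "g \<otimes> h = h \<otimes> g"
proof -
  let ?k = "h \<otimes> g \<otimes> inv h"
  have k: "?k \<in> carrier G" using g by simp
  have kk: "?k \<otimes> ?k = g \<otimes> g"
  proof -
    have "?k \<otimes> ?k = (h \<otimes> (g \<otimes> g)) \<otimes> inv h" using g by (simp add: m_assoc)
    then show ?thesis using g by (simp add: e[symmetric] m_assoc)
  qed
  have "?k = g"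
  proof (rule ccontr)
    assume "?k \<noteq> g"
    then consider "?k \<lessdot> g" | "g \<lessdot> ?k" using lt_total[OF k g(1)] by blast
    then show False
    proof cases
      case 1
      then have "?k \<otimes> ?k \<lessdot> g \<otimes> g" using lt_mult[OF k k g(1) g(1)] lt_asym[OF k g(1)] by blast
      then show False using kk lt_irrefl[of "g \<otimes> g"] g by simp
    next
      case 2
      then have "g \<otimes> g \<lessdot> ?k \<otimes> ?k" using lt_mult[OF g(1) g(1) k k] lt_asym[OF g(1) k] by blast
      then show False using kk lt_irrefl[of "g \<otimes> g"] g by simp
    qed
  qed
  then have "h \<otimes> g \<otimes> inv h \<otimes> h = g \<otimes> h" by simp
  then show ?thesis using g by (simp add: m_assoc)
qed

end

text \<open>If \<open>s x = x\<close>, a letter is a palindrome under the involution as soon as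
  \<open>lam\<close> and \<open>lam'\<close> are exchanged. If \<open>s x = inv x\<close>, then
  \<open>\<sigma> q = - q t'\<close>, and the conjugation by \<open>t\<close> in the condition on
  \<open>lam'\<close> absorbs the stray powers of \<open>t\<close>.\<close>

locale star_letters = star_field G lt s \<sigma> + free_letters "MN_series G lt" "MN_mult G" "single \<one> 1" K "single x 1" p \<tau> \<tau>' lam lam' \<kappa> d e
  for G :: "('g, 'b) monoid_scheme" (structure) and lt s and \<sigma> :: "('g \<Rightarrow> 'k::field) \<Rightarrow> ('g \<Rightarrow> 'k)"
    and K :: "('g \<Rightarrow> 'k) set" and x p \<tau> \<tau>' and lam lam' \<kappa> :: "'g \<Rightarrow> 'k" and d e +
  assumes x_G: "x \<in> carrier G"
    and lam_F: "lam \<in> F" and lam'_F: "lam' \<in> F" and \<kappa>_F: "\<kappa> \<in> F" and d_F: "d i \<in> F" and \<sigma>_d: "\<sigma> (d i) = e i"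
    and \<sigma>_\<kappa>: "\<sigma> \<kappa> = \<kappa>"
    and star_x: "s x = x \<and> \<sigma> lam = lam' \<or> s x = inv x \<and> lam' = single x 1 \<star> \<sigma> lam \<star> single (inv x) 1"
begin

abbreviation q :: "'g \<Rightarrow> 'k" where "q \<equiv> unit - single x 1"
abbreviation t' :: "'g \<Rightarrow> 'k" where "t' \<equiv> single (inv x) 1"
abbreviation t :: "'g \<Rightarrow> 'k" where "t \<equiv> single x 1"

lemma p_eq: "p = A.rinv q"
  using A.rinv_unique[of q p] p_inverse by (simp add: x_G)

lemma F_closed [simp]: "lam \<in> F" "lam' \<in> F" "\<kappa> \<in> F" "d i \<in> F" "e i \<in> F" "q \<in> F" "p \<in> F" "t \<in> F" "t' \<in> F"
  using lam_F lam'_F \<kappa>_F d_F x_G one_minus_t_nonzero \<sigma>_F[OF d_F[of i]] \<sigma>_d[of i] by (simp_all add: p_eq)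

lemma \<sigma>_e: "\<sigma> (e i) = d i"
  using \<sigma>_d[of i] d_F by (metis \<sigma>_\<sigma>)

lemma letter_symmetric: "\<sigma> (letter (i, False)) = letter (i, False)"
proof -
  have eq: "\<sigma> (letter (i, False)) = d i \<star> (\<sigma> q \<star> (\<sigma> lam' \<star> (\<sigma> p \<star> (\<kappa> \<star> (\<sigma> p \<star> (\<sigma> lam \<star> (\<sigma> q \<star> e i)))))))"
    by (simp add: \<sigma>_mult \<sigma>_d \<sigma>_e \<sigma>_\<kappa> A.assoc)
  have \<sigma>p: "\<sigma> p = A.rinv (\<sigma> q)" unfolding p_eq using one_minus_t_nonzero by (intro \<sigma>_rinv) auto
  from star_x show ?thesis
  proof
    assume x: "s x = x \<and> \<sigma> lam = lam'"
    then have "\<sigma> q = q" using x_G by (simp add: \<sigma>_diff \<sigma>_single)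
    moreover then have "\<sigma> p = p" using \<sigma>p p_eq by simp
    moreover have "\<sigma> lam' = lam" using x by (metis \<sigma>_\<sigma> lam_F)
    ultimately show ?thesis unfolding eq using x by simp
  next
    assume x: "s x = inv x \<and> lam' = t \<star> \<sigma> lam \<star> t'"
    have tt: "t' \<star> (t \<star> z) = z" "t \<star> (t' \<star> z) = z" if "z \<in> MN" for z
      using that x_G A.assoc[of t' t z] A.assoc[of t t' z] by simp_all
    have tt1: "t' \<star> t = unit" "t \<star> t' = unit" using x_G by simp_all
    have \<sigma>t: "\<sigma> t = t'" "\<sigma> t' = t" using x x_G by (simp_all add: \<sigma>_single s_inv)
    have \<sigma>q: "\<sigma> q = unit - t'" using \<sigma>t by (simp add: \<sigma>_diff \<sigma>_single)
    have \<sigma>q1: "\<sigma> q = - (q \<star> t')" and \<sigma>q2: "\<sigma> q = - (t' \<star> q)"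
      unfolding \<sigma>q using tt1 x_G by (simp_all add: A.diffl A.diffr)
    have tq: "t \<star> q = q \<star> t" using x_G by (simp add: A.diffl A.diffr)
    have "t \<star> p = p \<star> (q \<star> (t \<star> p))" using p_cancel(1)[of "t \<star> p"] by simp
    also have "q \<star> (t \<star> p) = t \<star> (q \<star> p)" using tq A.assoc[of q t p] A.assoc[of t q p] x_G by simp
    also have "\<dots> = t" using p_inverse x_G by simp
    finally have tp: "t \<star> p = p \<star> t" .
    have "\<sigma> q \<star> (- (t \<star> p)) = unit"
      unfolding \<sigma>q1 using x_G p_inverse by (simp add: A.assoc tt)
    then have \<sigma>p1: "\<sigma> p = - (t \<star> p)" unfolding \<sigma>p using x_G by (intro A.rinv_unique) simp_all
    then have \<sigma>p2: "\<sigma> p = - (p \<star> t)" using tp by simp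
    have l': "\<sigma> lam' = t \<star> (lam \<star> t')" using x by (simp add: \<sigma>_mult \<sigma>t A.assoc)
    have l: "\<sigma> lam = t' \<star> (lam' \<star> t)" using x tt1 by (simp add: A.assoc tt)
    \<comment> \<open>The signs from \<open>q\<close> and \<open>p\<close> cancel, and each stray
      \<open>t'\<close> meets a \<open>t\<close>: the product is
      \<open>q t' t lam t' t p z\<close>.\<close>
    have 1: "\<sigma> q \<star> (\<sigma> lam' \<star> (\<sigma> p \<star> z)) = q \<star> (lam \<star> (p \<star> z))" if "z \<in> MN" for z
      unfolding \<sigma>q1 \<sigma>p1 l' using that x_G by (simp add: A.assoc tt)
    have 2: "\<sigma> p \<star> (\<sigma> lam \<star> (\<sigma> q \<star> z)) = p \<star> (lam' \<star> (q \<star> z))" if "z \<in> MN" for z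
      unfolding \<sigma>q2 \<sigma>p2 l using that x_G by (simp add: A.assoc tt)
    show ?thesis unfolding eq by (simp add: 1 2)
  qed
qed

lemma letter_F: "letter l \<in> F"
proof -
  have nz: "A.rinv lam \<in> F" "A.rinv lam' \<in> F" "A.rinv \<kappa> \<in> F" "A.rinv (d i) \<in> F" "A.rinv (e i) \<in> F" for i
    using lam_K lam'_K \<kappa>_K d_K e_K by (auto intro!: F_rinv)
  show ?thesis by (cases l rule: letter.cases) (simp_all add: nz)
qed

theorem free_pair:
  assumes "stable M" "unit \<in> M" "p \<notin> M"
  shows "free_symmetric_pair G lt \<sigma> (letter (False, False)) (letter (True, False))"
  unfolding free_symmetric_pair_def MN_one_eq
proof -
  have "word w \<noteq> unit" if "w \<noteq> []" "reduced_word w" for w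
    using reduced_word_nontrivial[OF assms that] .
  then show "letter (False, False) \<in> F \<and> letter (True, False) \<in> F \<and>
      \<sigma> (letter (False, False)) = letter (False, False) \<and> \<sigma> (letter (True, False)) = letter (True, False) \<and>
      (\<exists>u' v'. u' \<in> F \<and> v' \<in> F \<and> letter (False, False) \<star> u' = unit \<and> u' \<star> letter (False, False) = unit \<and>
        letter (True, False) \<star> v' = unit \<and> v' \<star> letter (True, False) = unit \<and>
        (\<forall>w. w \<noteq> [] \<longrightarrow> reduced_word w \<longrightarrow>
           eval_word (MN_mult G) unit (letter (False, False)) u' (letter (True, False)) v' w \<noteq> unit))"
    using letter_F letter_symmetric letter_inverse by blast
qed

end

lemma (in group) conj_eq_iff: "x \<in> carrier G \<Longrightarrow> y \<in> carrier G \<Longrightarrow> x \<otimes> y \<otimes> inv x = y \<longleftrightarrow> x \<otimes> y = y \<otimes> x"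
  by (metis inv_closed inv_solve_right' m_closed)

lemma (in group) mult_inv_eq_one:
  assumes "a \<in> carrier G" "b \<in> carrier G"
  shows "a \<otimes> inv b = \<one> \<longleftrightarrow> a = b" "inv a \<otimes> b = \<one> \<longleftrightarrow> a = b"
  using assms by (metis inv_closed inv_solve_right' l_one one_closed, metis inv_solve_left' one_closed r_one)

lemma (in group) conj_inv: "x \<in> carrier G \<Longrightarrow> y \<in> carrier G \<Longrightarrow> x \<otimes> inv y \<otimes> inv x = inv (x \<otimes> y \<otimes> inv x)"
  by (simp add: inv_mult_group m_assoc)

lemma (in group_hom) heisenberg_pair_noncommuting:
  assumes "heisenberg_pair G H h x y" shows "x \<otimes> y \<noteq> y \<otimes> x"
proof
  assume xy: "x \<otimes> y = y \<otimes> x"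
  obtain c where c: "x \<in> carrier G" "y \<in> carrier G" "c \<in> carrier H" "h x \<otimes>\<^bsub>H\<^esub> h y = c \<otimes>\<^bsub>H\<^esub> (h y \<otimes>\<^bsub>H\<^esub> h x)"
    "\<And>n::nat. n > 0 \<Longrightarrow> c [^]\<^bsub>H\<^esub> n \<noteq> \<one>\<^bsub>H\<^esub>"
    using assms unfolding heisenberg_pair_def by blast
  then have "h x \<otimes>\<^bsub>H\<^esub> h y = h y \<otimes>\<^bsub>H\<^esub> h x" using xy by (metis hom_mult)
  then have "c = \<one>\<^bsub>H\<^esub>" using c(1-4) H.r_cancel_one'[of "h y \<otimes>\<^bsub>H\<^esub> h x" c] by simp
  then show False using c(5)[of 1] by simp
qed

section \<open>Free symmetric pairs from the three configurations\<close>

locale star_graded = star_field G lt s \<sigma> + graded G lt kty L deg x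
  for G :: "('g, 'b) monoid_scheme" (structure) and lt s and \<sigma> :: "('g \<Rightarrow> 'k::field) \<Rightarrow> ('g \<Rightarrow> 'k)"
    and kty :: "'k itself" and L deg x
begin

lemma quot_rinv: "h \<in> L \<Longrightarrow> h \<noteq> \<one> \<Longrightarrow> quot \<epsilon> h = A.rinv (one - single h \<epsilon>)"
  unfolding quot_def using one_minus_single[of h \<epsilon>] by (intro rinv_D_A[symmetric]) auto

lemma quot_F: "h \<in> L \<Longrightarrow> h \<noteq> \<one> \<Longrightarrow> quot \<epsilon> h \<in> F"
  using one_minus_single(2)[of h \<epsilon>] by (simp add: quot_rinv)

lemma \<sigma>_quot:
  assumes "h \<in> L" "h \<noteq> \<one>" "s h \<in> L" shows "\<sigma> (quot \<epsilon> h) = quot \<epsilon> (s h)"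
proof -
  have "s h \<noteq> \<one>" using assms s_s[of h] s_one by (metis L_G)
  then show ?thesis using assms one_minus_single(2)[of h \<epsilon>] by (simp add: quot_rinv \<sigma>_rinv \<sigma>_diff \<sigma>_single)
qed

lemma cayley_F: "h \<in> L \<Longrightarrow> h \<noteq> \<one> \<Longrightarrow> cayley \<epsilon> h \<in> F"
  unfolding cayley_def by (intro F_add F_diff quot_F) simp_all

lemma \<sigma>_cayley:
  assumes "h \<in> L" "h \<noteq> \<one>" "s h \<in> L" shows "\<sigma> (cayley \<epsilon> h) = cayley \<epsilon> (s h)"
proof -
  have "quot \<epsilon> h \<in> F" "one \<in> F" using assms quot_F by auto
  then have "\<sigma> (cayley \<epsilon> h) = \<sigma> (quot \<epsilon> h) + \<sigma> (quot \<epsilon> h) - \<sigma> one"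
    unfolding cayley_def by (simp only: \<sigma>_add \<sigma>_diff F_add)
  then show ?thesis unfolding cayley_def using \<sigma>_quot[OF assms] by (simp only: \<sigma>_single s_one one_closed)
qed

lemma free_symmetric_pair_from_letters:
  assumes "free_letters A (MN_mult G) one D.frac t p (cj x) (cj (inv x)) lam lam' \<kappa> d e"
    and "lam \<in> F" "lam' \<in> F" "\<kappa> \<in> F" "\<And>i. d i \<in> F" "\<And>i. \<sigma> (d i) = e i" "\<sigma> \<kappa> = \<kappa>"
    and "s x = x \<and> \<sigma> lam = lam' \<or> s x = inv x \<and> lam' = t \<star> \<sigma> lam \<star> single (inv x) 1"
  shows "\<exists>u v. free_symmetric_pair G lt \<sigma> u v"
proof -
  have "star_letters G lt s \<sigma> D.frac x p (cj x) (cj (inv x)) lam lam' \<kappa> d e"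
    using assms star_field_axioms x_G by (simp add: star_letters_def star_letters_axioms_def)
  then show ?thesis using star_letters.free_pair[OF _ stable_bounded one_bounded p_not_bounded] by blast
qed

lemma pairing_single_left:
  assumes "a \<in> carrier G" "c \<in> carrier G" "d \<in> carrier G" "a \<otimes> c = \<one>" "a \<otimes> d \<noteq> \<one>"
  shows "pairing (single a 1) one (single c 1 - single d 1)"
  using assms by (intro bexI[of _ \<one>]) (simp_all add: A.diffl A.diffr single_apply)

lemma pairing_single_right:
  assumes "a \<in> carrier G" "b \<in> carrier G" "c \<in> carrier G" "(a \<otimes> c = \<one>) \<noteq> (b \<otimes> c = \<one>)"
  shows "pairing (single a 1 - single b 1) one (single c 1)"
  using assms by (intro bexI[of _ \<one>]) (auto simp: A.diffl A.diffr single_apply)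

text \<open>Of the four terms in the expansion, the first and the last have sign plus, the middle
  two sign minus. The hypothesis makes one term hit \<open>g\<close> and excludes both terms of the
  opposite sign. The remaining term of equal sign may also hit, so the coefficient is 1, 2, -1 or
  -2.\<close>

lemma pairing_differences:
  assumes two: "(2::'k) \<noteq> 0" and G: "a \<in> carrier G" "b \<in> carrier G" "m \<in> carrier G" "c \<in> carrier G" "d \<in> carrier G"
    and g: "g \<in> L" "deg g = 0" "x \<otimes> g = g \<otimes> x"
    and eq: "g = a \<otimes> m \<otimes> c \<and> g \<noteq> a \<otimes> m \<otimes> d \<and> g \<noteq> b \<otimes> m \<otimes> c \<or> g = a \<otimes> m \<otimes> d \<and> g \<noteq> a \<otimes> m \<otimes> c \<and> g \<noteq> b \<otimes> m \<otimes> d"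
  shows "pairing (single a 1 - single b 1) (single m 1) (single c 1 - single d 1)"
proof -
  have expand: "((single a 1 - single b 1) \<star> (single m 1 \<star> (single c 1 - single d 1))) g =
    single (a \<otimes> m \<otimes> c) 1 g - single (a \<otimes> m \<otimes> d) 1 g - (single (b \<otimes> m \<otimes> c) 1 g - single (b \<otimes> m \<otimes> d) (1::'k) g)"
    using G by (simp add: A.diffl A.diffr m_assoc)
  have "- 2 \<noteq> (0::'k)" using two by simp
  then have "((single a 1 - single b 1) \<star> (single m 1 \<star> (single c 1 - single d 1))) g \<noteq> (0::'k)"
    unfolding expand using eq two by (auto simp: single_apply)
  then show ?thesis using g by blast
qed

context
  fixes y
  assumes two: "(2::'k) \<noteq> 0" and y: "y \<in> L" "deg y = 1" and xy: "x \<otimes> y \<noteq> y \<otimes> x"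
begin

lemma conjugates:
  defines "z \<equiv> x \<otimes> y \<otimes> inv x" and "w \<equiv> inv x \<otimes> y \<otimes> x"
  shows "z \<in> carrier G" "w \<in> carrier G" "z \<noteq> y" "w \<noteq> y"
    "x \<otimes> inv y \<otimes> inv x = inv z" "inv x \<otimes> inv y \<otimes> x = inv w" "y \<in> carrier G" "y \<noteq> \<one>"
proof -
  show "y \<noteq> \<one>" using xy by auto
  show G: "y \<in> carrier G" "z \<in> carrier G" "w \<in> carrier G" using y by (auto simp: z_def w_def)
  show "z \<noteq> y" using xy conj_eq_iff[of x y] G by (simp add: z_def)
  show "w \<noteq> y"
  proof
    assume "w = y"
    then have "inv x \<otimes> y = y \<otimes> inv x" using conj_eq_iff[of "inv x" y] G by (simp add: w_def)
    then have "x \<otimes> (inv x \<otimes> y) \<otimes> x = x \<otimes> (y \<otimes> inv x) \<otimes> x" by simp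
    then show False using xy G by (simp add: m_assoc)
  qed
  show "x \<otimes> inv y \<otimes> inv x = inv z" "inv x \<otimes> inv y \<otimes> x = inv w" using conj_inv[of x y] conj_inv[of "inv x" y] G by (auto simp: z_def w_def)
qed

text \<open>As \<open>y\<close> is fixed, \<open>s\<close> preserves degrees of its powers, and the
  polynomials \<open>1 + y\<close> and \<open>1 - y\<close> are themselves symmetric. All
  coefficients are tested at the identity.\<close>

lemma free_pair_symmetric:
  assumes s: "s x = x" "s y = y" shows "\<exists>u v. free_symmetric_pair G lt \<sigma> u v"
proof (rule free_symmetric_pair_from_letters)
  define Z W where "Z = x \<otimes> y \<otimes> inv x" and "W = inv x \<otimes> y \<otimes> x"
  note zw = conjugates[folded Z_def W_def]
  have c1: "pairing (single (inv y) 1 - single (inv W) 1) (single (y \<otimes> y) 1) (single (inv y) 1 - single (inv Z) 1)"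
    by (rule pairing_differences[where g = \<one>, OF two]) (use zw(1-4,7) in \<open>simp_all add: m_assoc mult_inv_eq_one eq_commute[of \<one>]\<close>)
  have c2: "pairing (single y 1) one (single (inv y) 1 - single (inv Z) 1)"
    by (rule pairing_single_left) (use zw(1-4,7) in \<open>auto simp: mult_inv_eq_one\<close>)
  have c3: "pairing (single (inv y) 1 - single (inv W) 1) one (single y 1)"
    by (rule pairing_single_right) (use zw(1-4,7) in \<open>auto simp: mult_inv_eq_one\<close>)
  have c4: "pairing (single y 1 - single W 1) (single (inv y \<otimes> inv y) 1) (single y 1 - single Z 1)"
    by (rule pairing_differences[where g = \<one>, OF two]) (use zw(1-4,7) in \<open>simp_all add: m_assoc mult_inv_eq_one eq_commute[of \<one>]\<close>)
  show "free_letters A (MN_mult G) one D.frac t p (cj x) (cj (inv x)) (single (inv y) 1) (single (inv y) 1)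
    (quot (- 1) (inv y \<otimes> inv y)) (\<lambda>i. one + single y (if i then 1 else - 1)) (\<lambda>i. one + single y (if i then 1 else - 1))"
    by (rule free_letters_preserving[OF two y refl refl refl refl]; unfold zw(5,6) Z_def[symmetric] W_def[symmetric] zw)
      (fact c1 c2 c3 c4)+
  have "inv y \<otimes> inv y \<noteq> \<one>" using deg_mult[of "inv y" "inv y"] deg_inv[of y] y by auto
  then show "quot (- 1) (inv y \<otimes> inv y) \<in> F" "\<sigma> (quot (- 1) (inv y \<otimes> inv y)) = quot (- 1) (inv y \<otimes> inv y)"
    using s y zw by (simp_all add: quot_F \<sigma>_quot s_mult s_inv)
qed (use s y conjugates  in \<open>simp_all add: \<sigma>_add \<sigma>_single s_inv\<close>)

text \<open>With \<open>lam\<close> given by \<open>inv y\<close>, the twisted condition forces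
  \<open>lam'\<close> to be the conjugate \<open>x y x\<^sup>-\<^sup>1\<close>. The differences then
  consist of \<open>y\<close>, \<open>Z\<close> and their inverses, and in \<open>c1\<close> and
  \<open>c4\<close> the coefficient at the identity is -2.\<close>

lemma free_pair_inverted:
  assumes s: "s x = inv x" "s y = inv y" shows "\<exists>u v. free_symmetric_pair G lt \<sigma> u v"
proof (rule free_symmetric_pair_from_letters)
  define Z where "Z = x \<otimes> y \<otimes> inv x"
  note zw = conjugates[folded Z_def]
  have ZL: "Z \<in> L" "deg Z = 1" unfolding Z_def using y x_L deg_x by auto
  have ZG: "inv x \<otimes> Z \<otimes> x = y" "inv x \<otimes> inv Z \<otimes> x = inv y"
    unfolding zw(5)[symmetric] unfolding Z_def using zw(7) by (simp_all add: m_assoc)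
  have c1: "pairing (single Z 1 - single y 1) one (single (inv y) 1 - single (inv Z) 1)"
    by (rule pairing_differences[where g = \<one>, OF two]) (use zw(1-4,7) in \<open>simp_all add: m_assoc mult_inv_eq_one eq_commute[of \<one>]\<close>)
  have c2: "pairing (single y 1) one (single (inv y) 1 - single (inv Z) 1)"
    by (rule pairing_single_left) (use zw(1-4,7) in \<open>auto simp: mult_inv_eq_one\<close>)
  have c3: "pairing (single Z 1 - single y 1) one (single (inv y) 1)"
    by (rule pairing_single_right) (use zw(1-4,7) in \<open>auto simp: mult_inv_eq_one\<close>)
  have c4: "pairing (single (inv Z) 1 - single (inv y) 1) one (single y 1 - single Z 1)"
    by (rule pairing_differences[where g = \<one>, OF two]) (use zw(1-4,7) in \<open>simp_all add: m_assoc mult_inv_eq_one eq_commute[of \<one>]\<close>)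
  have y': "inv y \<in> L" "deg (inv y) = -1" using y deg_inv by auto
  show "free_letters A (MN_mult G) one D.frac t p (cj x) (cj (inv x)) (single (inv y) 1) (single Z 1)
    one (\<lambda>i. if i then cayley 1 y else one) (\<lambda>i. if i then cayley 1 (inv y) else one)"
    by (rule free_letters_reversing[OF two y y' ZL refl refl refl refl]; unfold zw(5) ZG Z_def[symmetric])
      (fact c1 c2 c3 c4)+
  show "\<sigma> (if i then cayley 1 y else one) = (if i then cayley 1 (inv y) else one)" for i
    using y y' zw \<sigma>_cayley[of y 1] s by (simp add: \<sigma>_single)
  show "s x = x \<and> \<sigma> (single (inv y) 1) = single Z 1 \<or> s x = inv x \<and> single Z 1 = t \<star> \<sigma> (single (inv y) 1) \<star> single (inv x) 1"
    using s zw by (simp add: \<sigma>_single s_inv Z_def)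
qed (use s y conjugates x_L in \<open>simp_all add: \<sigma>_add \<sigma>_single s_inv cayley_F\<close>)

text \<open>Here \<open>s y = inv y \<otimes> c\<close> with \<open>c\<close> of degree zero
  commuting with \<open>x\<close>, so \<open>s\<close> reverses the degree of \<open>y\<close>
  although it fixes \<open>x\<close>. The factor \<open>c\<close> moves two of the tests away from
  the identity.\<close>

lemma free_pair_mixed:
  assumes s: "s x = x" and c: "y \<otimes> s y \<in> L" "deg (y \<otimes> s y) = 0" "x \<otimes> (y \<otimes> s y) = (y \<otimes> s y) \<otimes> x"
    "x \<otimes> (s y \<otimes> y) = (s y \<otimes> y) \<otimes> x"
  shows "\<exists>u v. free_symmetric_pair G lt \<sigma> u v"
proof (rule free_symmetric_pair_from_letters)
  define Z W where "Z = x \<otimes> y \<otimes> inv x" and "W = inv x \<otimes> y \<otimes> x"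
  note zw = conjugates[folded Z_def W_def]
  define c where "c = y \<otimes> s y"
  have cL: "c \<in> L" "deg c = 0" "x \<otimes> c = c \<otimes> x" "c \<in> carrier G" unfolding c_def using c by auto
  have sy: "s y = inv y \<otimes> c" unfolding c_def using zw by simp
  have cx: "inv c \<otimes> x = x \<otimes> inv c" "inv x \<otimes> inv c = inv c \<otimes> inv x"
  proof -
    have "inv c \<otimes> (x \<otimes> c) \<otimes> inv c = inv c \<otimes> (c \<otimes> x) \<otimes> inv c" using cL(3) by simp
    then show "inv c \<otimes> x = x \<otimes> inv c" using cL(4) by (simp add: m_assoc)
    have "inv (x \<otimes> c) = inv (c \<otimes> x)" using cL(3) by simp
    then show "inv x \<otimes> inv c = inv c \<otimes> inv x" using cL(4) by (simp add: inv_mult_group)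
  qed
  define l where "l = inv c \<otimes> y"
  have lG: "inv (s y) = l" unfolding sy l_def using zw cL by (simp add: inv_mult_group)
  have y': "s y \<in> L" "deg (s y) = -1" unfolding sy using y cL deg_inv by (auto simp: deg_mult)
  have l: "l \<in> L" "deg l = 1" unfolding l_def using y cL deg_inv by (auto simp: deg_mult)
  have xl: "inv x \<otimes> l \<otimes> x = inv c \<otimes> W"
    unfolding l_def W_def using zw(7) cL(4) by (simp add: m_assoc[symmetric] cx)
  have l': "inv l = inv y \<otimes> c" using lG sy zw by (metis inv_inv s_closed)
  have xl': "inv x \<otimes> (inv y \<otimes> c) \<otimes> x = inv W \<otimes> c"
    using zw(7) cL(3,4) by (simp add: zw(6)[symmetric] m_assoc)
  \<comment> \<open>The product of \<open>l = inv c \<otimes> y\<close> with \<open>inv y\<close> is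
    \<open>inv c\<close>, so the coefficient is tested there.\<close>
  have c1: "pairing (single l 1 - single (inv c \<otimes> W) 1) one (single (inv y) 1 - single (inv Z) 1)"
    by (rule pairing_differences[where g = "inv c", OF two]) (use zw(1-4,7) cL cx deg_inv in \<open>simp_all add: m_assoc l_def mult_inv_eq_one eq_commute[of \<one>]\<close>)
  have c2: "pairing (single y 1) one (single (inv y) 1 - single (inv Z) 1)"
    by (rule pairing_single_left) (use zw(1-4,7) in \<open>auto simp: mult_inv_eq_one\<close>)
  have c3: "pairing (single l 1 - single (inv c \<otimes> W) 1) one (single (s y) 1)"
  proof (rule pairing_single_right)
    have "inv c \<otimes> ((W \<otimes> inv y) \<otimes> c) \<noteq> \<one>"
      using zw(2,4,7) cL(4) inv_solve_left'[of c "(W \<otimes> inv y) \<otimes> c" \<one>] r_cancel_one[of c "W \<otimes> inv y"]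
      by (simp add: mult_inv_eq_one)
    then show "(l \<otimes> s y = \<one>) \<noteq> (inv c \<otimes> W \<otimes> s y = \<one>)"
      using zw(2,7) cL(4) by (simp add: l_def sy m_assoc)
  qed (use zw(2,7) l y' cL(4) in auto)
  have inv_eq_W: "inv y \<noteq> inv W" using zw(2,4,7) by (metis inv_inv)
  \<comment> \<open>Now \<open>inv l \<otimes> y\<close> equals \<open>s y \<otimes> y\<close>, a
    conjugate of \<open>c\<close> by \<open>y\<close>; that it commutes with \<open>x\<close> is the
    last assumption.\<close>
  have c4: "pairing (single (inv y \<otimes> c) 1 - single (inv W \<otimes> c) 1) one (single y 1 - single Z 1)"
    by (rule pairing_differences[where g = "s y \<otimes> y", OF two]) (use zw(1-4,7) inv_eq_W cL c(4) y y' deg_inv in \<open>simp_all add: m_assoc sy deg_mult\<close>)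
  show "free_letters A (MN_mult G) one D.frac t p (cj x) (cj (inv x)) (single (inv y) 1) (single l 1)
    one (\<lambda>i. if i then cayley 1 y else one) (\<lambda>i. if i then cayley 1 (s y) else one)"
    by (rule free_letters_reversing[OF two y y' l refl refl refl refl]; unfold xl xl' zw(5) l' Z_def[symmetric])
      (fact c1 c2 c3 c4)+
  show "\<sigma> (if i then cayley 1 y else one) = (if i then cayley 1 (s y) else one)" for i
    using y y' zw \<sigma>_cayley[of y 1] by (simp add: \<sigma>_single)
  show "single l 1 \<in> F" using l by simp
  show "s x = x \<and> \<sigma> (single (inv y) 1) = single l 1 \<or> s x = inv x \<and> single l 1 = t \<star> \<sigma> (single (inv y) 1) \<star> single (inv x) 1"
    using s zw lG by (simp add: \<sigma>_single s_inv)
qed (use s y conjugates in \<open>simp_all add: \<sigma>_add \<sigma>_single s_inv cayley_F\<close>)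

end

end

section \<open>Pairs adapted to the involution\<close>

context star_field
begin

lemma star_pair_exists:
  assumes res: "residually_tfn G" and nonab: "nonabelian G"
  obtains Q :: "'g set monoid" and \<phi> x y where "group_hom G Q \<phi>" "heisenberg_pair G Q \<phi> x y"
    "s x = x \<and> s y = y \<or> s x = inv x \<and> s y = inv y \<or>
     s x = x \<and> \<phi> (y \<otimes> s y) \<otimes>\<^bsub>Q\<^esub> \<phi> y = \<phi> y \<otimes>\<^bsub>Q\<^esub> \<phi> (y \<otimes> s y) \<and>
       x \<otimes> (y \<otimes> s y) = (y \<otimes> s y) \<otimes> x \<and> x \<otimes> (s y \<otimes> y) = (s y \<otimes> y) \<otimes> x"
proof -
  define Sym where "Sym = {a \<in> carrier G. s a = a}"
  have SymG: "Sym \<subseteq> carrier G" unfolding Sym_def by blast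
  have norm: "g \<otimes> s g \<in> Sym" if "g \<in> carrier G" for g
    unfolding Sym_def using that by (simp add: s_mult)
  consider (B0) a b where "a \<in> Sym" "b \<in> Sym" "a \<otimes> b \<noteq> b \<otimes> a"
    | (B1) a y where "\<forall>a\<in>Sym. \<forall>b\<in>Sym. a \<otimes> b = b \<otimes> a" "a \<in> Sym" "y \<in> carrier G" "a \<otimes> y \<noteq> y \<otimes> a"
    | (C) "\<forall>a\<in>Sym. \<forall>g\<in>carrier G. a \<otimes> g = g \<otimes> a"
    by blast
  then show ?thesis
  proof cases
    case B0
    then have ab: "a \<in> carrier G" "b \<in> carrier G" "s a = a" "s b = b" by (auto simp: Sym_def)
    have "{a} \<subseteq> carrier G" using ab by simp
    then obtain Q :: "'g set monoid" and \<phi> x where "group_hom G Q \<phi>" "x \<in> {a}" "heisenberg_pair G Q \<phi> x b"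
      by (rule heisenberg_pair_exists[OF res ab(2) _ _ B0(3)]) auto
    then show ?thesis using that[of Q \<phi> a b] ab by auto
  next
    case C
    \<comment> \<open>In this case \<open>g \<otimes> s g\<close> is central, so \<open>g\<close>
      commutes with \<open>s g\<close> and \<open>r g\<close> is \<open>g\<close> times the inverse
      of \<open>s g\<close>, which \<open>s\<close> inverts.\<close>
    define r where "r g = g \<otimes> g \<otimes> inv (g \<otimes> s g)" for g
    have r: "r g \<in> carrier G" "s (r g) = inv (r g)" if "g \<in> carrier G" for g
    proof -
      have c: "g \<otimes> (g \<otimes> s g) = (g \<otimes> s g) \<otimes> g" using C[rule_format, OF norm[OF that] that] by (rule sym)
      then have "g \<otimes> s g = s g \<otimes> g" using that by (simp add: m_assoc)
      then have "inv g \<otimes> (g \<otimes> s g) \<otimes> inv g = inv g \<otimes> (s g \<otimes> g) \<otimes> inv g" by simp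
      then have sg: "s g \<otimes> inv g = inv g \<otimes> s g" using that by (simp add: m_assoc)
      then have "s g \<otimes> (inv g \<otimes> inv g) = inv g \<otimes> (inv g \<otimes> s g)"
        using that m_assoc[of "s g" "inv g" "inv g"] m_assoc[of "inv g" "s g" "inv g"] by simp
      moreover from sg have "inv g \<otimes> (s g \<otimes> s g) = s g \<otimes> (inv g \<otimes> s g)" using that by (simp add: m_assoc[symmetric])
      ultimately show "r g \<in> carrier G" "s (r g) = inv (r g)"
        unfolding r_def using that by (simp_all add: s_mult s_inv inv_mult_group m_assoc)
    qed
    \<comment> \<open>The square of \<open>g\<close> is \<open>r g\<close> times a central element,
      so whatever commutes with \<open>r g\<close> commutes with that square, hence with
      \<open>g\<close>. Applied twice, it shows that \<open>r g\<close> and \<open>r h\<close> do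
      not commute when \<open>g\<close> and \<open>h\<close> do not.\<close>
    have comm: "g \<otimes> h = h \<otimes> g" if gh: "g \<in> carrier G" "h \<in> carrier G" "r g \<otimes> h = h \<otimes> r g" for g h
    proof -
      have c: "(g \<otimes> s g) \<otimes> h = h \<otimes> (g \<otimes> s g)" using C[rule_format, OF norm[OF gh(1)] gh(2)] .
      have rg: "r g \<otimes> (g \<otimes> s g) = g \<otimes> g" unfolding r_def using gh by (simp add: m_assoc)
      have "(g \<otimes> g) \<otimes> h = r g \<otimes> ((g \<otimes> s g) \<otimes> h)" using m_assoc[of "r g" "g \<otimes> s g" h] rg gh r by simp
      also have "\<dots> = (r g \<otimes> h) \<otimes> (g \<otimes> s g)" unfolding c using gh(1,2) r(1) by (simp add: m_assoc)
      also have "\<dots> = h \<otimes> (g \<otimes> g)" unfolding gh(3) using m_assoc[of h "r g" "g \<otimes> s g"] rg gh(1,2) r(1) by simp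
      finally show ?thesis by (rule square_commute[OF gh(1,2)])
    qed
    obtain g h where gh: "g \<in> carrier G" "h \<in> carrier G" "g \<otimes> h \<noteq> h \<otimes> g"
      using nonab unfolding nonabelian_def by blast
    have "r g \<otimes> r h \<noteq> r h \<otimes> r g"
    proof
      assume "r g \<otimes> r h = r h \<otimes> r g"
      then have "g \<otimes> r h = r h \<otimes> g" by (rule comm[OF gh(1) r(1)[OF gh(2)]])
      then show False using comm[OF gh(2,1)] gh(3) by (metis (full_types))
    qed
    then have ne: "r g \<in> {r g}" "r g \<otimes> r h \<noteq> r h \<otimes> r g" by simp_all
    have "{r g} \<subseteq> carrier G" using r gh by simp
    then obtain Q :: "'g set monoid" and \<phi> x where "group_hom G Q \<phi>" "x \<in> {r g}" "heisenberg_pair G Q \<phi> x (r h)"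
      by (rule heisenberg_pair_exists[OF res r(1)[OF gh(2)] _ ne])
    then show ?thesis using r gh by (intro that[of Q \<phi> "r g" "r h"]) simp_all
  next
    case B1
    then have abelian: "a \<otimes> b = b \<otimes> a" if "a \<in> Sym" "b \<in> Sym" for a b using that by blast
    obtain Q :: "'g set monoid" and \<phi> x where Q: "group_hom G Q \<phi>" "x \<in> Sym" "heisenberg_pair G Q \<phi> x y"
      and central: "\<And>b h. b \<in> Sym \<Longrightarrow> h \<in> carrier G \<Longrightarrow> \<phi> (commutator b y) \<otimes>\<^bsub>Q\<^esub> \<phi> h = \<phi> h \<otimes>\<^bsub>Q\<^esub> \<phi> (commutator b y)"
      by (rule heisenberg_pair_exists[OF res B1(3) SymG B1(2,4)]) (rule that; assumption)
    interpret p: group_hom G Q \<phi> by (rule Q(1))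
    have xG: "x \<in> carrier G" using Q(2) SymG by blast
    define c where "c = y \<otimes> s y"
    have c: "c \<in> Sym" "c \<in> carrier G" unfolding c_def using norm[OF B1(3)] B1(3) by auto
    then have ic: "inv c \<in> Sym" unfolding Sym_def using s_inv[of c] by simp
    have sy: "s y = inv y \<otimes> c" unfolding c_def using B1(3) by simp
    \<comment> \<open>The norm \<open>y \<otimes> s y\<close> need not commute with \<open>y\<close>
      modulo the kernel. The choice of \<open>v\<close> turns the norm into the commutator of
      \<open>inv c\<close> with \<open>y\<close>, where \<open>inv c\<close> is symmetric, and such
      commutators are central modulo the kernel.\<close>
    define v where "v = inv c \<otimes> (y \<otimes> y)"
    have v: "v \<in> carrier G" unfolding v_def using c B1(3) by simp
    have vs: "v \<otimes> s v = commutator (inv c) y"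
    proof -
      have "s v = (s y \<otimes> s y) \<otimes> inv c" unfolding v_def using c B1(3) ic by (simp add: s_mult Sym_def)
      then show ?thesis unfolding v_def sy commutator_def using c B1(3) by (simp add: m_assoc)
    qed
    obtain e where e: "e \<in> carrier Q" "\<And>g. g \<in> carrier G \<Longrightarrow> e \<otimes>\<^bsub>Q\<^esub> \<phi> g = \<phi> g \<otimes>\<^bsub>Q\<^esub> e"
      "\<And>n::nat. n > 0 \<Longrightarrow> e [^]\<^bsub>Q\<^esub> n \<noteq> \<one>\<^bsub>Q\<^esub>" "\<phi> x \<otimes>\<^bsub>Q\<^esub> \<phi> y = e \<otimes>\<^bsub>Q\<^esub> (\<phi> y \<otimes>\<^bsub>Q\<^esub> \<phi> x)"
      using Q(3)[unfolded heisenberg_pair_def] by (elim conjE bexE) (rule that; simp)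
    have "heisenberg_pair G Q \<phi> x v"
      unfolding heisenberg_pair_def
    proof (intro conjI bexI[of _ "e \<otimes>\<^bsub>Q\<^esub> e"] ballI allI impI)
      let ?X = "\<phi> x" and ?Y = "\<phi> y" and ?C = "\<phi> (inv c)"
      have cl: "?X \<in> carrier Q" "?Y \<in> carrier Q" "?C \<in> carrier Q" using xG B1(3) c by auto
      have XC: "?X \<otimes>\<^bsub>Q\<^esub> ?C = ?C \<otimes>\<^bsub>Q\<^esub> ?X" using abelian[OF Q(2) ic] xG c by (metis inv_closed p.hom_mult)
      have V: "\<phi> v = ?C \<otimes>\<^bsub>Q\<^esub> (?Y \<otimes>\<^bsub>Q\<^esub> ?Y)" unfolding v_def using B1(3) c by simp
      have "?X \<otimes>\<^bsub>Q\<^esub> \<phi> v = ?C \<otimes>\<^bsub>Q\<^esub> ((?X \<otimes>\<^bsub>Q\<^esub> ?Y) \<otimes>\<^bsub>Q\<^esub> ?Y)"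
        unfolding V using cl XC by (metis p.H.m_assoc p.H.m_closed)
      also have "\<dots> = ?C \<otimes>\<^bsub>Q\<^esub> (e \<otimes>\<^bsub>Q\<^esub> (?Y \<otimes>\<^bsub>Q\<^esub> (?X \<otimes>\<^bsub>Q\<^esub> ?Y)))"
        by (subst (1) e(4)) (use cl e(1) in \<open>simp add: p.H.m_assoc\<close>)
      also have "\<dots> = (?C \<otimes>\<^bsub>Q\<^esub> e) \<otimes>\<^bsub>Q\<^esub> ((?Y \<otimes>\<^bsub>Q\<^esub> e) \<otimes>\<^bsub>Q\<^esub> (?Y \<otimes>\<^bsub>Q\<^esub> ?X))" unfolding e(4) using cl e(1) by (simp add: p.H.m_assoc)
      also have "?Y \<otimes>\<^bsub>Q\<^esub> e = e \<otimes>\<^bsub>Q\<^esub> ?Y" using e(2)[OF B1(3)] by simp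
      also have "?C \<otimes>\<^bsub>Q\<^esub> e = e \<otimes>\<^bsub>Q\<^esub> ?C" using e(2)[of "inv c"] c by simp
      also have "(e \<otimes>\<^bsub>Q\<^esub> ?C) \<otimes>\<^bsub>Q\<^esub> ((e \<otimes>\<^bsub>Q\<^esub> ?Y) \<otimes>\<^bsub>Q\<^esub> (?Y \<otimes>\<^bsub>Q\<^esub> ?X)) = e \<otimes>\<^bsub>Q\<^esub> ((?C \<otimes>\<^bsub>Q\<^esub> e) \<otimes>\<^bsub>Q\<^esub> (?Y \<otimes>\<^bsub>Q\<^esub> (?Y \<otimes>\<^bsub>Q\<^esub> ?X)))"
        using cl e(1) by (simp add: p.H.m_assoc)
      also have "?C \<otimes>\<^bsub>Q\<^esub> e = e \<otimes>\<^bsub>Q\<^esub> ?C" using e(2)[of "inv c"] c by simp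
      finally show "?X \<otimes>\<^bsub>Q\<^esub> \<phi> v = (e \<otimes>\<^bsub>Q\<^esub> e) \<otimes>\<^bsub>Q\<^esub> (\<phi> v \<otimes>\<^bsub>Q\<^esub> ?X)"
        unfolding V using cl e(1) by (simp add: p.H.m_assoc)
    next
      fix g assume "g \<in> carrier G"
      then show "(e \<otimes>\<^bsub>Q\<^esub> e) \<otimes>\<^bsub>Q\<^esub> \<phi> g = \<phi> g \<otimes>\<^bsub>Q\<^esub> (e \<otimes>\<^bsub>Q\<^esub> e)"
        using e(1,2) by (metis p.H.m_assoc p.hom_closed)
    next
      fix n :: nat assume "n > 0"
      moreover have "(e \<otimes>\<^bsub>Q\<^esub> e) [^]\<^bsub>Q\<^esub> n = e [^]\<^bsub>Q\<^esub> (2 * n)"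
        using p.H.nat_pow_pow[OF e(1), of 2 n] e(1) by (simp add: numeral_2_eq_2)
      ultimately show "(e \<otimes>\<^bsub>Q\<^esub> e) [^]\<^bsub>Q\<^esub> n \<noteq> \<one>\<^bsub>Q\<^esub>" using e(3)[of "2 * n"] by simp
    qed (use xG v e(1) in auto)
    moreover have "s x = x" using Q(2) by (simp add: Sym_def)
    moreover have "\<phi> (v \<otimes> s v) \<otimes>\<^bsub>Q\<^esub> \<phi> v = \<phi> v \<otimes>\<^bsub>Q\<^esub> \<phi> (v \<otimes> s v)" unfolding vs using central[OF ic v] .
    moreover have "x \<otimes> (v \<otimes> s v) = (v \<otimes> s v) \<otimes> x" using abelian[OF Q(2) norm[OF v]] .
    moreover have "s v \<otimes> v \<in> Sym" using norm[of "s v"] v by simp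
    then have "x \<otimes> (s v \<otimes> v) = (s v \<otimes> v) \<otimes> x" using abelian[OF Q(2)] by blast
    ultimately show ?thesis by (intro that[OF Q(1), of x v]) simp_all
  qed
qed

end

theorem theorem1p6:
  fixes G :: "('g, 'b) monoid_scheme"
    and lt :: "'g \<Rightarrow> 'g \<Rightarrow> bool"
    and s :: "'g \<Rightarrow> 'g"
    and \<sigma> :: "('g \<Rightarrow> 'k::field) \<Rightarrow> ('g \<Rightarrow> 'k)"
  assumes "(2::'k) \<noteq> 0"
    and "group G"
    and "nonabelian G"
    and "residually_tfn G"
    and "group_involution G s"
    and "ordered_group G lt"
    and "extending_k_involution G lt s \<sigma>"
  shows "\<exists>u v. free_symmetric_pair G lt \<sigma> u v"
proof -
  interpret group G by fact
  have og: "ordered_grp G lt"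
    using assms(2,6) by (simp add: ordered_grp_def ordered_grp_axioms_def)
  then interpret star_field G lt s \<sigma>
    using assms(5,7) by (simp add: star_field_def star_field_axioms_def)
  obtain Q :: "'g set monoid" and \<phi> x0 y where Q: "group_hom G Q \<phi>" and hp0: "heisenberg_pair G Q \<phi> x0 y"
    and st0: "s x0 = x0 \<and> s y = y \<or> s x0 = inv\<^bsub>G\<^esub> x0 \<and> s y = inv\<^bsub>G\<^esub> y \<or>
     s x0 = x0 \<and> \<phi> (y \<otimes>\<^bsub>G\<^esub> s y) \<otimes>\<^bsub>Q\<^esub> \<phi> y = \<phi> y \<otimes>\<^bsub>Q\<^esub> \<phi> (y \<otimes>\<^bsub>G\<^esub> s y) \<and>
       x0 \<otimes>\<^bsub>G\<^esub> (y \<otimes>\<^bsub>G\<^esub> s y) = (y \<otimes>\<^bsub>G\<^esub> s y) \<otimes>\<^bsub>G\<^esub> x0 \<and> x0 \<otimes>\<^bsub>G\<^esub> (s y \<otimes>\<^bsub>G\<^esub> y) = (s y \<otimes>\<^bsub>G\<^esub> y) \<otimes>\<^bsub>G\<^esub> x0"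
    by (rule star_pair_exists[OF assms(4,3)])
  interpret p: group_hom G Q \<phi> by (rule Q)
  have x0y: "x0 \<in> carrier G" "y \<in> carrier G" using hp0 by (auto simp: heisenberg_pair_def)
  have "x0 \<noteq> \<one>\<^bsub>G\<^esub>" using p.heisenberg_pair_noncommuting[OF hp0] x0y by auto
  have commute_inv: "inv\<^bsub>G\<^esub> x0 \<otimes>\<^bsub>G\<^esub> h = h \<otimes>\<^bsub>G\<^esub> inv\<^bsub>G\<^esub> x0" if "h \<in> carrier G" "x0 \<otimes>\<^bsub>G\<^esub> h = h \<otimes>\<^bsub>G\<^esub> x0" for h
  proof -
    have "inv\<^bsub>G\<^esub> x0 \<otimes>\<^bsub>G\<^esub> (x0 \<otimes>\<^bsub>G\<^esub> h) \<otimes>\<^bsub>G\<^esub> inv\<^bsub>G\<^esub> x0 = inv\<^bsub>G\<^esub> x0 \<otimes>\<^bsub>G\<^esub> (h \<otimes>\<^bsub>G\<^esub> x0) \<otimes>\<^bsub>G\<^esub> inv\<^bsub>G\<^esub> x0"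
      using that(2) by simp
    then show ?thesis using that(1) x0y(1) by (simp add: m_assoc)
  qed
  \<comment> \<open>The geometric series for \<open>p\<close> requires \<open>x\<close> above the
    identity. Each of the three alternatives survives replacing \<open>x0\<close> by its
    inverse.\<close>
  obtain x where pos: "lt \<one>\<^bsub>G\<^esub> x" and hp: "heisenberg_pair G Q \<phi> x y"
    and st: "s x = x \<and> s y = y \<or> s x = inv\<^bsub>G\<^esub> x \<and> s y = inv\<^bsub>G\<^esub> y \<or>
     s x = x \<and> \<phi> (y \<otimes>\<^bsub>G\<^esub> s y) \<otimes>\<^bsub>Q\<^esub> \<phi> y = \<phi> y \<otimes>\<^bsub>Q\<^esub> \<phi> (y \<otimes>\<^bsub>G\<^esub> s y) \<and>
       x \<otimes>\<^bsub>G\<^esub> (y \<otimes>\<^bsub>G\<^esub> s y) = (y \<otimes>\<^bsub>G\<^esub> s y) \<otimes>\<^bsub>G\<^esub> x \<and> x \<otimes>\<^bsub>G\<^esub> (s y \<otimes>\<^bsub>G\<^esub> y) = (s y \<otimes>\<^bsub>G\<^esub> y) \<otimes>\<^bsub>G\<^esub> x"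
  proof (cases "lt \<one>\<^bsub>G\<^esub> x0")
    case True
    then show ?thesis by (rule that[OF _ hp0 st0])
  next
    case False
    then have "lt x0 \<one>\<^bsub>G\<^esub>" using \<open>x0 \<noteq> \<one>\<^bsub>G\<^esub>\<close> lt_total[OF x0y(1) one_closed] False by simp
    then have "lt \<one>\<^bsub>G\<^esub> (inv\<^bsub>G\<^esub> x0)" using lt_mult_left[of x0 "\<one>\<^bsub>G\<^esub>" "inv\<^bsub>G\<^esub> x0"] x0y by simp
    moreover have "s (inv\<^bsub>G\<^esub> x0) = inv\<^bsub>G\<^esub> (s x0)" using s_inv x0y by simp
    ultimately show ?thesis
      using that[of "inv\<^bsub>G\<^esub> x0"] p.heisenberg_pair_inv[OF hp0] st0 commute_inv x0y by auto
  qed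
  obtain L deg where gr: "graded G lt L deg x" and y: "y \<in> L" "deg y = 1"
    and L0: "\<And>g. g \<in> carrier G \<Longrightarrow> \<phi> g \<otimes>\<^bsub>Q\<^esub> \<phi> y = \<phi> y \<otimes>\<^bsub>Q\<^esub> \<phi> g \<Longrightarrow> x \<otimes>\<^bsub>G\<^esub> g = g \<otimes>\<^bsub>G\<^esub> x \<Longrightarrow> g \<in> L \<and> deg g = 0"
    by (rule graded_exists[OF og Q hp pos]) (rule that; assumption)
  interpret gr: star_graded G lt s \<sigma> "TYPE('k)" L deg x
    using gr star_field_axioms by (simp add: star_graded_def)
  note pair = p.heisenberg_pair_noncommuting[OF hp]
  from st show ?thesis
  proof (elim disjE conjE)
    assume "s x = x" "s y = y"
    then show ?thesis by (rule gr.free_pair_symmetric[OF assms(1) y pair])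
  next
    assume "s x = inv\<^bsub>G\<^esub> x" "s y = inv\<^bsub>G\<^esub> y"
    then show ?thesis by (rule gr.free_pair_inverted[OF assms(1) y pair])
  next
    assume "s x = x" "\<phi> (y \<otimes>\<^bsub>G\<^esub> s y) \<otimes>\<^bsub>Q\<^esub> \<phi> y = \<phi> y \<otimes>\<^bsub>Q\<^esub> \<phi> (y \<otimes>\<^bsub>G\<^esub> s y)"
      and c: "x \<otimes>\<^bsub>G\<^esub> (y \<otimes>\<^bsub>G\<^esub> s y) = (y \<otimes>\<^bsub>G\<^esub> s y) \<otimes>\<^bsub>G\<^esub> x" "x \<otimes>\<^bsub>G\<^esub> (s y \<otimes>\<^bsub>G\<^esub> y) = (s y \<otimes>\<^bsub>G\<^esub> y) \<otimes>\<^bsub>G\<^esub> x"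
    moreover then have "y \<otimes>\<^bsub>G\<^esub> s y \<in> L \<and> deg (y \<otimes>\<^bsub>G\<^esub> s y) = 0" using L0 x0y by simp
    ultimately show ?thesis by (intro gr.free_pair_mixed[OF assms(1) y pair]) auto
  qed
qed

end
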